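(* Let $p\in\mathbb C$, $p\ne0$, and let $M$ be a nontrivial finite irreducible conformal module over $\mathfrak K(p)$. (1) If $p\neq -1$, then, up to parity change, $M$ is isomorphic to $V^{(1)}_{\Delta,\alpha}$ or $V^{(2)}_{\Delta,\alpha}$ for some $\Delta,\alpha\in\mathbb C$ with $\Delta\neq 0$, or to $V_{\Delta,\Lambda,\alpha}$ for some $\Delta,\Lambda,\alpha\in\mathbb C$ with $2\Delta+\Lambda\neq0$ and $2\Delta-\Lambda\ne 0$. (2) If $p=-1$, then, up to parity change, $M$ is isomorphic to $V^{(1)}_{\Delta,\alpha}$ or $V^{(2)}_{\Delta,\alpha}$ for some $\Delta,\alpha\in\mathbb C$ with $\Delta\ne 0$, or to $V_{\Delta,\Lambda,\alpha,\beta}$ for some $\Delta,\Lambda,\alpha,\beta\in\mathbb C$ with $(2\Delta+\Lambda,\beta)\ne(0,0)$ and $(2\Delta-\Lambda,\beta)\neq(0,0)$.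
   Context: A Lie conformal superalgebra is a $\mathbb Z/2\mathbb Z$-graded $\mathbb C[\partial]$-module $R=R_{\bar0}\oplus R_{\bar1}$ with a (parity-preserving) $\mathbb C$-linear $\lambda$-bracket $R\otimes R\to\mathbb C[\lambda]\otimes R$, $a\otimes b\mapsto[a\,{}_\lambda\, b]$, such that $[\partial a\,{}_\lambda\, b]=-\lambda[a\,{}_\lambda\, b]$, $[a\,{}_\lambda\,\partial b]=(\partial+\lambda)[a\,{}_\lambda\, b]$, $[a\,{}_\lambda\, b]=-(-1)^{|a||b|}[b\,{}_{-\lambda-\partial}\,a]$, $[a\,{}_\lambda[b\,{}_\mu c]]=[[a\,{}_\lambda b]\,{}_{\lambda+\mu}c]+(-1)^{|a||b|}[b\,{}_\mu[a\,{}_\lambda c]]$. A conformal $R$-module is a $\mathbb Z/2\mathbb Z$-graded $\mathbb C[\partial]$-module $M=M_{\bar0}\oplus M_{\bar1}$ with a (parity-preserving) $\mathbb C$-linear $\lambda$-action $R\otimes M\to\mathbb C[\lambda]\otimes M$, $a\otimes v\mapsto a\,{}_\lambda v$, such that $(\partial a)\,{}_\lambda v=-\lambda\, a\,{}_\lambda v$, $a\,{}_\lambda(\partial v)=(\partial+\lambda)a\,{}_\lambda v$, $[a\,{}_\lambda b]\,{}_{\lambda+\mu}v=a\,{}_\lambda(b\,{}_\mu v)-(-1)^{|a||b|}b\,{}_\mu(a\,{}_\lambda v)$. It is finite if finitely generated over $\mathbb C[\partial]$, and nontrivial if the $\lambda$-action is not identically zero. "$M$ is isomorphic to $V$ up to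 parity change" means $M\cong V$ or $M$ is isomorphic to $V$ with reversed parity. For nonzero $p\in\mathbb C$, $\mathfrak K(p)$ is the Lie conformal superalgebra whose even part has $\mathbb C[\partial]$-basis $\{L_i,J_i\mid i\in\mathbb Z_+\}$ and odd part has $\mathbb C[\partial]$-basis $\{G_i^\pm\mid i\in\mathbb Z_+\}$ ($\mathbb Z_+=\{0,1,2,\dots\}$), with $[L_i\,{}_\lambda L_j]=((i+p)\partial+(i+j+2p)\lambda)L_{i+j}$, $[L_i\,{}_\lambda J_j]=((i+p)\partial+(i+j+p)\lambda)J_{i+j}$, $[L_i\,{}_\lambda G^\pm_j]=((i+p)\partial+(i+j+\frac32p)\lambda)G^\pm_{i+j}$, $[J_i\,{}_\lambda G^\pm_j]=\pm G^\pm_{i+j}$, $[G^+_i\,{}_\lambda G^-_j]=((2i+p)\partial+2(i+j+p)\lambda)J_{i+j}+2L_{i+j}$, the other brackets of basis elements being given by skew-symmetry or zero. Fix a square root $\sqrt p$ of $p$ (so $\sqrt p=\sqrt{-1}$ when $p=-1$). The following are conformal $\mathfrak K(p)$-modules, free over $\mathbb C[\partial]$; subscripts $\bar0,\bar1$ of basis vectors denote parity; $\Delta,\Lambda,\alpha,\beta\in\mathbb C$. $V^{(1)}_{\Delta,\alpha}=\mathbb C[\partial]v_{\bar0}\oplus\mathbb C[\partial]v_{\bar1}$: $L_0\,{}_\lambda v_{\bar0}=p(\partial+\Delta\lambda+\alpha)v_{\bar0}$, $L_0\,{}_\lambda v_{\bar1}=p(\partial+(\Delta+\frac12)\lambda+\alpha)v_{\bar1}$,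 $J_0\,{}_\lambda v_{\bar0}=-2\Delta v_{\bar0}$, $J_0\,{}_\lambda v_{\bar1}=(1-2\Delta)v_{\bar1}$, $G_0^+\,{}_\lambda v_{\bar0}=\sqrt p\,v_{\bar1}$, $G_0^+\,{}_\lambda v_{\bar1}=0$, $G_0^-\,{}_\lambda v_{\bar0}=0$, $G_0^-\,{}_\lambda v_{\bar1}=2\sqrt p(\partial+2\Delta\lambda+\alpha)v_{\bar0}$; $L_i,J_i,G_i^\pm$ act as zero for $i\ge1$. $V^{(2)}_{\Delta,\alpha}=\mathbb C[\partial]v_{\bar0}\oplus\mathbb C[\partial]v_{\bar1}$: $L_0\,{}_\lambda v_{\bar0}=p(\partial+\Delta\lambda+\alpha)v_{\bar0}$, $L_0\,{}_\lambda v_{\bar1}=p(\partial+(\Delta+\frac12)\lambda+\alpha)v_{\bar1}$, $J_0\,{}_\lambda v_{\bar0}=2\Delta v_{\bar0}$, $J_0\,{}_\lambda v_{\bar1}=(2\Delta-1)v_{\bar1}$, $G_0^+\,{}_\lambda v_{\bar0}=0$, $G_0^+\,{}_\lambda v_{\bar1}=2\sqrt p(\partial+2\Delta\lambda+\alpha)v_{\bar0}$, $G_0^-\,{}_\lambda v_{\bar0}=\sqrt p\,v_{\bar1}$, $G_0^-\,{}_\lambda v_{\bar1}=0$; $L_i,J_i,G_i^\pm$ act as zero for $i\ge1$. $V_{\Delta,\Lambda,\alpha}=\mathbb C[\partial]v_{\bar0}^{(1)}\oplus\mathbb C[\partial]v_{\bar0}^{(2)}\oplus\mathbb C[\partial]v_{\bar1}^{(1)}\oplus\mathbb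 C[\partial]v_{\bar1}^{(2)}$: $L_0\,{}_\lambda v_{\bar0}^{(1)}=p(\partial+\Delta\lambda+\alpha)v_{\bar0}^{(1)}$, $L_0\,{}_\lambda v_{\bar0}^{(2)}=p(\partial+(\Delta+1)\lambda+\alpha)v_{\bar0}^{(2)}+p(\Delta+\frac\Lambda2)\lambda^2v_{\bar0}^{(1)}$, $L_0\,{}_\lambda v_{\bar1}^{(\ell)}=p(\partial+(\Delta+\frac12)\lambda+\alpha)v_{\bar1}^{(\ell)}$ ($\ell=1,2$); $J_0\,{}_\lambda v_{\bar0}^{(1)}=\Lambda v_{\bar0}^{(1)}$, $J_0\,{}_\lambda v_{\bar0}^{(2)}=\Lambda v_{\bar0}^{(2)}+(2\Delta+\Lambda)\lambda v_{\bar0}^{(1)}$, $J_0\,{}_\lambda v_{\bar1}^{(1)}=(\Lambda+1)v_{\bar1}^{(1)}$, $J_0\,{}_\lambda v_{\bar1}^{(2)}=(\Lambda-1)v_{\bar1}^{(2)}$; $G_0^+\,{}_\lambda v_{\bar0}^{(1)}=\sqrt p\,v_{\bar1}^{(1)}$, $G_0^+\,{}_\lambda v_{\bar1}^{(1)}=0$, $G_0^+\,{}_\lambda v_{\bar0}^{(2)}=-\sqrt p(2\Delta+\Lambda)\lambda v_{\bar1}^{(1)}$, $G_0^+\,{}_\lambda v_{\bar1}^{(2)}=\sqrt p(2\Delta+\Lambda)\lambda v_{\bar0}^{(1)}+\sqrt p\,v_{\bar0}^{(2)}$; $G_0^-\,{}_\lambda v_{\bar0}^{(1)}=\sqrt p\,v_{\bar1}^{(2)}$,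 $G_0^-\,{}_\lambda v_{\bar1}^{(1)}=\sqrt p(2\partial+(2\Delta-\Lambda)\lambda+2\alpha)v_{\bar0}^{(1)}-\sqrt p\,v_{\bar0}^{(2)}$, $G_0^-\,{}_\lambda v_{\bar0}^{(2)}=\sqrt p(2\partial+(2\Delta-\Lambda+2)\lambda+2\alpha)v_{\bar1}^{(2)}$, $G_0^-\,{}_\lambda v_{\bar1}^{(2)}=0$; $L_i,J_i,G_i^\pm$ act as zero for $i\ge1$. $V_{\Delta,\Lambda,\alpha,\beta}$ (only for $p=-1$): same underlying $\mathbb C[\partial]$-module and same actions of $L_0,J_0,G_0^\pm$ as $V_{\Delta,\Lambda,\alpha}$ with $p=-1$; $L_1\,{}_\lambda v=-\frac{\sqrt{-1}}2\beta v$ for $v=v_{\bar0}^{(1)},v_{\bar1}^{(1)},v_{\bar1}^{(2)}$, $L_1\,{}_\lambda v_{\bar0}^{(2)}=-\frac{\sqrt{-1}}2\beta(v_{\bar0}^{(2)}+\lambda v_{\bar0}^{(1)})$; $J_1\,{}_\lambda v_{\bar0}^{(2)}=\sqrt{-1}\,\beta v_{\bar0}^{(1)}$; $G_1^+\,{}_\lambda v_{\bar0}^{(2)}=\beta v_{\bar1}^{(1)}$, $G_1^+\,{}_\lambda v_{\bar1}^{(2)}=-\beta v_{\bar0}^{(1)}$; $G_1^-\,{}_\lambda v_{\bar1}^{(1)}=-\beta v_{\bar0}^{(1)}$, $G_1^-\,{}_\lambda v_{\bar0}^{(2)}=-\beta v_{\bar1}^{(2)}$; $J_1,G_1^\pm$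 act as zero on the remaining basis vectors; $L_i,J_i,G_i^\pm$ act as zero for $i\ge2$. *)

theory Defs
  imports
    Complex_Main
    "HOL-Library.Z2"
    "HOL-Library.Poly_Mapping"
    "HOL-Computational_Algebra.Polynomial"
begin

section \<open>Graded modules over the polynomial ring in the derivation\<close>

text \<open>
  The ring of complex polynomials in the derivation is \<^typ>\<open>complex poly\<close>, and a module over it
  is an instance of the library locale \<^locale>\<open>module\<close> whose underlying set is a whole type.
  Parities are elements of the type \<^typ>\<open>bit\<close> of integers modulo 2.
\<close>

record 'm graded_module =
  smul :: "complex poly \<Rightarrow> 'm \<Rightarrow> 'm"
  part :: "bit \<Rightarrow> 'm set"

definition deriv_op :: "(complex poly \<Rightarrow> 'm \<Rightarrow> 'm) \<Rightarrow> 'm \<Rightarrow> 'm"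
  where "deriv_op sm = sm [:0, 1:]"

definition cmul :: "(complex poly \<Rightarrow> 'm \<Rightarrow> 'm) \<Rightarrow> complex \<Rightarrow> 'm \<Rightarrow> 'm"
  where "cmul sm c = sm [:c:]"

locale graded_module =
  fixes M :: "('m::ab_group_add, 'z) graded_module_scheme"
  assumes module: "module (smul M)"
    and subspace_part: "module.subspace (smul M) (part M i)"
    and part_Int: "part M 0 \<inter> part M 1 = {0}"
    and part_sum: "\<exists>x0\<in>part M 0. \<exists>x1\<in>part M 1. x = x0 + x1"

definition koszul :: "bit \<Rightarrow> bit \<Rightarrow> 'a::ab_group_add \<Rightarrow> 'a"
  where "koszul i j x = (if i * j = 1 then - x else x)"


section \<open>Polynomials with coefficients in a module\<close>

text \<open>
  The module of polynomials in \<open>\<lambda>\<close> with coefficients in \<open>M\<close> is \<^typ>\<open>'m poly\<close>. Polynomials in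
  two variables \<open>\<lambda>\<close>, \<open>\<mu>\<close> are elements of \<^typ>\<open>'m poly poly\<close>; the inner variable is \<open>\<lambda>\<close> and the
  outer one is \<open>\<mu>\<close>.

  For \<open>P = (\<Sum>k. \<lambda>^k c\<^sub>k)\<close>, an additive operator \<open>T\<close> and a map \<open>f\<close>, the value \<open>subst T f P\<close> is
  \<open>\<Sum>k. T^k (f c\<^sub>k)\<close>: every coefficient is replaced by its image under \<open>f\<close>, and the variable by \<open>T\<close>.
\<close>

definition subst :: "('b \<Rightarrow> 'b) \<Rightarrow> ('a \<Rightarrow> 'b) \<Rightarrow> 'a::zero poly \<Rightarrow> 'b::comm_monoid_add"
  where "subst T f P = (\<Sum>k\<le>degree P. (T ^^ k) (f (coeff P k)))"

abbreviation mul_lam :: "'m::zero poly \<Rightarrow> 'm poly"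
  where "mul_lam \<equiv> pCons 0"

definition deriv_plus_lam ::
  "(complex poly \<Rightarrow> 'm \<Rightarrow> 'm::comm_monoid_add) \<Rightarrow> 'm poly \<Rightarrow> 'm poly"
  where "deriv_plus_lam sm P = map_poly (deriv_op sm) P + mul_lam P"

text \<open>The substitution \<open>P(\<lambda>) \<mapsto> P(-\<lambda>-\<partial>)\<close>, where \<open>\<partial>\<close> acts on the coefficients.\<close>

definition reflect :: "(complex poly \<Rightarrow> 'm \<Rightarrow> 'm::ab_group_add) \<Rightarrow> 'm poly \<Rightarrow> 'm poly"
  where "reflect sm = subst (\<lambda>Q. - deriv_plus_lam sm Q) (\<lambda>x. [:x:])"

abbreviation mul1 :: "'m::zero poly poly \<Rightarrow> 'm poly poly"
  where "mul1 \<equiv> map_poly (pCons 0)"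

abbreviation mul2 :: "'m::zero poly poly \<Rightarrow> 'm poly poly"
  where "mul2 \<equiv> pCons 0"

abbreviation mul12 :: "'m::comm_monoid_add poly poly \<Rightarrow> 'm poly poly"
  where "mul12 Q \<equiv> mul1 Q + mul2 Q"

text \<open>
  The operators \<open>mul1\<close>, \<open>mul2\<close>, \<open>mul12\<close> are the multiplications by \<open>\<lambda>\<close>, \<open>\<mu>\<close>, \<open>\<lambda>+\<mu>\<close>. For a
  polynomial \<open>P\<close> in one variable and an operation \<open>f\<close> with values in polynomials, \<open>nest S T f P\<close>
  applies \<open>f\<close> to the coefficients of \<open>P\<close> and puts \<open>S\<close> for the variable of \<open>P\<close> and \<open>T\<close> for that of
  the values of \<open>f\<close>. With \<open>B a b\<close> for the bracket of \<open>a\<close> and \<open>b\<close>, the three terms of the Jacobi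
  identity \<open>[a\<^sub>\<lambda>[b\<^sub>\<mu> c]]\<close>, \<open>[[a\<^sub>\<lambda> b]\<^bsub>\<lambda>+\<mu>\<^esub> c]\<close>, \<open>[b\<^sub>\<mu>[a\<^sub>\<lambda> c]]\<close> are \<open>nest mul2 mul1 (B a) (B b c)\<close>,
  \<open>nest mul1 mul12 (\<lambda>x. B x c) (B a b)\<close>, \<open>nest mul1 mul2 (B b) (B a c)\<close>.
\<close>

definition nest :: "('m poly poly \<Rightarrow> 'm poly poly) \<Rightarrow> ('m poly poly \<Rightarrow> 'm poly poly) \<Rightarrow>
    ('r::zero \<Rightarrow> 'm::comm_monoid_add poly) \<Rightarrow> 'r poly \<Rightarrow> 'm poly poly"
  where "nest S T f P = subst S (\<lambda>x. subst T (\<lambda>y. [:[:y:]:]) (f x)) P"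


section \<open>Lie conformal superalgebras and conformal modules\<close>

record (overloaded) ('r::zero) conf_alg = "'r graded_module" +
  bracket :: "'r \<Rightarrow> 'r \<Rightarrow> 'r poly"

locale sesquilinear_action =
  R: graded_module R + M: graded_module M
  for R :: "('r::ab_group_add, 'y) graded_module_scheme"
    and M :: "('m::ab_group_add, 'z) graded_module_scheme" +
  fixes f :: "'r \<Rightarrow> 'm \<Rightarrow> 'm poly"
  assumes add_left: "f (a + b) v = f a v + f b v"
    and add_right: "f a (v + w) = f a v + f a w"
    and cmul_left: "f (cmul (smul R) c a) v = map_poly (cmul (smul M) c) (f a v)"
    and cmul_right: "f a (cmul (smul M) c v) = map_poly (cmul (smul M) c) (f a v)"
    and deriv_left: "f (deriv_op (smul R) a) v = - mul_lam (f a v)"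
    and deriv_right: "f a (deriv_op (smul M) v) = deriv_plus_lam (smul M) (f a v)"
    and parity: "a \<in> part R i \<Longrightarrow> v \<in> part M j \<Longrightarrow> coeff (f a v) n \<in> part M (i + j)"

locale lie_conformal_superalgebra =
  sesquilinear_action R R "bracket R"
  for R :: "('r::ab_group_add, 'z) conf_alg_scheme" +
  assumes skew: "a \<in> part R i \<Longrightarrow> b \<in> part R j \<Longrightarrow>
      bracket R a b = - koszul i j (reflect (smul R) (bracket R b a))"
    and jacobi: "a \<in> part R i \<Longrightarrow> b \<in> part R j \<Longrightarrow>
      nest mul2 mul1 (bracket R a) (bracket R b c) =
        nest mul1 mul12 (\<lambda>x. bracket R x c) (bracket R a b)
        + koszul i j (nest mul1 mul2 (bracket R b) (bracket R a c))"

record (overloaded) ('r, 'm::zero) conf_mod = "'m graded_module" +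
  act :: "'r \<Rightarrow> 'm \<Rightarrow> 'm poly"

locale conformal_module =
  R: lie_conformal_superalgebra R + sesquilinear_action R M "act M"
  for R :: "('r::ab_group_add, 'y) conf_alg_scheme"
    and M :: "('r, 'm::ab_group_add, 'z) conf_mod_scheme" +
  assumes act_bracket: "a \<in> part R i \<Longrightarrow> b \<in> part R j \<Longrightarrow>
      nest mul1 mul12 (\<lambda>x. act M x v) (bracket R a b) =
        nest mul2 mul1 (act M a) (act M b v)
        - koszul i j (nest mul1 mul2 (act M b) (act M a v))"

definition finite_module :: "('m::ab_group_add, 'z) graded_module_scheme \<Rightarrow> bool"
  where "finite_module M \<longleftrightarrow> (\<exists>S. finite S \<and> module.span (smul M) S = UNIV)"

definition nontrivial_module :: "('r, 'm::zero, 'z) conf_mod_scheme \<Rightarrow> bool"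
  where "nontrivial_module M \<longleftrightarrow> (\<exists>a v. act M a v \<noteq> 0)"

text \<open>Submodules are taken in the category of superspaces, that is, they are graded.\<close>

definition conformal_submodule :: "('r, 'm::ab_group_add, 'z) conf_mod_scheme \<Rightarrow> 'm set \<Rightarrow> bool"
  where "conformal_submodule M N \<longleftrightarrow>
    module.subspace (smul M) N \<and>
    (\<forall>x\<in>N. \<exists>x0\<in>N \<inter> part M 0. \<exists>x1\<in>N \<inter> part M 1. x = x0 + x1) \<and>
    (\<forall>a. \<forall>x\<in>N. \<forall>n. coeff (act M a x) n \<in> N)"

definition irreducible_module :: "('r, 'm::ab_group_add, 'z) conf_mod_scheme \<Rightarrow> bool"
  where "irreducible_module M \<longleftrightarrow>
    (UNIV :: 'm set) \<noteq> {0} \<and> (\<forall>N. conformal_submodule M N \<longrightarrow> N = {0} \<or> N = UNIV)"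

definition isomorphic ::
  "('r, 'm::ab_group_add, 'y) conf_mod_scheme \<Rightarrow> ('r, 'n::ab_group_add, 'z) conf_mod_scheme \<Rightarrow> bool"
  where "isomorphic M V \<longleftrightarrow> (\<exists>\<phi>. bij \<phi> \<and> module_hom (smul M) (smul V) \<phi> \<and>
    (\<forall>i. \<phi> ` part M i = part V i) \<and>
    (\<forall>a v. act V a (\<phi> v) = map_poly \<phi> (act M a v)))"

definition parity_change :: "('r, 'm::zero, 'z) conf_mod_scheme \<Rightarrow> ('r, 'm, 'z) conf_mod_scheme"
  where "parity_change M = M\<lparr>part := \<lambda>i. part M (i + 1)\<rparr>"

definition isomorphic_upto_parity ::
  "('r, 'm::ab_group_add, 'y) conf_mod_scheme \<Rightarrow> ('r, 'n::ab_group_add, 'z) conf_mod_scheme \<Rightarrow> bool"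
  where "isomorphic_upto_parity M V \<longleftrightarrow> isomorphic M V \<or> isomorphic M (parity_change V)"


section \<open>Free modules and sesquilinear extension\<close>

text \<open>
  The free module whose basis is the whole type \<^typ>\<open>'b\<close> consists of the finitely supported
  functions from \<^typ>\<open>'b\<close> to \<^typ>\<open>complex poly\<close>; a function \<open>par\<close> gives the parities of the basis.
\<close>

type_synonym 'b free = "'b \<Rightarrow>\<^sub>0 complex poly"

definition free_smul :: "complex poly \<Rightarrow> 'b free \<Rightarrow> 'b free"
  where "free_smul q = Poly_Mapping.map ((*) q)"

definition free_part :: "('b \<Rightarrow> bit) \<Rightarrow> bit \<Rightarrow> 'b free set"
  where "free_part par i = {x. \<forall>b\<in>Poly_Mapping.keys x. par b = i}"

text \<open>
  The extension of a function \<open>f\<close> on pairs of basis elements to an operation on the free modules: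
  \<open>q(\<partial>)a\<close> and \<open>r(\<partial>)b\<close> are sent to \<open>q(-\<lambda>) r(\<partial>+\<lambda>)\<close> applied to \<open>f a b\<close>.
\<close>

definition extend :: "('a \<Rightarrow> 'b \<Rightarrow> 'b free poly) \<Rightarrow> 'a free \<Rightarrow> 'b free \<Rightarrow> 'b free poly"
  where "extend f x y =
    (\<Sum>a\<in>Poly_Mapping.keys x. \<Sum>b\<in>Poly_Mapping.keys y.
      subst (\<lambda>Q. - mul_lam Q)
        (\<lambda>c. subst (deriv_plus_lam free_smul)
          (\<lambda>d. map_poly (free_smul [:c * d:]) (f a b))
          (Poly_Mapping.lookup y b))
        (Poly_Mapping.lookup x a))"

text \<open>
  \<open>t \<odot> b\<close> is the multiple of the basis element \<open>b\<close> by a polynomial \<open>t\<close> in \<open>\<partial>\<close> and \<open>\<lambda>\<close>, given as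
  a polynomial in \<open>\<lambda>\<close> with coefficients in \<^typ>\<open>complex poly\<close>.
\<close>

definition term_of_basis :: "complex poly poly \<Rightarrow> 'b \<Rightarrow> 'b free poly"  (infix \<open>\<odot>\<close> 70)
  where "t \<odot> b = map_poly (Poly_Mapping.single b) t"

abbreviation cst :: "complex \<Rightarrow> complex poly poly"
  where "cst c \<equiv> [:[:c:]:]"

abbreviation dd :: "complex poly poly"
  where "dd \<equiv> [:[:0, 1:]:]"

abbreviation ll :: "complex poly poly"
  where "ll \<equiv> [:0, 1:]"


section \<open>The Lie conformal superalgebra\<close>

datatype gen = L nat | J nat | Gp nat | Gm nat

fun gen_parity :: "gen \<Rightarrow> bit"
  where
    "gen_parity (L i) = 0"
  | "gen_parity (J i) = 0"
  | "gen_parity (Gp i) = 1"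
  | "gen_parity (Gm i) = 1"

fun gen_rank :: "gen \<Rightarrow> nat"
  where
    "gen_rank (L i) = 0"
  | "gen_rank (J i) = 1"
  | "gen_rank (Gp i) = 2"
  | "gen_rank (Gm i) = 3"

fun K_bracket0 :: "complex \<Rightarrow> gen \<Rightarrow> gen \<Rightarrow> gen free poly"
  where
    "K_bracket0 p (L i) (L j) =
      (cst (of_nat i + p) * dd + cst (of_nat i + of_nat j + 2 * p) * ll) \<odot> L (i + j)"
  | "K_bracket0 p (L i) (J j) =
      (cst (of_nat i + p) * dd + cst (of_nat i + of_nat j + p) * ll) \<odot> J (i + j)"
  | "K_bracket0 p (L i) (Gp j) =
      (cst (of_nat i + p) * dd + cst (of_nat i + of_nat j + 3/2 * p) * ll) \<odot> Gp (i + j)"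
  | "K_bracket0 p (L i) (Gm j) =
      (cst (of_nat i + p) * dd + cst (of_nat i + of_nat j + 3/2 * p) * ll) \<odot> Gm (i + j)"
  | "K_bracket0 p (J i) (Gp j) = cst 1 \<odot> Gp (i + j)"
  | "K_bracket0 p (J i) (Gm j) = cst (- 1) \<odot> Gm (i + j)"
  | "K_bracket0 p (Gp i) (Gm j) =
      (cst (2 * of_nat i + p) * dd + cst (2 * (of_nat i + of_nat j + p)) * ll) \<odot> J (i + j)
      + cst 2 \<odot> L (i + j)"
  | "K_bracket0 p _ _ = 0"

text \<open>
  The function \<^const>\<open>K_bracket0\<close> prescribes the bracket of two basis elements in nondecreasing
  order of \<^const>\<open>gen_rank\<close>; the bracket in the opposite order is determined by skew-symmetry.
\<close>

definition K_bracket :: "complex \<Rightarrow> gen \<Rightarrow> gen \<Rightarrow> gen free poly"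
  where "K_bracket p a b =
    (if gen_rank a \<le> gen_rank b then K_bracket0 p a b
     else - koszul (gen_parity a) (gen_parity b) (reflect free_smul (K_bracket0 p b a)))"

definition K_alg :: "complex \<Rightarrow> gen free conf_alg"
  where "K_alg p = \<lparr>smul = free_smul, part = free_part gen_parity, bracket = extend (K_bracket p)\<rparr>"


section \<open>The modules\<close>

text \<open>In this section \<open>s\<close> denotes the chosen square root of \<open>p\<close>.\<close>

datatype basis2 = v0 | v1

fun basis2_parity :: "basis2 \<Rightarrow> bit"
  where
    "basis2_parity v0 = 0"
  | "basis2_parity v1 = 1"

fun V1_act :: "complex \<Rightarrow> complex \<Rightarrow> complex \<Rightarrow> complex \<Rightarrow> gen \<Rightarrow> basis2 \<Rightarrow> basis2 free poly"
  where
    "V1_act p s \<Delta> \<alpha> (L 0) v0 = (cst p * (dd + cst \<Delta> * ll + cst \<alpha>)) \<odot> v0"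
  | "V1_act p s \<Delta> \<alpha> (L 0) v1 = (cst p * (dd + cst (\<Delta> + 1/2) * ll + cst \<alpha>)) \<odot> v1"
  | "V1_act p s \<Delta> \<alpha> (J 0) v0 = cst (- 2 * \<Delta>) \<odot> v0"
  | "V1_act p s \<Delta> \<alpha> (J 0) v1 = cst (1 - 2 * \<Delta>) \<odot> v1"
  | "V1_act p s \<Delta> \<alpha> (Gp 0) v0 = cst s \<odot> v1"
  | "V1_act p s \<Delta> \<alpha> (Gp 0) v1 = 0"
  | "V1_act p s \<Delta> \<alpha> (Gm 0) v0 = 0"
  | "V1_act p s \<Delta> \<alpha> (Gm 0) v1 = (cst (2 * s) * (dd + cst (2 * \<Delta>) * ll + cst \<alpha>)) \<odot> v0"
  | "V1_act p s \<Delta> \<alpha> _ _ = 0"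

fun V2_act :: "complex \<Rightarrow> complex \<Rightarrow> complex \<Rightarrow> complex \<Rightarrow> gen \<Rightarrow> basis2 \<Rightarrow> basis2 free poly"
  where
    "V2_act p s \<Delta> \<alpha> (L 0) v0 = (cst p * (dd + cst \<Delta> * ll + cst \<alpha>)) \<odot> v0"
  | "V2_act p s \<Delta> \<alpha> (L 0) v1 = (cst p * (dd + cst (\<Delta> + 1/2) * ll + cst \<alpha>)) \<odot> v1"
  | "V2_act p s \<Delta> \<alpha> (J 0) v0 = cst (2 * \<Delta>) \<odot> v0"
  | "V2_act p s \<Delta> \<alpha> (J 0) v1 = cst (2 * \<Delta> - 1) \<odot> v1"
  | "V2_act p s \<Delta> \<alpha> (Gp 0) v0 = 0"
  | "V2_act p s \<Delta> \<alpha> (Gp 0) v1 = (cst (2 * s) * (dd + cst (2 * \<Delta>) * ll + cst \<alpha>)) \<odot> v0"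
  | "V2_act p s \<Delta> \<alpha> (Gm 0) v0 = cst s \<odot> v1"
  | "V2_act p s \<Delta> \<alpha> (Gm 0) v1 = 0"
  | "V2_act p s \<Delta> \<alpha> _ _ = 0"

text \<open>
  In \<open>basis4\<close>, the elements \<open>u1\<close>, \<open>u2\<close> are the even basis vectors with superscripts 1, 2, and
  \<open>w1\<close>, \<open>w2\<close> the odd ones.
\<close>

datatype basis4 = u1 | u2 | w1 | w2

fun basis4_parity :: "basis4 \<Rightarrow> bit"
  where
    "basis4_parity u1 = 0"
  | "basis4_parity u2 = 0"
  | "basis4_parity w1 = 1"
  | "basis4_parity w2 = 1"

fun V4_act :: "complex \<Rightarrow> complex \<Rightarrow> complex \<Rightarrow> complex \<Rightarrow> complex \<Rightarrow> gen \<Rightarrow> basis4 \<Rightarrow> basis4 free poly"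
  where
    "V4_act p s \<Delta> \<Lambda> \<alpha> (L 0) u1 = (cst p * (dd + cst \<Delta> * ll + cst \<alpha>)) \<odot> u1"
  | "V4_act p s \<Delta> \<Lambda> \<alpha> (L 0) u2 =
      (cst p * (dd + cst (\<Delta> + 1) * ll + cst \<alpha>)) \<odot> u2 + (cst (p * (\<Delta> + \<Lambda> / 2)) * ll^2) \<odot> u1"
  | "V4_act p s \<Delta> \<Lambda> \<alpha> (L 0) w1 = (cst p * (dd + cst (\<Delta> + 1/2) * ll + cst \<alpha>)) \<odot> w1"
  | "V4_act p s \<Delta> \<Lambda> \<alpha> (L 0) w2 = (cst p * (dd + cst (\<Delta> + 1/2) * ll + cst \<alpha>)) \<odot> w2"
  | "V4_act p s \<Delta> \<Lambda> \<alpha> (J 0) u1 = cst \<Lambda> \<odot> u1"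
  | "V4_act p s \<Delta> \<Lambda> \<alpha> (J 0) u2 = cst \<Lambda> \<odot> u2 + (cst (2 * \<Delta> + \<Lambda>) * ll) \<odot> u1"
  | "V4_act p s \<Delta> \<Lambda> \<alpha> (J 0) w1 = cst (\<Lambda> + 1) \<odot> w1"
  | "V4_act p s \<Delta> \<Lambda> \<alpha> (J 0) w2 = cst (\<Lambda> - 1) \<odot> w2"
  | "V4_act p s \<Delta> \<Lambda> \<alpha> (Gp 0) u1 = cst s \<odot> w1"
  | "V4_act p s \<Delta> \<Lambda> \<alpha> (Gp 0) w1 = 0"
  | "V4_act p s \<Delta> \<Lambda> \<alpha> (Gp 0) u2 = (cst (- s * (2 * \<Delta> + \<Lambda>)) * ll) \<odot> w1"
  | "V4_act p s \<Delta> \<Lambda> \<alpha> (Gp 0) w2 = (cst (s * (2 * \<Delta> + \<Lambda>)) * ll) \<odot> u1 + cst s \<odot> u2"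
  | "V4_act p s \<Delta> \<Lambda> \<alpha> (Gm 0) u1 = cst s \<odot> w2"
  | "V4_act p s \<Delta> \<Lambda> \<alpha> (Gm 0) w1 =
      (cst s * (cst 2 * dd + cst (2 * \<Delta> - \<Lambda>) * ll + cst (2 * \<alpha>))) \<odot> u1 + cst (- s) \<odot> u2"
  | "V4_act p s \<Delta> \<Lambda> \<alpha> (Gm 0) u2 =
      (cst s * (cst 2 * dd + cst (2 * \<Delta> - \<Lambda> + 2) * ll + cst (2 * \<alpha>))) \<odot> w2"
  | "V4_act p s \<Delta> \<Lambda> \<alpha> (Gm 0) w2 = 0"
  | "V4_act p s \<Delta> \<Lambda> \<alpha> _ _ = 0"

text \<open>The actions of the generators of index 1 for \<open>p = -1\<close>, where \<open>s\<close> is a square root of \<open>-1\<close>.\<close>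

fun V4b_act :: "complex \<Rightarrow> complex \<Rightarrow> complex \<Rightarrow> complex \<Rightarrow> complex \<Rightarrow> gen \<Rightarrow> basis4 \<Rightarrow> basis4 free poly"
  where
    "V4b_act s \<Delta> \<Lambda> \<alpha> \<beta> (L (Suc 0)) u1 = cst (- (s / 2) * \<beta>) \<odot> u1"
  | "V4b_act s \<Delta> \<Lambda> \<alpha> \<beta> (L (Suc 0)) w1 = cst (- (s / 2) * \<beta>) \<odot> w1"
  | "V4b_act s \<Delta> \<Lambda> \<alpha> \<beta> (L (Suc 0)) w2 = cst (- (s / 2) * \<beta>) \<odot> w2"
  | "V4b_act s \<Delta> \<Lambda> \<alpha> \<beta> (L (Suc 0)) u2 =
      cst (- (s / 2) * \<beta>) \<odot> u2 + (cst (- (s / 2) * \<beta>) * ll) \<odot> u1"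
  | "V4b_act s \<Delta> \<Lambda> \<alpha> \<beta> (J (Suc 0)) u2 = cst (s * \<beta>) \<odot> u1"
  | "V4b_act s \<Delta> \<Lambda> \<alpha> \<beta> (Gp (Suc 0)) u2 = cst \<beta> \<odot> w1"
  | "V4b_act s \<Delta> \<Lambda> \<alpha> \<beta> (Gp (Suc 0)) w2 = cst (- \<beta>) \<odot> u1"
  | "V4b_act s \<Delta> \<Lambda> \<alpha> \<beta> (Gm (Suc 0)) w1 = cst (- \<beta>) \<odot> u1"
  | "V4b_act s \<Delta> \<Lambda> \<alpha> \<beta> (Gm (Suc 0)) u2 = cst (- \<beta>) \<odot> w2"
  | "V4b_act s \<Delta> \<Lambda> \<alpha> \<beta> g v = V4_act (- 1) s \<Delta> \<Lambda> \<alpha> g v"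

definition V1 :: "complex \<Rightarrow> complex \<Rightarrow> complex \<Rightarrow> complex \<Rightarrow> (gen free, basis2 free) conf_mod"
  where "V1 p s \<Delta> \<alpha> =
    \<lparr>smul = free_smul, part = free_part basis2_parity, act = extend (V1_act p s \<Delta> \<alpha>)\<rparr>"

definition V2 :: "complex \<Rightarrow> complex \<Rightarrow> complex \<Rightarrow> complex \<Rightarrow> (gen free, basis2 free) conf_mod"
  where "V2 p s \<Delta> \<alpha> =
    \<lparr>smul = free_smul, part = free_part basis2_parity, act = extend (V2_act p s \<Delta> \<alpha>)\<rparr>"

definition V4 :: "complex \<Rightarrow> complex \<Rightarrow> complex \<Rightarrow> complex \<Rightarrow> complex \<Rightarrow> (gen free, basis4 free) conf_mod"
  where "V4 p s \<Delta> \<Lambda> \<alpha> =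
    \<lparr>smul = free_smul, part = free_part basis4_parity, act = extend (V4_act p s \<Delta> \<Lambda> \<alpha>)\<rparr>"

definition V4b :: "complex \<Rightarrow> complex \<Rightarrow> complex \<Rightarrow> complex \<Rightarrow> complex \<Rightarrow> (gen free, basis4 free) conf_mod"
  where "V4b s \<Delta> \<Lambda> \<alpha> \<beta> =
    \<lparr>smul = free_smul, part = free_part basis4_parity, act = extend (V4b_act s \<Delta> \<Lambda> \<alpha> \<beta>)\<rparr>"


section \<open>The axioms hold for the algebra\<close>

text \<open>
  The locale \<^locale>\<open>conformal_module\<close> includes the assumption that the acting algebra is a Lie
  conformal superalgebra. This section proves that \<^term>\<open>K_alg p\<close> is one.
\<close>

lemma lookup_free_smul: "Poly_Mapping.lookup (free_smul q x) b = q * Poly_Mapping.lookup x b"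
  by (simp add: free_smul_def Poly_Mapping.map.rep_eq when_def)

lemma module_free_smul: "module (free_smul :: complex poly \<Rightarrow> 'b free \<Rightarrow> 'b free)"
  by unfold_locales
    (auto intro!: poly_mapping_eqI simp: lookup_free_smul lookup_add algebra_simps)

text \<open>
  An element of \<^typ>\<open>'b free poly\<close> is determined by the values of the coordinate polynomials in
  \<open>\<partial>\<close> and \<open>\<lambda>\<close> at all pairs of complex numbers \<open>d\<close>, \<open>l\<close>. On these values the operations above become
  arithmetic in the complex numbers.
\<close>

definition ev :: "'b free poly \<Rightarrow> 'b \<Rightarrow> complex \<Rightarrow> complex \<Rightarrow> complex"
  where "ev P b d l = poly (map_poly (\<lambda>x. poly (Poly_Mapping.lookup x b) d) P) l"

definition ev2 :: "'b free poly poly \<Rightarrow> 'b \<Rightarrow> complex \<Rightarrow> complex \<Rightarrow> complex \<Rightarrow> complex"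
  where "ev2 Q b d l m = poly (map_poly (\<lambda>P. ev P b d l) Q) m"

lemma map_poly_additive:
  assumes "h 0 = 0" "\<And>x y. h (x + y) = h x + h y"
  shows "map_poly h (P + Q) = map_poly h P + map_poly h Q"
  by (rule poly_eqI) (simp add: coeff_map_poly assms)

lemma ev_0 [simp]: "ev 0 b d l = 0"
  by (simp add: ev_def)

lemma ev_add [simp]: "ev (P + Q) b d l = ev P b d l + ev Q b d l"
  by (simp add: ev_def map_poly_additive lookup_add)

lemma ev_minus [simp]: "ev (- P) b d l = - ev P b d l"
  by (metis add.right_inverse add_eq_0_iff ev_0 ev_add)

lemma ev_diff [simp]: "ev (P - Q) b d l = ev P b d l - ev Q b d l"
  by (metis ev_add ev_minus diff_conv_add_uminus)

lemma ev_sum [simp]: "ev (sum f A) b d l = (\<Sum>a\<in>A. ev (f a) b d l)"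
  by (induction A rule: infinite_finite_induct) auto

lemma ev2_0 [simp]: "ev2 0 b d l m = 0"
  by (simp add: ev2_def)

lemma ev2_add [simp]: "ev2 (P + Q) b d l m = ev2 P b d l m + ev2 Q b d l m"
  by (simp add: ev2_def map_poly_additive)

lemma ev2_minus [simp]: "ev2 (- P) b d l m = - ev2 P b d l m"
  by (metis add.right_inverse add_eq_0_iff ev2_0 ev2_add)

lemma ev2_diff [simp]: "ev2 (P - Q) b d l m = ev2 P b d l m - ev2 Q b d l m"
  by (metis ev2_add ev2_minus diff_conv_add_uminus)

lemma ev_pCons [simp]: "ev (pCons x P) b d l = poly (Poly_Mapping.lookup x b) d + l * ev P b d l"
  by (simp add: ev_def map_poly_pCons)

lemma ev2_pCons [simp]: "ev2 (pCons x P) b d l m = ev x b d l + m * ev2 P b d l m"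
  by (simp add: ev2_def map_poly_pCons)

lemma ev_map:
  assumes "\<And>x. poly (Poly_Mapping.lookup (h x) b) d = t * poly (Poly_Mapping.lookup x b) d" "h 0 = 0"
  shows "ev (map_poly h P) b d l = t * ev P b d l"
proof -
  have "map_poly (\<lambda>x. poly (Poly_Mapping.lookup x b) d) (map_poly h P) = smult t (map_poly (\<lambda>x. poly (Poly_Mapping.lookup x b) d) P)"
    by (rule poly_eqI) (simp add: coeff_map_poly assms)
  thus ?thesis by (simp add: ev_def)
qed

lemma free_smul_0 [simp]: "free_smul q 0 = 0"
  by (rule poly_mapping_eqI) (simp add: lookup_free_smul)

lemma ev_smul [simp]: "ev (map_poly (free_smul q) P) b d l = poly q d * ev P b d l"
  by (rule ev_map) (simp_all add: lookup_free_smul)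

lemma ev_deriv_plus_lam [simp]: "ev (deriv_plus_lam free_smul P) b d l = (d + l) * ev P b d l"
  by (simp add: deriv_plus_lam_def deriv_op_def algebra_simps)

lemma ev2_mul1 [simp]: "ev2 (mul1 Q) b d l m = l * ev2 Q b d l m"
proof -
  have "map_poly (\<lambda>P. ev P b d l) (mul1 Q) = smult l (map_poly (\<lambda>P. ev P b d l) Q)"
    by (rule poly_eqI) (simp add: coeff_map_poly)
  thus ?thesis by (simp add: ev2_def)
qed

lemma ev_eqI:
  fixes P Q :: "'b free poly"
  assumes "\<And>b d l. ev P b d l = ev Q b d l" shows "P = Q"
proof (rule poly_eqI, rule poly_mapping_eqI)
  fix n and b :: 'b
  have "poly (Poly_Mapping.lookup (coeff P n) b) d = poly (Poly_Mapping.lookup (coeff Q n) b) d" for d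
  proof -
    have "map_poly (\<lambda>x. poly (Poly_Mapping.lookup x b) d) P = map_poly (\<lambda>x. poly (Poly_Mapping.lookup x b) d) Q"
      using assms unfolding ev_def by (intro iffD1[OF poly_eq_poly_eq_iff] ext) blast
    from arg_cong[OF this, of "\<lambda>R. coeff R n"] show ?thesis by (simp add: coeff_map_poly)
  qed
  thus "Poly_Mapping.lookup (coeff P n) b = Poly_Mapping.lookup (coeff Q n) b"
    by (intro iffD1[OF poly_eq_poly_eq_iff] ext)
qed

lemma ev2_eqI:
  fixes P Q :: "'b free poly poly"
  assumes "\<And>b d l m. ev2 P b d l m = ev2 Q b d l m" shows "P = Q"
proof (rule poly_eqI, rule ev_eqI)
  fix n b d l
  have "map_poly (\<lambda>x. ev x b d l) P = map_poly (\<lambda>x. ev x b d l) Q"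
    using assms unfolding ev2_def by (intro iffD1[OF poly_eq_poly_eq_iff] ext) blast
  from arg_cong[OF this, of "\<lambda>R. coeff R n"] show "ev (coeff P n) b d l = ev (coeff Q n) b d l"
    by (simp add: coeff_map_poly)
qed

lemma poly_map_poly_altdef:
  fixes h :: "'a::zero \<Rightarrow> complex"
  assumes "h 0 = 0"
  shows "poly (map_poly h P) z = (\<Sum>k\<le>degree P. z ^ k * h (coeff P k))"
proof -
  have "poly (map_poly h P) z = (\<Sum>k\<le>degree (map_poly h P). h (coeff P k) * z ^ k)"
    by (simp add: poly_altdef coeff_map_poly assms)
  also have "\<dots> = (\<Sum>k\<le>degree P. h (coeff P k) * z ^ k)"
  proof (intro sum.mono_neutral_left)
    have "degree (map_poly h P) \<le> degree P"
      by (rule degree_le) (simp add: coeff_map_poly coeff_eq_0 assms)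
    thus "{..degree (map_poly h P)} \<subseteq> {..degree P}" by simp
    show "\<forall>i\<in>{..degree P} - {..degree (map_poly h P)}. h (coeff P i) * z ^ i = 0"
    proof
      fix i assume "i \<in> {..degree P} - {..degree (map_poly h P)}"
      hence "coeff (map_poly h P) i = 0" by (intro coeff_eq_0) auto
      thus "h (coeff P i) * z ^ i = 0" by (simp add: coeff_map_poly assms)
    qed
  qed simp
  finally show ?thesis by (simp add: mult.commute)
qed

lemma hom_subst:
  fixes H :: "'b::comm_monoid_add \<Rightarrow> complex"
  assumes "H 0 = 0" "\<And>x y. H (x + y) = H x + H y" "\<And>x. H (T x) = t * H x"
  shows "H (subst T f P) = (\<Sum>k\<le>degree P. t ^ k * H (f (coeff P k)))"
proof -
  have "H ((T ^^ k) x) = t ^ k * H x" for k x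
    by (induction k) (simp_all add: assms)
  moreover have "H (sum g A) = (\<Sum>a\<in>A. H (g a))" for g and A :: "nat set"
    by (induction A rule: infinite_finite_induct) (auto simp: assms)
  ultimately show ?thesis by (simp add: subst_def)
qed

lemma ev_reflect [simp]: "ev (reflect free_smul P) b d l = ev P b d (- l - d)"
proof -
  have "ev (reflect free_smul P) b d l = (\<Sum>k\<le>degree P. (- l - d) ^ k * poly (Poly_Mapping.lookup (coeff P k) b) d)"
    unfolding reflect_def by (subst hom_subst[where t = "- l - d"]) (auto simp: algebra_simps)
  thus ?thesis by (simp add: ev_def poly_map_poly_altdef)
qed

lemma poly_altdef': "poly q (z::complex) = (\<Sum>k\<le>degree q. z ^ k * coeff q k)"
  by (simp add: poly_altdef mult.commute)

lemma ev_extend_keys: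
  "ev (extend f x y) c d l = (\<Sum>a\<in>Poly_Mapping.keys x. \<Sum>b\<in>Poly_Mapping.keys y.
     poly (Poly_Mapping.lookup x a) (- l) * poly (Poly_Mapping.lookup y b) (d + l) * ev (f a b) c d l)"
proof -
  have "ev (subst (\<lambda>Q. - mul_lam Q) (\<lambda>u. subst (deriv_plus_lam free_smul)
      (\<lambda>v. map_poly (free_smul [:u * v:]) F) q) r) c d l
    = poly r (- l) * poly q (d + l) * ev F c d l" for F q r
    apply (subst hom_subst[where t = "- l"], simp, simp, simp)
    apply (subst hom_subst[where t = "d + l"], simp, simp, simp)
    apply (simp add: poly_altdef' sum_product sum_distrib_right mult_ac)
    apply (simp add: sum_distrib_left sum_distrib_right mult_ac)
    done
  thus ?thesis by (simp add: extend_def)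
qed

lemma ev_extend:
  assumes "finite A" "Poly_Mapping.keys x \<subseteq> A" "finite B" "Poly_Mapping.keys y \<subseteq> B"
  shows "ev (extend f x y) c d l =
    (\<Sum>a\<in>A. \<Sum>b\<in>B. poly (Poly_Mapping.lookup x a) (- l) * poly (Poly_Mapping.lookup y b) (d + l) * ev (f a b) c d l)"
proof -
  have "(\<Sum>b\<in>Poly_Mapping.keys y. poly (Poly_Mapping.lookup x a) (- l) * poly (Poly_Mapping.lookup y b) (d + l) * ev (f a b) c d l) =
    (\<Sum>b\<in>B. poly (Poly_Mapping.lookup x a) (- l) * poly (Poly_Mapping.lookup y b) (d + l) * ev (f a b) c d l)" for a
    using assms by (intro sum.mono_neutral_left) (auto simp: in_keys_iff)
  thus ?thesis unfolding ev_extend_keys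
    using assms by (simp, intro sum.mono_neutral_left) (auto simp: in_keys_iff)
qed

lemma ev_term: "ev (t \<odot> b) c d l = (if b = c then poly (map_poly (\<lambda>q. poly q d) t) l else 0)"
proof -
  have "map_poly (\<lambda>x. poly (Poly_Mapping.lookup x c) d) (t \<odot> b) =
    (if b = c then map_poly (\<lambda>q. poly q d) t else 0)"
    by (rule poly_eqI) (auto simp: term_of_basis_def coeff_map_poly lookup_single when_def)
  thus ?thesis by (simp add: ev_def)
qed

lemma ev_term_poly [simp]: "ev (t \<odot> b) c d l = (if b = c then poly (poly t [:l:]) d else 0)"
proof -
  have "poly (map_poly (\<lambda>q. poly q d) t) l = poly (poly t [:l:]) d"
    by (induction t) (auto simp: map_poly_pCons)
  thus ?thesis by (simp add: ev_term)
qed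

lemma ev2_const: "ev2 [:[:y:]:] b d l m = poly (Poly_Mapping.lookup y b) d"
  by simp

lemma ev2_nest:
  assumes "\<And>Q b d l m. ev2 (S Q) b d l m = s d l m * ev2 Q b d l m"
    and "\<And>Q b d l m. ev2 (T Q) b d l m = t d l m * ev2 Q b d l m"
  shows "ev2 (nest S T f P) e d l m =
    (\<Sum>k\<le>degree P. s d l m ^ k * ev (f (coeff P k)) e d (t d l m))"
  unfolding nest_def
  apply (subst hom_subst[where t = "s d l m"], simp, simp, simp add: assms)
  apply (subst hom_subst[where t = "t d l m"], simp, simp, simp add: assms)
  apply (simp add: ev_def poly_map_poly_altdef)
  done

lemma ev_altdef: "ev P b d l = (\<Sum>k\<le>degree P. l ^ k * poly (Poly_Mapping.lookup (coeff P k) b) d)"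
  by (simp add: ev_def poly_map_poly_altdef)

lemma sum_rotate:
  "(\<Sum>n\<in>N. \<Sum>a\<in>A. \<Sum>b\<in>B. h n a b) = (\<Sum>a\<in>A. \<Sum>b\<in>B. \<Sum>n\<in>N. h n a b)"
  using sum.swap[of "\<lambda>n a. \<Sum>b\<in>B. h n a b" A N] sum.swap[of "\<lambda>n b. h n _ b" B N]
  by simp

lemma ev2_nest_right:
  fixes g :: "'a \<Rightarrow> 'b \<Rightarrow> 'b free poly"
  assumes S: "\<And>Q (b::'b) d l m. ev2 (S Q) b d l m = s d l m * ev2 Q b d l m"
    and T: "\<And>Q (b::'b) d l m. ev2 (T Q) b d l m = t d l m * ev2 Q b d l m"
    and A: "finite A" "Poly_Mapping.keys x \<subseteq> A"
    and B: "finite B" "\<And>k. Poly_Mapping.keys (coeff P k) \<subseteq> B"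
  shows "ev2 (nest S T (extend g x) P) e d l m =
    (\<Sum>a\<in>A. \<Sum>b\<in>B. poly (Poly_Mapping.lookup x a) (- t d l m) * ev P b (d + t d l m) (s d l m) * ev (g a b) e d (t d l m))"
  apply (subst ev2_nest[OF S T])
  apply (simp add: ev_extend[OF A B])
  apply (simp add: ev_altdef[of P] sum_distrib_left sum_distrib_right)
  apply (subst sum_rotate)
  apply (simp add: mult_ac)
  done

lemma ev2_nest_left:
  fixes g :: "'a \<Rightarrow> 'b \<Rightarrow> 'b free poly"
  assumes S: "\<And>Q (b::'b) d l m. ev2 (S Q) b d l m = s d l m * ev2 Q b d l m"
    and T: "\<And>Q (b::'b) d l m. ev2 (T Q) b d l m = t d l m * ev2 Q b d l m"
    and A: "finite A" "\<And>k. Poly_Mapping.keys (coeff P k) \<subseteq> A"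
    and B: "finite B" "Poly_Mapping.keys z \<subseteq> B"
  shows "ev2 (nest S T (\<lambda>x. extend g x z) P) e d l m =
    (\<Sum>a\<in>A. \<Sum>b\<in>B. ev P a (- t d l m) (s d l m) * poly (Poly_Mapping.lookup z b) (d + t d l m) * ev (g a b) e d (t d l m))"
  apply (subst ev2_nest[OF S T])
  apply (simp add: ev_extend[OF A B])
  apply (simp add: ev_altdef[of P] sum_distrib_left sum_distrib_right)
  apply (subst sum_rotate)
  apply (simp add: mult_ac)
  done

lemma graded_module_free:
  assumes "smul M = free_smul" "part M = free_part par"
  shows "graded_module M"
proof -
  interpret module "free_smul :: complex poly \<Rightarrow> 'a free \<Rightarrow> 'a free" by (rule module_free_smul)
  show ?thesis
  proof (rule graded_module.intro)
    show "module (smul M)" by (simp add: assms module_free_smul)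
    show "module.subspace (smul M) (part M i)" for i
      by (auto simp: assms subspace_def free_part_def in_keys_iff lookup_add lookup_free_smul)
    show "part M 0 \<inter> part M 1 = {0}"
      by (auto simp: assms free_part_def in_keys_iff intro!: poly_mapping_eqI)
    show "\<exists>x0\<in>part M 0. \<exists>x1\<in>part M 1. x = x0 + x1" for x
    proof -
      define r where "r i = Poly_Mapping.mapp (\<lambda>b q. q when par b = i) x" for i
      have lk: "Poly_Mapping.lookup (r i) b = (if par b = i then Poly_Mapping.lookup x b else 0)" for i b
        by (auto simp: r_def lookup_mapp when_def in_keys_iff)
      have "r i \<in> part M i" for i by (auto simp: assms free_part_def in_keys_iff lk split: if_split_asm)
      moreover have "x = r 0 + r 1"
        by (rule poly_mapping_eqI) (auto simp: lookup_add lk)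
      ultimately show ?thesis by blast
    qed
  qed
qed

definition supp :: "'b free poly \<Rightarrow> 'b set"
  where "supp P = (\<Union>k\<le>degree P. Poly_Mapping.keys (coeff P k))"

lemma finite_supp [simp]: "finite (supp P)"
  by (simp add: supp_def)

lemma keys_subset_supp: "Poly_Mapping.keys (coeff P k) \<subseteq> supp P"
  by (cases "k \<le> degree P") (auto simp: supp_def coeff_eq_0)

lemma lookup_coeff_zeroI:
  assumes "\<And>d l. ev P b d l = 0" shows "Poly_Mapping.lookup (coeff P n) b = 0"
proof -
  have "map_poly (\<lambda>x. poly (Poly_Mapping.lookup x b) d) P = 0" for d
    using assms unfolding ev_def by (intro iffD1[OF poly_eq_poly_eq_iff] ext) simp
  hence "coeff (map_poly (\<lambda>x. poly (Poly_Mapping.lookup x b) d) P) n = 0" for d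
    by simp
  hence "poly (Poly_Mapping.lookup (coeff P n) b) d = 0" for d by (simp add: coeff_map_poly)
  thus ?thesis by (intro iffD1[OF poly_eq_poly_eq_iff] ext) simp
qed

lemma sesquilinear_action_extend:
  fixes R :: "('a free, 'y) graded_module_scheme" and M :: "('b free, 'z) graded_module_scheme"
  assumes R: "smul R = free_smul" "part R = free_part par"
    and M: "smul M = free_smul" "part M = free_part par'"
    and par: "\<And>a b c d l. par' c \<noteq> par a + par' b \<Longrightarrow> ev (f a b) c d l = 0"
  shows "sesquilinear_action R M (extend f)"
proof -
  interpret R: graded_module R using R by (rule graded_module_free)
  interpret M: graded_module M using M by (rule graded_module_free)
  show ?thesis
  proof
    fix a b :: "'a free" and v w :: "'b free" and c :: complex
    define A where "A = Poly_Mapping.keys a \<union> Poly_Mapping.keys b \<union> Poly_Mapping.keys (a + b)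
      \<union> Poly_Mapping.keys (free_smul [:c:] a) \<union> Poly_Mapping.keys (free_smul [:0, 1:] a)"
    define B where "B = Poly_Mapping.keys v \<union> Poly_Mapping.keys w \<union> Poly_Mapping.keys (v + w)
      \<union> Poly_Mapping.keys (free_smul [:c:] v) \<union> Poly_Mapping.keys (free_smul [:0, 1:] v)"
    have fin: "finite A" "finite B" by (auto simp: A_def B_def)
    have A: "Poly_Mapping.keys a \<subseteq> A" "Poly_Mapping.keys b \<subseteq> A" "Poly_Mapping.keys (a + b) \<subseteq> A"
      "Poly_Mapping.keys (free_smul [:c:] a) \<subseteq> A" "Poly_Mapping.keys (free_smul [:0, 1:] a) \<subseteq> A"
      by (auto simp: A_def)
    have B: "Poly_Mapping.keys v \<subseteq> B" "Poly_Mapping.keys w \<subseteq> B" "Poly_Mapping.keys (v + w) \<subseteq> B"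
      "Poly_Mapping.keys (free_smul [:c:] v) \<subseteq> B" "Poly_Mapping.keys (free_smul [:0, 1:] v) \<subseteq> B"
      by (auto simp: B_def)
    note E = ev_extend[OF fin(1) _ fin(2)]
    note E' = A[THEN E, OF B(1)] B[THEN E[OF A(1)]]
    show "extend f (a + b) v = extend f a v + extend f b v"
      by (rule ev_eqI) (simp only: ev_add E' lookup_add poly_add distrib_left distrib_right sum.distrib)
    show "extend f a (v + w) = extend f a v + extend f a w"
      by (rule ev_eqI) (simp only: ev_add E' lookup_add poly_add distrib_left distrib_right sum.distrib)
    show "extend f (cmul (smul R) c a) v = map_poly (cmul (smul M) c) (extend f a v)"
      by (rule ev_eqI)
        (simp add: E' R M cmul_def [abs_def] lookup_free_smul mult_ac sum_distrib_left)
    show "extend f a (cmul (smul M) c v) = map_poly (cmul (smul M) c) (extend f a v)"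
      by (rule ev_eqI)
        (simp add: E' R M cmul_def [abs_def] lookup_free_smul mult_ac sum_distrib_left)
    show "extend f (deriv_op (smul R) a) v = - mul_lam (extend f a v)"
      by (rule ev_eqI)
        (simp add: E' R M deriv_op_def lookup_free_smul sum_distrib_left mult_ac sum_negf)
    show "extend f a (deriv_op (smul M) v) = deriv_plus_lam (smul M) (extend f a v)"
      by (rule ev_eqI)
        (simp add: E' R M deriv_op_def lookup_free_smul sum_distrib_left mult_ac)
  next
    fix a v i j n
    assume *: "a \<in> part R i" "v \<in> part M j"
    have "ev (extend f a v) c d l = 0" if "par' c \<noteq> i + j" for c d l
      unfolding ev_extend_keys
      using * that by (intro sum.neutral ballI) (auto simp: R M free_part_def intro!: par)
    hence "Poly_Mapping.lookup (coeff (extend f a v) n) c = 0" if "par' c \<noteq> i + j" for c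
      using that by (intro lookup_coeff_zeroI) auto
    thus "coeff (extend f a v) n \<in> part M (i + j)"
      unfolding M free_part_def in_keys_iff by blast
  qed
qed

lemma ev2_mul2: "ev2 (mul2 Q) b d l m = m * ev2 Q b d l m"
  by simp

lemma ev2_mul12: "ev2 (mul12 Q) b d l m = (l + m) * ev2 Q b d l m"
  by (simp add: algebra_simps)

lemmas nest_l12 = ev2_nest_left[where S = mul1 and T = mul12, OF ev2_mul1 ev2_mul12]
lemmas nest_21 = ev2_nest_right[where S = mul2 and T = mul1, OF ev2_mul2 ev2_mul1]
lemmas nest_12 = ev2_nest_right[where S = mul1 and T = mul2, OF ev2_mul1 ev2_mul2]

lemma sum_rotate4:
  "(\<Sum>c\<in>W. \<Sum>b\<in>B. (\<Sum>a\<in>A. \<Sum>a'\<in>A'. h c b a a')) =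
   (\<Sum>a\<in>A. \<Sum>a'\<in>A'. \<Sum>b\<in>B. \<Sum>c\<in>W. h c b a a')"
  (is "?l = ?r")
proof -
  have "?l = (\<Sum>c\<in>W. \<Sum>a\<in>A. \<Sum>a'\<in>A'. \<Sum>b\<in>B. h c b a a')"
    by (subst sum_rotate) simp
  also have "\<dots> = ?r"
    by (subst sum_rotate, intro sum.cong refl sum.swap)
  finally show ?thesis .
qed

lemma jacobi_extend:
  fixes g :: "'a \<Rightarrow> 'a \<Rightarrow> 'a free poly" and h :: "'a \<Rightarrow> 'b \<Rightarrow> 'b free poly"
  assumes sg: "\<And>a a'. finite (sg a a')" and sh: "\<And>a b. finite (sh a b)"
    and gen: "\<And>a a' b e d l m W U. \<lbrakk>finite W; sg a a' \<subseteq> W; finite U; sh a b \<subseteq> U; sh a' b \<subseteq> U;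
        par a = i; par a' = j\<rbrakk> \<Longrightarrow>
      (\<Sum>u\<in>U. ev (h a' b) u (d + l) m * ev (h a u) e d l) =
      (\<Sum>c\<in>W. ev (g a a') c (- (l + m)) l * ev (h c b) e d (l + m))
      + koszul i j (\<Sum>u\<in>U. ev (h a b) u (d + m) l * ev (h a' u) e d m)"
    and x: "x \<in> free_part par i" and y: "y \<in> free_part par j"
  shows "nest mul2 mul1 (extend h x) (extend h y v) =
    nest mul1 mul12 (\<lambda>u. extend h u v) (extend g x y)
    + koszul i j (nest mul1 mul2 (extend h y) (extend h x v))"
proof (rule ev2_eqI)
  fix e d l m
  define A where "A = Poly_Mapping.keys x"
  define A' where "A' = Poly_Mapping.keys y"
  define B where "B = Poly_Mapping.keys v"
  define W where "W = supp (extend g x y) \<union> (\<Union>a\<in>A. \<Union>a'\<in>A'. sg a a')"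
  define U where "U = supp (extend h x v) \<union> supp (extend h y v)
    \<union> (\<Union>a\<in>A. \<Union>b\<in>B. sh a b) \<union> (\<Union>a\<in>A'. \<Union>b\<in>B. sh a b)"
  have fin: "finite A" "finite A'" "finite B" "finite W" "finite U"
    by (auto simp: A_def A'_def B_def W_def U_def sg sh)
  have sub: "\<And>k. Poly_Mapping.keys (coeff (extend g x y) k) \<subseteq> W"
    "\<And>k. Poly_Mapping.keys (coeff (extend h x v) k) \<subseteq> U"
    "\<And>k. Poly_Mapping.keys (coeff (extend h y v) k) \<subseteq> U"
    by (rule subset_trans[OF keys_subset_supp], force simp: W_def U_def)+
  have k: "Poly_Mapping.keys x \<subseteq> A" "Poly_Mapping.keys y \<subseteq> A'" "Poly_Mapping.keys v \<subseteq> B"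
    by (auto simp: A_def A'_def B_def)
  define X where "X a a' b = poly (Poly_Mapping.lookup x a) (- l) * poly (Poly_Mapping.lookup y a') (- m) * poly (Poly_Mapping.lookup v b) (d + l + m)"
    for a a' b
  have 1: "ev2 (nest mul2 mul1 (extend h x) (extend h y v)) e d l m =
    (\<Sum>a\<in>A. \<Sum>a'\<in>A'. \<Sum>b\<in>B. X a a' b * (\<Sum>u\<in>U. ev (h a' b) u (d + l) m * ev (h a u) e d l))"
    (is "?L1 = _")
  proof -
    have "?L1 = (\<Sum>a\<in>A. \<Sum>u\<in>U. \<Sum>a'\<in>A'. \<Sum>b\<in>B. X a a' b * (ev (h a' b) u (d + l) m * ev (h a u) e d l))"
      by (subst nest_21[OF fin(1) k(1) fin(5) sub(3)])
        (simp add: ev_extend[OF fin(2) k(2) fin(3) k(3)] X_def sum_distrib_left sum_distrib_right mult_ac)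
    also have "\<dots> = (\<Sum>a\<in>A. \<Sum>a'\<in>A'. \<Sum>b\<in>B. \<Sum>u\<in>U. X a a' b * (ev (h a' b) u (d + l) m * ev (h a u) e d l))"
      by (rule sum.cong[OF refl], rule sum_rotate)
    finally show ?thesis by (simp add: sum_distrib_left)
  qed
  have 2: "ev2 (nest mul1 mul2 (extend h y) (extend h x v)) e d l m =
    (\<Sum>a\<in>A. \<Sum>a'\<in>A'. \<Sum>b\<in>B. X a a' b * (\<Sum>u\<in>U. ev (h a b) u (d + m) l * ev (h a' u) e d m))"
    (is "?L2 = _")
  proof -
    have "?L2 = (\<Sum>a'\<in>A'. \<Sum>u\<in>U. \<Sum>a\<in>A. \<Sum>b\<in>B. X a a' b * (ev (h a b) u (d + m) l * ev (h a' u) e d m))"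
      by (subst nest_12[OF fin(2) k(2) fin(5) sub(2)])
        (simp add: ev_extend[OF fin(1) k(1) fin(3) k(3)] X_def sum_distrib_left sum_distrib_right mult_ac add_ac)
    also have "\<dots> = (\<Sum>a'\<in>A'. \<Sum>a\<in>A. \<Sum>b\<in>B. \<Sum>u\<in>U. X a a' b * (ev (h a b) u (d + m) l * ev (h a' u) e d m))"
      by (rule sum.cong[OF refl], rule sum_rotate)
    also have "\<dots> = (\<Sum>a\<in>A. \<Sum>a'\<in>A'. \<Sum>b\<in>B. \<Sum>u\<in>U. X a a' b * (ev (h a b) u (d + m) l * ev (h a' u) e d m))"
      by (rule sum.swap)
    finally show ?thesis by (simp add: sum_distrib_left)
  qed
  have 3: "ev2 (nest mul1 mul12 (\<lambda>u. extend h u v) (extend g x y)) e d l m =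
    (\<Sum>a\<in>A. \<Sum>a'\<in>A'. \<Sum>b\<in>B. X a a' b * (\<Sum>c\<in>W. ev (g a a') c (- (l + m)) l * ev (h c b) e d (l + m)))"
    (is "?L3 = _")
  proof -
    have "?L3 = (\<Sum>c\<in>W. \<Sum>b\<in>B. \<Sum>a\<in>A. \<Sum>a'\<in>A'. X a a' b * (ev (g a a') c (- (l + m)) l * ev (h c b) e d (l + m)))"
      by (subst nest_l12[OF fin(4) sub(1) fin(3) k(3)])
        (simp add: ev_extend[OF fin(1) k(1) fin(2) k(2)] X_def sum_distrib_left sum_distrib_right mult_ac add_ac)
    also note sum_rotate4
    finally show ?thesis by (simp add: sum_distrib_left)
  qed
  have par: "par a = i" if "a \<in> A" for a using x that by (auto simp: free_part_def A_def)
  have par': "par a = j" if "a \<in> A'" for a using y that by (auto simp: free_part_def A'_def)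
  have G: "(\<Sum>u\<in>U. ev (h a' b) u (d + l) m * ev (h a u) e d l) =
      (\<Sum>c\<in>W. ev (g a a') c (- (l + m)) l * ev (h c b) e d (l + m))
      + koszul i j (\<Sum>u\<in>U. ev (h a b) u (d + m) l * ev (h a' u) e d m)"
    if "a \<in> A" "a' \<in> A'" "b \<in> B" for a a' b
    using that fin by (intro gen par par') (auto simp: W_def U_def)
  have kk: "ev2 (koszul i j Q) e d l m = koszul i j (ev2 Q e d l m)" for Q :: "'b free poly poly"
    by (simp add: koszul_def)
  have "?L1 = (\<Sum>a\<in>A. \<Sum>a'\<in>A'. \<Sum>b\<in>B. X a a' b * (\<Sum>c\<in>W. ev (g a a') c (- (l + m)) l * ev (h c b) e d (l + m))
      + koszul i j (X a a' b * (\<Sum>u\<in>U. ev (h a b) u (d + m) l * ev (h a' u) e d m)))"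
    unfolding 1 by (intro sum.cong refl) (simp add: G distrib_left koszul_def)
  also have "\<dots> = ?L3 + koszul i j ?L2"
    unfolding 2 3 by (simp add: sum.distrib koszul_def sum_negf)
  finally show "?L1 = ev2 (nest mul1 mul12 (\<lambda>u. extend h u v) (extend g x y)
    + koszul i j (nest mul1 mul2 (extend h y) (extend h x v))) e d l m"
    by (simp add: kk)
qed

lemma skew_extend:
  fixes g :: "'a \<Rightarrow> 'a \<Rightarrow> 'a free poly"
  assumes gen: "\<And>a b c d l. par a = i \<Longrightarrow> par b = j \<Longrightarrow> ev (g a b) c d l = - koszul i j (ev (g b a) c d (- l - d))"
    and x: "x \<in> free_part par i" and y: "y \<in> free_part par j"
  shows "extend g x y = - koszul i j (reflect free_smul (extend g y x))"
proof (rule ev_eqI)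
  fix c d l
  have kk: "ev (koszul i j Q) c d l = koszul i j (ev Q c d l)" for Q :: "'a free poly"
    by (simp add: koszul_def)
  let ?A = "Poly_Mapping.keys x" and ?B = "Poly_Mapping.keys y"
  have "ev (extend g x y) c d l = (\<Sum>a\<in>?A. \<Sum>b\<in>?B.
      - koszul i j (poly (Poly_Mapping.lookup y b) (d + l) * poly (Poly_Mapping.lookup x a) (- l) * ev (g b a) c d (- l - d)))"
    unfolding ev_extend_keys
  proof (intro sum.cong refl)
    fix a b assume "a \<in> ?A" "b \<in> ?B"
    hence "par a = i" "par b = j" using x y by (auto simp: free_part_def)
    from gen[OF this] show "poly (Poly_Mapping.lookup x a) (- l) * poly (Poly_Mapping.lookup y b) (d + l) * ev (g a b) c d l =
      - koszul i j (poly (Poly_Mapping.lookup y b) (d + l) * poly (Poly_Mapping.lookup x a) (- l) * ev (g b a) c d (- l - d))"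
      by (simp add: koszul_def)
  qed
  also have "\<dots> = - koszul i j (\<Sum>b\<in>?B. \<Sum>a\<in>?A. (poly (Poly_Mapping.lookup y b) (d + l) * poly (Poly_Mapping.lookup x a) (- l) * ev (g b a) c d (- l - d)))"
    by (subst sum.swap) (simp add: koszul_def sum_negf)
  also have "\<dots> = ev (- koszul i j (reflect free_smul (extend g y x))) c d l"
    by (simp add: kk ev_extend_keys add.commute)
  finally show "ev (extend g x y) c d l = ev (- koszul i j (reflect free_smul (extend g y x))) c d l" .
qed

fun gen_index :: "gen \<Rightarrow> nat"
  where
    "gen_index (L i) = i"
  | "gen_index (J i) = i"
  | "gen_index (Gp i) = i"
  | "gen_index (Gm i) = i"

definition sK :: "gen \<Rightarrow> gen \<Rightarrow> gen set"
  where "sK a b = (let n = gen_index a + gen_index b in {L n, J n, Gp n, Gm n})"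

lemma finite_sK [simp]: "finite (sK a b)"
  by (simp add: sK_def Let_def)

lemma sum_if_mult:
  fixes z :: complex
  shows "finite W \<Longrightarrow> (\<Sum>u\<in>W. (if x = u then z else 0) * f u) = (if x \<in> W then z * f x else 0)"
proof -
  assume "finite W"
  have "(\<Sum>u\<in>W. (if x = u then z else 0) * f u) = (\<Sum>u\<in>W. (if x = u then z * f u else 0))"
    by (intro sum.cong) auto
  thus ?thesis using \<open>finite W\<close> by simp
qed

lemma ev_koszul [simp]: "ev (koszul i j Q) c d l = koszul i j (ev Q c d l)"
  by (simp add: koszul_def)

lemma K_bracket_skew: "ev (K_bracket p a b) c d l =
   - koszul (gen_parity a) (gen_parity b) (ev (K_bracket p b a) c d (- l - d))"
  by (cases a; cases b) (auto simp: K_bracket_def koszul_def algebra_simps add.commute)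

lemma K_bracket_parity:
  "gen_parity c \<noteq> gen_parity a + gen_parity b \<Longrightarrow> ev (K_bracket p a b) c d l = 0"
  by (cases a; cases b; cases c) (auto simp: K_bracket_def koszul_def)

lemma K_bracket_table:
  assumes "p = 2 * q"
  shows
  "ev (K_bracket p (L i) (L j)) c d l = (if L (i + j) = c then (i + p) * d + (i + j + 2 * p) * l else 0)"
  "ev (K_bracket p (L i) (J j)) c d l = (if J (i + j) = c then (i + p) * d + (i + j + p) * l else 0)"
  "ev (K_bracket p (L i) (Gp j)) c d l = (if Gp (i + j) = c then (i + p) * d + (i + j + 3 * q) * l else 0)"
  "ev (K_bracket p (L i) (Gm j)) c d l = (if Gm (i + j) = c then (i + p) * d + (i + j + 3 * q) * l else 0)"
  "ev (K_bracket p (J i) (L j)) c d l = (if J (i + j) = c then i * d + (i + j + p) * l else 0)"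
  "ev (K_bracket p (J i) (J j)) c d l = 0"
  "ev (K_bracket p (J i) (Gp j)) c d l = (if Gp (i + j) = c then 1 else 0)"
  "ev (K_bracket p (J i) (Gm j)) c d l = (if Gm (i + j) = c then - 1 else 0)"
  "ev (K_bracket p (Gp i) (L j)) c d l = (if Gp (i + j) = c then (i + q) * d + (i + j + 3 * q) * l else 0)"
  "ev (K_bracket p (Gp i) (J j)) c d l = (if Gp (i + j) = c then - 1 else 0)"
  "ev (K_bracket p (Gp i) (Gp j)) c d l = 0"
  "ev (K_bracket p (Gp i) (Gm j)) c d l = (if J (i + j) = c then (2 * i + p) * d + 2 * (i + j + p) * l else 0)
    + (if L (i + j) = c then 2 else 0)"
  "ev (K_bracket p (Gm i) (L j)) c d l = (if Gm (i + j) = c then (i + q) * d + (i + j + 3 * q) * l else 0)"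
  "ev (K_bracket p (Gm i) (J j)) c d l = (if Gm (i + j) = c then 1 else 0)"
  "ev (K_bracket p (Gm i) (Gp j)) c d l = (if J (i + j) = c then - (2 * i + p) * d - 2 * (i + j + p) * l else 0)
    + (if L (i + j) = c then 2 else 0)"
  "ev (K_bracket p (Gm i) (Gm j)) c d l = 0"
  using assms by (auto simp: K_bracket_def koszul_def algebra_simps)

lemma K_bracket_jacobi:
  assumes "finite W" "sK a a' \<subseteq> W" "finite U" "sK a b \<subseteq> U" "sK a' b \<subseteq> U"
  shows "(\<Sum>u\<in>U. ev (K_bracket p a' b) u (d + l) m * ev (K_bracket p a u) e d l) =
      (\<Sum>c\<in>W. ev (K_bracket p a a') c (- (l + m)) l * ev (K_bracket p c b) e d (l + m))
      + koszul (gen_parity a) (gen_parity a')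
         (\<Sum>u\<in>U. ev (K_bracket p a b) u (d + m) l * ev (K_bracket p a' u) e d m)"
proof -
  obtain q where q: "p = 2 * q" by (metis nonzero_mult_div_cancel_left times_divide_eq_right zero_neq_numeral)
  note T = K_bracket_table[OF q]
  have S: "(\<Sum>u\<in>A. ((if x = u then z else 0) + (if y = u then w else 0)) * f u) =
    (if x \<in> A then z * f x else 0) + (if y \<in> A then w * f y else 0)" if "finite A"
    for A :: "gen set" and x y z w and f :: "gen \<Rightarrow> complex"
    using that by (simp add: distrib_right sum.distrib sum_if_mult)
  show ?thesis
    using assms
    by (cases a; cases a'; cases b; simp add: sK_def Let_def T S koszul_def add.assoc add.left_commute sum_if_mult;
        (simp add: q algebra_simps)?)
qed

lemma K_alg_simps [simp]:
  "smul (K_alg p) = free_smul" "part (K_alg p) = free_part gen_parity"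
  "bracket (K_alg p) = extend (K_bracket p)"
  by (simp_all add: K_alg_def)

theorem lie_conformal_superalgebra_K: "lie_conformal_superalgebra (K_alg p)"
proof -
  interpret sesquilinear_action "K_alg p" "K_alg p" "bracket (K_alg p)"
    unfolding K_alg_simps
    by (rule sesquilinear_action_extend[OF K_alg_simps(1,2) K_alg_simps(1,2)])
      (rule K_bracket_parity)
  show ?thesis
  proof
    fix a b c :: "gen free" and i j
    assume "a \<in> part (K_alg p) i" "b \<in> part (K_alg p) j"
    hence *: "a \<in> free_part gen_parity i" "b \<in> free_part gen_parity j" by simp_all
    have skew: "ev (K_bracket p a b) c d l = - koszul i j (ev (K_bracket p b a) c d (- l - d))"
      if "gen_parity a = i" "gen_parity b = j" for a b c d l
      using K_bracket_skew[of p a b c d l] that by simp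
    show "bracket (K_alg p) a b = - koszul i j (reflect (smul (K_alg p)) (bracket (K_alg p) b a))"
      unfolding K_alg_simps by (rule skew_extend[OF skew *])
    have jacobi: "(\<Sum>u\<in>U. ev (K_bracket p a' b) u (d + l) m * ev (K_bracket p a u) e d l) =
        (\<Sum>c\<in>W. ev (K_bracket p a a') c (- (l + m)) l * ev (K_bracket p c b) e d (l + m))
        + koszul i j (\<Sum>u\<in>U. ev (K_bracket p a b) u (d + m) l * ev (K_bracket p a' u) e d m)"
      if "finite W" "sK a a' \<subseteq> W" "finite U" "sK a b \<subseteq> U" "sK a' b \<subseteq> U"
        "gen_parity a = i" "gen_parity a' = j" for a a' b e d l m W U
      using K_bracket_jacobi[OF that(1-5), of p d l m e] unfolding that(6,7) .
    show "nest mul2 mul1 (bracket (K_alg p) a) (bracket (K_alg p) b c) =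
        nest mul1 mul12 (\<lambda>x. bracket (K_alg p) x c) (bracket (K_alg p) a b)
        + koszul i j (nest mul1 mul2 (bracket (K_alg p) b) (bracket (K_alg p) a c))"
      unfolding K_alg_simps by (rule jacobi_extend[OF finite_sK finite_sK jacobi *])
  qed
qed

end

theory Submission
  imports Defs "HOL-Computational_Algebra.Fundamental_Theorem_Algebra"
begin

text \<open>
  Write \<open>x(n)\<close> for \<open>n!\<close> times the coefficient of \<open>\<lambda>^n\<close> in the action of a generator \<open>x\<close>. If \<open>x\<close> commutes with
  \<open>\<partial>\<close> and with an operator \<open>y\<close> such that \<open>h = [y, \<partial>]\<close> commutes with both, then \<open>q(x) h^e = 0\<close> for some nonzero
  polynomial \<open>q\<close>, because \<open>M\<close> is finitely generated over \<open>\<complex>[\<partial>]\<close>. Hence \<open>J\<^sub>j(0)\<close> is algebraic, and nilpotent for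
  \<open>j \<ge> 1\<close> by its weight. Since \<open>G\<^sub>j\<close> is obtained from \<open>G\<^sub>0\<close> by \<open>j\<close> commutators with \<open>J\<^sub>1(0)\<close>, it vanishes for large
  \<open>j\<close>, and so do \<open>J\<^sub>j\<close> and \<open>L\<^sub>j\<close>. The modes of the generators of the largest surviving index \<open>K \<ge> 1\<close> commute up to
  sign; if they are nilpotent, they have a common kernel, which is a submodule. This excludes every \<open>K \<ge> 1\<close>
  except \<open>K = 1 = -p\<close> with \<open>L\<^sub>1(0)\<close> a nonzero scalar.

  For fixed \<open>N\<close>, the vectors killed by \<open>L\<^sub>0(n)\<close> for all \<open>n \<ge> N\<close> form a finite-dimensional space; an
  eigenvector of \<open>L\<^sub>0(1)\<close> of lowest weight is taken in it. This gives a vector \<open>v\<close> killed by all modes of positive degree, and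
  \<open>M\<close> is spanned over \<open>\<complex>[\<partial>]\<close> by \<open>v\<close>, \<open>G\<^sub>0\<^sup>+(0) v\<close>, \<open>G\<^sub>0\<^sup>-(0) v\<close>, \<open>G\<^sub>0\<^sup>+(0) G\<^sub>0\<^sup>-(0) v\<close>. These are independent unless
  \<open>L\<^sub>1(0) = 0\<close> and \<open>\<Lambda> = 2 \<Delta>\<close> or \<open>\<Lambda> = - 2 \<Delta>\<close>, in which case \<open>v\<close> may be chosen with \<open>G\<^sub>0\<^sup>+(0) v = 0\<close> or
  \<open>G\<^sub>0\<^sup>-(0) v = 0\<close>.
\<close>

section \<open>Endomorphisms of modules\<close>

lemma subst_0 [simp]: "f 0 = 0 \<Longrightarrow> subst T f 0 = 0"
  by (simp add: subst_def)

lemma subst_pCons: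
  assumes "f 0 = 0" "T 0 = 0" "\<And>x y. T (x + y) = T x + T y"
  shows "subst T f (pCons a P) = f a + T (subst T f P)"
proof (cases "P = 0")
  case False
  have T: "T (sum g A) = (\<Sum>k\<in>A. T (g k))" for g and A :: "nat set"
    by (induction A rule: infinite_finite_induct) (simp_all add: assms)
  from False show ?thesis
    by (simp add: subst_def T sum.atMost_Suc_shift del: sum.atMost_Suc)
qed (simp add: subst_def assms)

text \<open>The vector \<open>q(x) v\<close>. Scalars in \<complex> give polynomials in
  \<open>x\<close>, scalars in \<complex>[\<partial>] polynomials in \<partial> and
  \<open>x\<close>.\<close>

definition app :: "('a::zero \<Rightarrow> 'b \<Rightarrow> 'b) \<Rightarrow> ('b \<Rightarrow> 'b) \<Rightarrow> 'a poly \<Rightarrow> 'b \<Rightarrow> 'b::comm_monoid_add"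
  where "app sc x q v = subst x (\<lambda>a. sc a v) q"

definition nilp :: "('b \<Rightarrow> 'b::zero) \<Rightarrow> bool"
  where "nilp x \<longleftrightarrow> (\<exists>n. \<forall>v. (x ^^ n) v = 0)"

locale endo = module sc
  for sc :: "'a::idom \<Rightarrow> 'b::ab_group_add \<Rightarrow> 'b" +
  fixes x :: "'b \<Rightarrow> 'b"
  assumes x_add: "x (u + v) = x u + x v"
    and x_scale: "x (sc a v) = sc a (x v)"
begin

lemma x_0 [simp]: "x 0 = 0"
  using x_add[of 0 0] by simp

lemma pow_add: "(x ^^ n) (u + v) = (x ^^ n) u + (x ^^ n) v"
  by (induction n) (simp_all add: x_add)

lemma pow_scale: "(x ^^ n) (sc a v) = sc a ((x ^^ n) v)"
  by (induction n) (simp_all add: x_scale)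

lemma pow_0 [simp]: "(x ^^ n) 0 = 0"
  by (induction n) simp_all

lemma app_0 [simp]: "app sc x 0 v = 0"
  by (simp add: app_def)

lemma app_pCons [simp]: "app sc x (pCons a q) v = sc a v + x (app sc x q v)"
  unfolding app_def by (rule subst_pCons) (simp_all add: x_add)

lemma app_add: "app sc x (q + r) v = app sc x q v + app sc x r v"
  by (induction q r rule: poly_induct2) (simp_all add: scale_left_distrib x_add)

lemma app_smult: "app sc x (smult a q) v = sc a (app sc x q v)"
  by (induction q) (simp_all add: x_scale scale_right_distrib)

lemma app_mult: "app sc x (q * r) v = app sc x q (app sc x r v)"
  by (induction q) (simp_all add: mult_pCons_left app_add app_smult)

lemma app_minus: "app sc x (- q) v = - app sc x q v"
  using app_smult[of "- 1" q v] by simp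

lemma app_diff: "app sc x (q - r) v = app sc x q v - app sc x r v"
  using app_add[of q "- r" v] by (simp add: app_minus)

lemma app_add_right: "app sc x q (u + v) = app sc x q u + app sc x q v"
  by (induction q) (simp_all add: scale_right_distrib x_add)

lemma app_0_right [simp]: "app sc x q 0 = 0"
  using app_add_right[of q 0 0] by simp

lemma app_commute:
  assumes "\<And>u v. f (u + v) = f u + f v" "\<And>a v. f (sc a v) = sc a (f v)" "\<And>v. f (x v) = x (f v)"
  shows "f (app sc x q v) = app sc x q (f v)"
proof -
  have "f 0 = 0" using assms(1)[of 0 0] by simp
  thus ?thesis by (induction q) (simp_all add: assms)
qed

lemma app_scale_right: "app sc x q (sc a v) = sc a (app sc x q v)"
  by (rule app_commute[symmetric]) (simp_all add: scale_right_distrib x_scale mult.commute)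

lemma app_x: "app sc x q (x v) = x (app sc x q v)"
  by (rule app_commute[symmetric]) (simp_all add: x_add x_scale)

lemma app_monom: "app sc x (monom a n) v = sc a ((x ^^ n) v)"
  by (induction n) (simp_all add: monom_0 monom_Suc x_scale)

lemma app_sum: "app sc x (sum f A) v = (\<Sum>i\<in>A. app sc x (f i) v)"
  by (induction A rule: infinite_finite_induct) (simp_all add: app_add)

end

text \<open>Induction on the spanning set: if some \<open>w k\<close> involves the generator
  \<open>g\<close>, cross-multiplication with its coefficient removes \<open>g\<close> from the
  other vectors. This replaces division.\<close>

lemma linear_dependence:
  fixes sc :: "'a::idom \<Rightarrow> 'b::ab_group_add \<Rightarrow> 'b" and w :: "'i \<Rightarrow> 'b"
  assumes "module sc" "finite S" "finite I" "card S < card I" "\<And>i. i \<in> I \<Longrightarrow> w i \<in> module.span sc S"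
  obtains q where "\<exists>i\<in>I. q i \<noteq> 0" "(\<Sum>i\<in>I. sc (q i) (w i)) = 0"
proof -
  interpret module sc by fact
  have "\<exists>q. (\<exists>i\<in>I. q i \<noteq> 0) \<and> (\<Sum>i\<in>I. sc (q i) (w i)) = 0"
    using assms(2-5)
  proof (induction S arbitrary: I w rule: finite_induct)
    case empty
    then obtain i where "i \<in> I" by fastforce
    thus ?case using empty by (intro exI[of _ "\<lambda>_. 1"]) auto
  next
    case (insert g S)
    have "\<forall>i\<in>I. \<exists>a. w i - sc a g \<in> span S"
      using insert.prems(3) span_breakdown_eq[of _ g S] by blast
    then obtain a where a: "\<And>i. i \<in> I \<Longrightarrow> w i - sc (a i) g \<in> span S" by metis
    show ?case
    proof (cases "\<forall>i\<in>I. a i = 0")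
      case True
      with a have "\<And>i. i \<in> I \<Longrightarrow> w i \<in> span S" by fastforce
      with insert.IH[OF insert.prems(1)] insert show ?thesis by simp
    next
      case False
      then obtain k where k: "k \<in> I" "a k \<noteq> 0" by blast
      define z where "z i = sc (a k) (w i) - sc (a i) (w k)" for i
      have z: "z i \<in> span S" if "i \<in> I" for i
      proof -
        have "z i = sc (a k) (w i - sc (a i) g) - sc (a i) (w k - sc (a k) g)"
          by (simp add: z_def scale_right_diff_distrib mult.commute)
        thus ?thesis using a[OF that] a[OF k(1)] by (simp add: span_diff span_scale)
      qed
      have "card S < card (I - {k})" using insert.prems insert.hyps k by simp
      with insert.IH[of "I - {k}" z] z insert.prems(1) obtain q
        where q: "\<exists>i\<in>I - {k}. q i \<noteq> 0" "(\<Sum>i\<in>I - {k}. sc (q i) (z i)) = 0" by auto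
      define r where "r i = (if i = k then - (\<Sum>i\<in>I - {k}. q i * a i) else q i * a k)" for i
      have "(\<Sum>i\<in>I. sc (r i) (w i)) = sc (r k) (w k) + (\<Sum>i\<in>I - {k}. sc (q i * a k) (w i))"
        using k insert.prems(1) by (subst sum.remove[of _ k]) (auto simp: r_def)
      also have "\<dots> = (\<Sum>i\<in>I - {k}. sc (q i) (z i))"
        by (simp add: r_def z_def scale_right_diff_distrib sum_subtractf scale_sum_left)
      finally have "(\<Sum>i\<in>I. sc (r i) (w i)) = 0" using q(2) by simp
      moreover have "\<exists>i\<in>I. r i \<noteq> 0" using q(1) k by (auto simp: r_def)
      ultimately show ?thesis by blast
    qed
  qed
  with that show thesis by blast
qed

text \<open>Leibniz rule: since the commutator \<open>d\<close> of \<open>E\<close> and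
  \<open>x\<close> commutes with \<open>x\<close>, each power \<open>x^k\<close> contributes
  \<open>k x^(k-1) d\<close>.\<close>

lemma (in endo) app_derivation:
  assumes "\<And>u v. E (u + v) = E u + E v" "\<And>a v. E (sc a v) = sc a (E v)"
    and "\<And>v. E (x v) = x (E v) + d v"
    and "\<And>v. d (x v) = x (d v)" "\<And>a v. d (sc a v) = sc a (d v)" "\<And>u v. d (u + v) = d u + d v"
  shows "E (app sc x q v) = app sc x q (E v) + app sc x (pderiv q) (d v)"
proof -
  have "E 0 = 0" using assms(1)[of 0 0] by simp
  moreover have "d (app sc x q v) = app sc x q (d v)" for q
    by (rule app_commute) (use assms in auto)
  ultimately show ?thesis
    by (induction q) (simp_all add: assms x_add app_add pderiv_pCons)
qed

text \<open>The commutator with \<open>E\<close> turns \<open>x^(n+1) y^r = 0\<close> into \<open>x^n y^(r+2) = 0\<close>.\<close>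

lemma (in endo) nilp_derivation:
  assumes nil: "nilp x"
    and E: "\<And>u v. E (u + v) = E u + E v" "\<And>a v. E (sc a v) = sc a (E v)"
    and y: "endo sc y" "\<And>v. y (x v) = x (y v)" "\<And>v. E (x v) = x (E v) + sc k (y v)"
    and z: "endo sc z" "\<And>v. z (x v) = x (z v)" "\<And>v. z (y v) = y (z v)"
      "\<And>v. E (y v) = y (E v) + sc l (z v)"
    and k: "\<And>n v. sc (of_nat (Suc n) * k) v = 0 \<Longrightarrow> v = 0"
  shows "nilp y"
proof -
  interpret y: endo sc y by fact
  interpret z: endo sc z by fact
  have xy: "(y ^^ n) (x v) = x ((y ^^ n) v)" for n v by (induction n) (simp_all add: y)
  have yx: "(x ^^ n) (y v) = y ((x ^^ n) v)" for n v by (induction n) (simp_all add: y)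
  have yz: "(y ^^ n) (z v) = z ((y ^^ n) v)" for n v by (induction n) (simp_all add: z)
  have Suc_k: "sc (of_nat n * k) v + sc k v = sc (of_nat (Suc n) * k) v" for n k v
    by (simp add: distrib_right scale_left_distrib)
  have Ex: "E ((x ^^ Suc n) v) = (x ^^ Suc n) (E v) + sc (of_nat (Suc n) * k) ((x ^^ n) (y v))" for n v
  proof (induction n)
    case (Suc n)
    have "E ((x ^^ Suc (Suc n)) v) = x (E ((x ^^ Suc n) v)) + sc k (y ((x ^^ Suc n) v))"
      by (simp add: y)
    also have "\<dots> = (x ^^ Suc (Suc n)) (E v) + (sc (of_nat (Suc n) * k) ((x ^^ Suc n) (y v)) + sc k ((x ^^ Suc n) (y v)))"
      unfolding Suc by (simp only: x_add x_scale yx y(2) funpow.simps comp_apply add.assoc)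
    finally show ?case by (simp only: Suc_k)
  qed (simp add: y)
  have Ey: "E ((y ^^ n) v) = (y ^^ n) (E v) + sc (of_nat n * l) (z ((y ^^ (n - 1)) v))" for n v
  proof (induction n)
    case (Suc n)
    have *: "sc (of_nat n * l) (y (z ((y ^^ (n - 1)) v))) = sc (of_nat n * l) (z ((y ^^ n) v))"
      by (cases n) (simp_all add: z)
    have "E ((y ^^ Suc n) v) = y (E ((y ^^ n) v)) + sc l (z ((y ^^ n) v))" by (simp add: z)
    also have "\<dots> = (y ^^ Suc n) (E v) + (sc (of_nat n * l) (z ((y ^^ n) v)) + sc l (z ((y ^^ n) v)))"
      unfolding Suc by (simp only: y.x_add y.x_scale * funpow.simps comp_apply add.assoc)
    finally show ?case by (simp only: Suc_k diff_Suc_1)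
  qed simp
  have step: "(x ^^ n) ((y ^^ (r + 2)) v) = 0" if "\<And>v. (x ^^ Suc n) ((y ^^ r) v) = 0" for n r v
  proof -
    \<comment> \<open>The factor \<open>y\<close> is inserted because \<open>E\<close> lowers
      \<open>y^r\<close> to \<open>y^(r-1)\<close>; with it the lowered term still contains
      \<open>y^r\<close> and is killed by the assumption.\<close>
    let ?v = "y v"
    have E0: "E 0 = 0" using E(1)[of 0 0] by simp
    have zx: "(x ^^ n) (z v) = z ((x ^^ n) v)" for n v by (induction n) (simp_all add: z)
    have y1: "(y ^^ (r - 1)) (y v) = (y ^^ r) v" if "r \<noteq> 0"
      using that by (cases r) (simp_all add: funpow_Suc_right del: funpow.simps)
    have "0 = E ((x ^^ Suc n) ((y ^^ r) ?v))" by (simp only: that E0)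
    also have "\<dots> = (x ^^ Suc n) (E ((y ^^ r) ?v)) + sc (of_nat (Suc n) * k) ((x ^^ n) (y ((y ^^ r) ?v)))"
      by (rule Ex)
    also have "(x ^^ Suc n) (E ((y ^^ r) ?v)) = sc (of_nat r * l) ((x ^^ Suc n) (z ((y ^^ (r - 1)) ?v)))"
      by (simp only: Ey pow_add pow_scale that add_0_left)
    also have "\<dots> = 0"
    proof (cases "r = 0")
      case False
      show ?thesis unfolding y1[OF False] zx that by simp
    qed simp
    finally have "sc (of_nat (Suc n) * k) ((x ^^ n) (y ((y ^^ r) ?v))) = 0" by (simp only: add_0_left)
    hence "(x ^^ n) (y ((y ^^ r) ?v)) = 0" by (rule k)
    moreover have "y ((y ^^ r) (y v)) = (y ^^ (r + 2)) v"
      by (metis add_2_eq_Suc' comp_apply funpow.simps(2) funpow_Suc_right)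
    ultimately show ?thesis by simp
  qed
  from nil obtain n where n: "\<And>v. (x ^^ n) v = 0" unfolding nilp_def by blast
  have "i \<le> n \<Longrightarrow> (x ^^ (n - i)) ((y ^^ (2 * i)) v) = 0" for i v
  proof (induction i arbitrary: v)
    case (Suc i)
    hence "Suc (n - Suc i) = n - i" by simp
    with Suc show ?case using step[of "n - Suc i" "2 * i"] by simp
  qed (simp add: n)
  from this[of n] have "(y ^^ (2 * n)) v = 0" for v by simp
  thus ?thesis unfolding nilp_def by blast
qed

text \<open>Up to sign \<open>G j\<close> is the \<open>j\<close>-fold commutator of
  \<open>J\<close> with \<open>G 0\<close>, a combination of terms \<open>J^a G\<^sub>0 J^b\<close>
  with \<open>a + b = j\<close>. For \<open>j \<ge> 2 n\<close> one of the exponents is at least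
  \<open>n\<close>.\<close>

lemma nilp_ad:
  fixes J :: "'b::ab_group_add \<Rightarrow> 'b"
  assumes nil: "nilp J" and J: "\<And>u v. J (u - v) = J u - J v"
    and G: "\<And>j v. G (Suc j) v = J (G j v) - G j (J v) \<or> G (Suc j) v = G j (J v) - J (G j v)"
      "G 0 0 = 0"
  shows "\<exists>n. \<forall>j\<ge>n. \<forall>v. G j v = 0"
proof -
  from nil obtain n where n: "\<And>v. (J ^^ n) v = 0" unfolding nilp_def by blast
  have J0: "(J ^^ a) 0 = 0" for a using J[of 0 0] by (induction a) auto
  have big: "(J ^^ a) v = 0" if "a \<ge> n" for a v
    using that n[of v] J0[of "a - n"] by (metis comp_apply funpow_add le_add_diff_inverse2)
  have Jd: "(J ^^ a) (u - v) = (J ^^ a) u - (J ^^ a) v" for a u v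
    by (induction a) (simp_all add: J)
  have "a + b + j \<ge> 2 * n \<Longrightarrow> (J ^^ a) (G j ((J ^^ b) v)) = 0" for a b j v
  proof (induction j arbitrary: a b)
    case 0
    hence "a \<ge> n \<or> b \<ge> n" by linarith
    thus ?case by (elim disjE) (simp_all add: big G J0)
  next
    case (Suc j)
    have "(J ^^ a) (J (G j ((J ^^ b) v))) = 0" "(J ^^ a) (G j (J ((J ^^ b) v))) = 0"
      using Suc.IH[of "Suc a" b] Suc.IH[of a "Suc b"] Suc.prems
      by (simp_all add: funpow_Suc_right[of a J] del: funpow.simps(2)) simp
    with G(1)[of j "(J ^^ b) v"] show ?case by (auto simp: Jd)
  qed
  from this[of 0 0] show ?thesis by (intro exI[of _ "2 * n"]) auto
qed

lemma vector_space_cmul: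
  assumes "module S" shows "vector_space (cmul S)"
proof -
  interpret module S by fact
  show ?thesis
    by unfold_locales
      (simp_all add: cmul_def scale_right_distrib scale_left_distrib[symmetric] mult.commute flip: one_pCons)
qed

lemma endo_cmul:
  assumes "endo S x" shows "endo (cmul S) x"
proof -
  interpret endo S x by fact
  interpret V: vector_space "cmul S" by (rule vector_space_cmul) unfold_locales
  show ?thesis by unfold_locales (simp_all add: x_add x_scale cmul_def)
qed

text \<open>
  A relation \<open>Q(\<partial>, x) = 0\<close> exists since the module is finitely generated. The commutator with \<open>y\<close>
  differentiates it with respect to \<open>\<partial>\<close> at the cost of a factor \<open>h = [y, \<partial>]\<close>, so that eventually
  \<open>\<partial>\<close> disappears.
\<close>

lemma algebraic_endomorphism:
  fixes S :: "complex poly \<Rightarrow> 'm::ab_group_add \<Rightarrow> 'm"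
  assumes S: "module S" and G: "finite G" "module.span S G = UNIV"
    and x: "endo S x" and h: "endo S h"
    and y: "\<And>u v. y (u + v) = y u + y v" "\<And>c v. y (cmul S c v) = cmul S c (y v)"
      "\<And>v. y (deriv_op S v) = deriv_op S (y v) + h v"
    and comm: "\<And>v. y (x v) = x (y v)" "\<And>v. h (x v) = x (h v)" "\<And>v. y (h v) = h (y v)"
  obtains q e where "q \<noteq> 0" "\<And>v. app (cmul S) x q ((h ^^ e) v) = 0"
proof -
  interpret x: endo S x by fact
  interpret h: endo S h by fact
  have y0: "y 0 = 0" using y(1)[of 0 0] by simp
  have S_pCons: "S (pCons a q) v = cmul S a v + deriv_op S (S q v)" for a q v
    by (simp add: cmul_def deriv_op_def x.scale_left_distrib[symmetric])
  have yS: "y (S q v) = S q (y v) + S (pderiv q) (h v)" for q v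
    by (induction q) (simp_all add: y0 S_pCons y pderiv_pCons x.scale_left_distrib,
        simp add: deriv_op_def cmul_def x.scale_right_distrib h.x_scale)
  have yapp: "y (app S x Q v) = app S x Q (y v) + app S x (map_poly pderiv Q) (h v)" for Q v
    by (induction Q) (simp_all add: y0 y(1) yS comm x.x_add map_poly_pCons)
  have happ: "h (app S x Q v) = app S x Q (h v)" for Q v
    by (rule x.app_commute) (simp_all add: h.x_add h.x_scale comm)
  have yh: "y ((h ^^ e) v) = (h ^^ e) (y v)" for e v
    by (induction e) (simp_all add: comm)
  \<comment> \<open>For one generator \<open>g\<close> the \<open>card G + 1\<close> vectors
    \<open>x^i g\<close> are dependent over \<complex>[\<partial>]; the polynomials for different
    generators are multiplied.\<close>
  have "\<exists>Q. Q \<noteq> 0 \<and> (\<forall>g\<in>F. app S x Q g = 0)" if "finite F" for F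
    using that
  proof induction
    case empty
    show ?case by (rule exI[of _ 1]) simp
  next
    case (insert g F)
    then obtain Q where Q: "Q \<noteq> 0" "\<And>g. g \<in> F \<Longrightarrow> app S x Q g = 0" by blast
    obtain q where q: "\<exists>i\<in>{..card G}. q i \<noteq> 0" "(\<Sum>i\<le>card G. S (q i) ((x ^^ i) g)) = 0"
      using linear_dependence[OF S G(1), of "{..card G}" "\<lambda>i. (x ^^ i) g"] G(2) by auto
    define R where "R = (\<Sum>i\<le>card G. monom (q i) i)"
    have "coeff R i = (if i \<le> card G then q i else 0)" for i
      by (auto simp: R_def coeff_sum)
    hence "R \<noteq> 0" using q(1) by (metis atMost_iff coeff_0)
    moreover have "app S x R g = 0"
      using q(2) by (simp add: R_def x.app_sum x.app_monom)
    moreover have "app S x (Q * R) f = 0" if "f \<in> insert g F" for f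
      using that Q(2) \<open>app S x R g = 0\<close> by (metis insertE mult.commute x.app_0_right x.app_mult)
    ultimately show ?case using Q(1) by (intro exI[of _ "Q * R"]) simp
  qed
  from this[OF G(1)] obtain Q where Q: "Q \<noteq> 0" "\<And>g. g \<in> G \<Longrightarrow> app S x Q g = 0" by blast
  have Q': "app S x Q v = 0" for v
  proof -
    have "v \<in> x.span G" by (simp add: G)
    thus ?thesis
      by (induction rule: x.span_induct_alt) (simp_all add: x.app_add_right x.app_scale_right Q)
  qed
  \<comment> \<open>Induction on the bound \<open>m\<close> for the degrees in \<partial>; for
    \<open>m = 0\<close> the coefficients of \<open>Q\<close> are complex numbers.\<close>
  have const: "\<exists>q e. q \<noteq> 0 \<and> (\<forall>v. app (cmul S) x q ((h ^^ e) v) = 0)"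
    if "Q \<noteq> 0" "\<forall>j. degree (coeff Q j) \<le> m" "\<forall>v. app S x Q ((h ^^ e) v) = 0" for Q e m
    using that
  proof (induction m arbitrary: Q e)
    case 0
    define q where "q = map_poly (\<lambda>r. coeff r 0) Q"
    interpret c: endo "cmul S" x by (rule endo_cmul) fact
    have Q: "Q = map_poly (\<lambda>c. [:c:]) q"
    proof (rule poly_eqI)
      fix j show "coeff Q j = coeff (map_poly (\<lambda>c. [:c:]) q) j"
        using 0 degree_eq_zeroE[of "coeff Q j"]
        by (metis coeff_map_poly coeff_0 coeff_pCons_0 le_zero_eq pCons_0_0 q_def)
    qed
    have "app S x (map_poly (\<lambda>c. [:c:]) q) v = app (cmul S) x q v" for q v
      by (induction q) (simp_all add: map_poly_pCons cmul_def[of S, symmetric])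
    with 0 Q show ?case by (metis map_poly_0)
  next
    case (Suc m)
    show ?case
    proof (cases "\<forall>j. degree (coeff Q j) \<le> m")
      case False
      then obtain j where "degree (coeff Q j) \<noteq> 0" by fastforce
      hence "pderiv (coeff Q j) \<noteq> 0" by (simp add: pderiv_eq_0_iff)
      hence "map_poly pderiv Q \<noteq> 0" by (metis coeff_0 coeff_map_poly pderiv_0)
      moreover have "degree (coeff (map_poly pderiv Q) j) \<le> m" for j
        using Suc.prems(2) by (auto simp: coeff_map_poly degree_pderiv le_diff_conv)
      moreover have "app S x (map_poly pderiv Q) ((h ^^ Suc e) v) = 0" for v
        using yapp[of Q "(h ^^ e) v"] Suc.prems(3) by (simp add: y0 yh)
      ultimately show ?thesis using Suc.IH by blast
    qed (use Suc in blast)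
  qed
  let ?m = "Max ((\<lambda>j. degree (coeff Q j)) ` {..degree Q})"
  have "degree (coeff Q j) \<le> ?m" for j
    by (cases "j \<le> degree Q") (auto intro!: Max_ge simp: coeff_eq_0)
  with const[of Q ?m 0] Q(1) Q' have "\<exists>q e. q \<noteq> 0 \<and> (\<forall>v. app (cmul S) x q ((h ^^ e) v) = 0)"
    by simp
  with that show thesis by blast
qed

section \<open>Operators annihilated by a complex polynomial\<close>

locale cendo = endo sc x for sc :: "complex \<Rightarrow> 'b::ab_group_add \<Rightarrow> 'b" and x

lemma (in cendo) obtain_minimal:
  assumes "q \<noteq> 0" "\<And>v. app sc x q v = 0"
  obtains q where "q \<noteq> 0" "\<And>v. app sc x q v = 0"
    "\<And>r. \<lbrakk>degree r < degree q; \<And>v. app sc x r v = 0\<rbrakk> \<Longrightarrow> r = 0"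
proof -
  define P where "P q \<longleftrightarrow> q \<noteq> 0 \<and> (\<forall>v. app sc x q v = 0)" for q
  have "P q" using assms by (simp add: P_def)
  then obtain q where "P q" "\<And>r. P r \<Longrightarrow> degree q \<le> degree r"
    using ex_has_least_nat[of P q degree] by blast
  thus thesis using that[of q] unfolding P_def by (metis not_less)
qed

text \<open>The commutator with \<open>E\<close> turns \<open>q(x) = 0\<close> into
  \<open>a x q'(x) = 0\<close>. If \<open>q\<close> has least degree, the polynomial
  \<open>t q' - (deg q) q\<close>, whose leading terms cancel, must be zero, so \<open>q\<close> is
  a monomial.\<close>

lemma (in cendo) nilp_of_weight:
  assumes q: "q \<noteq> 0" "\<And>v. app sc x q v = 0"
    and E: "\<And>u v. E (u + v) = E u + E v" "\<And>c v. E (sc c v) = sc c (E v)"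
      "\<And>v. E (x v) = x (E v) + sc a (x v)" and a: "a \<noteq> 0"
  shows "nilp x"
proof -
  obtain q where q: "q \<noteq> 0" "\<And>v. app sc x q v = 0"
    "\<And>r. \<lbrakk>degree r < degree q; \<And>v. app sc x r v = 0\<rbrakk> \<Longrightarrow> r = 0"
    using obtain_minimal[of q] assms(1,2) by metis
  have E0: "E 0 = 0" using E(1)[of 0 0] by simp
  define r where "r = pCons 0 (pderiv q) - smult (of_nat (degree q)) q"
  have cr: "coeff r i = (of_nat i - of_nat (degree q)) * coeff q i" for i
    by (cases i) (simp_all add: r_def coeff_pderiv algebra_simps)
  have "app sc x r v = 0" for v
  proof -
    have "0 = E (app sc x q v)" by (simp only: q(2) E0)
    also have "\<dots> = app sc x q (E v) + app sc x (pderiv q) (sc a (x v))"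
      by (rule app_derivation) (simp_all add: E x_add x_scale scale_right_distrib mult.commute)
    also have "\<dots> = sc a (app sc x (pCons 0 (pderiv q)) v)"
      by (simp add: q(2) app_scale_right app_x)
    finally have "sc (inverse a) (sc a (app sc x (pCons 0 (pderiv q)) v)) = 0" by simp
    thus ?thesis using a by (simp add: r_def app_diff app_smult q(2))
  qed
  moreover have "degree r < degree q \<or> r = 0"
  proof -
    have "coeff r i = 0" if "i > degree q - 1" for i
    proof (cases "i = degree q")
      case False
      with that have "degree q < i" by linarith
      thus ?thesis by (simp add: cr coeff_eq_0)
    qed (simp add: cr)
    hence "degree r \<le> degree q - 1" by (intro degree_le) blast
    moreover have "r = 0" if "degree q = 0"
    proof (rule poly_eqI)
      fix i show "coeff r i = coeff 0 i" using that by (cases i) (simp_all add: cr coeff_eq_0)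
    qed
    ultimately show ?thesis by linarith
  qed
  ultimately have "r = 0" using q(3) by blast
  hence "coeff q i = 0" if "i \<noteq> degree q" for i using cr[of i] that by simp
  hence "q = monom (lead_coeff q) (degree q)" by (intro poly_eqI) auto
  hence "sc (lead_coeff q) ((x ^^ degree q) v) = 0" for v
    using q(2)[of v] app_monom by metis
  hence "sc (inverse (lead_coeff q)) (sc (lead_coeff q) ((x ^^ degree q) v)) = 0" for v by simp
  hence "(x ^^ degree q) v = 0" for v using q(1) by simp
  thus ?thesis unfolding nilp_def by blast
qed

text \<open>The commutator with \<open>E\<close> differentiates an annihilating polynomial of least
  degree. The derivative must vanish, so a nonzero constant annihilates the space.\<close>

lemma (in cendo) algebraic_not_conjugate:
  assumes q: "q \<noteq> 0" "\<And>v. app sc x q v = 0"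
    and E: "\<And>u v. E (u + v) = E u + E v" "\<And>c v. E (sc c v) = sc c (E v)"
      "\<And>v. E (x v) = x (E v) + sc a v" and a: "a \<noteq> 0"
  shows "(w::'b) = 0"
proof -
  obtain q where q: "q \<noteq> 0" "\<And>v. app sc x q v = 0"
    "\<And>r. \<lbrakk>degree r < degree q; \<And>v. app sc x r v = 0\<rbrakk> \<Longrightarrow> r = 0"
    using obtain_minimal[of q] assms(1,2) by metis
  have E0: "E 0 = 0" using E(1)[of 0 0] by simp
  have "app sc x (pderiv q) v = 0" for v
  proof -
    have "0 = E (app sc x q v)" by (simp only: q(2) E0)
    also have "\<dots> = app sc x q (E v) + app sc x (pderiv q) (sc a v)"
      by (rule app_derivation) (simp_all add: E x_add x_scale scale_right_distrib mult.commute)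
    finally have "sc (inverse a) (sc a (app sc x (pderiv q) v)) = 0" by (simp add: q(2) app_scale_right)
    thus ?thesis using a by simp
  qed
  hence "degree q = 0"
    using q(3)[of "pderiv q"] degree_pderiv[of q] pderiv_eq_0_iff[of q] by fastforce
  then obtain c where "q = [:c:]" by (auto elim: degree_eq_zeroE)
  with q(1) have c: "c \<noteq> 0" and "sc c w = 0" using q(2)[of w] \<open>q = [:c:]\<close> by auto
  hence "sc (inverse c) (sc c w) = 0" by simp
  with c show ?thesis by simp
qed

text \<open>Linear factors are split off \<open>q\<close> until the rest no longer kills
  \<open>v\<close>. The eigenvector is a polynomial in \<open>x\<close> applied to \<open>v\<close>,
  so it stays in every invariant subspace containing \<open>v\<close>.\<close>

lemma (in cendo) obtain_eigenvector:
  assumes "q \<noteq> 0" "app sc x q v = 0" "v \<noteq> 0"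
  obtains r t where "app sc x r v \<noteq> 0" "x (app sc x r v) = sc t (app sc x r v)"
proof -
  have "\<exists>r t. app sc x r v \<noteq> 0 \<and> x (app sc x r v) = sc t (app sc x r v)"
    using assms(1,2)
  proof (induction "degree q" arbitrary: q)
    case 0
    then obtain c where c: "q = [:c:]" "c \<noteq> 0" by (metis degree_eq_zeroE pCons_0_0)
    hence "sc (inverse c) (sc c v) = 0" using 0 by simp
    with c assms(3) show ?case by simp
  next
    case (Suc n)
    then obtain t where t: "poly q t = 0"
      by (metis constant_degree fundamental_theorem_of_algebra nat.distinct(1))
    then obtain q' where q': "q = [:- t, 1:] * q'" by (metis dvd_def poly_eq_0_iff_dvd)
    with Suc.prems(1) have "q' \<noteq> 0" by auto
    with Suc.hyps(2) have "n = degree q'"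
      using degree_mult_eq[of "[:- t, 1:]" q'] unfolding q' by simp
    show ?case
    proof (cases "app sc x q' v = 0")
      case True
      with Suc.hyps(1)[of q'] \<open>q' \<noteq> 0\<close> \<open>n = degree q'\<close> show ?thesis by blast
    next
      case False
      have "0 = app sc x [:- t, 1:] (app sc x q' v)" using Suc.prems(2) unfolding q' app_mult by simp
      hence "x (app sc x q' v) = sc t (app sc x q' v)" by simp
      with False show ?thesis by blast
    qed
  qed
  with that show thesis by blast
qed

text \<open>The last nonzero vector \<open>x^m v\<close> is killed by \<open>x\<close> and, by
  \<open>comm\<close>, by every member of \<open>X\<close> that kills \<open>v\<close>. So the
  number of members not killing the vector drops, while \<open>X\<close> itself may be
  infinite.\<close>

lemma common_kernel:
  fixes v :: "'b::zero"
  assumes comm: "\<And>x y v. \<lbrakk>x \<in> X; y \<in> X; y v = 0\<rbrakk> \<Longrightarrow> y (x v) = 0"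
    and nil: "\<And>x. x \<in> X \<Longrightarrow> nilp x"
    and fin: "finite {x\<in>X. x v \<noteq> 0}" and v: "v \<noteq> 0"
  obtains w where "w \<noteq> 0" "\<And>x. x \<in> X \<Longrightarrow> x w = 0"
proof -
  have "\<exists>w. w \<noteq> 0 \<and> (\<forall>x\<in>X. x w = 0)"
    using fin v
  proof (induction "card {x\<in>X. x v \<noteq> 0}" arbitrary: v rule: less_induct)
    case less
    show ?case
    proof (cases "{x\<in>X. x v \<noteq> 0} = {}")
      case True
      with less show ?thesis by blast
    next
      case False
      then obtain x where x: "x \<in> X" "x v \<noteq> 0" by blast
      from nil[OF x(1)] obtain n where "(x ^^ n) v = 0" unfolding nilp_def by blast
      moreover have "(x ^^ n) v = 0 \<Longrightarrow> \<exists>m. (x ^^ m) v \<noteq> 0 \<and> x ((x ^^ m) v) = 0" for n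
        using less.prems(2) by (induction n) auto
      ultimately obtain m where m: "(x ^^ m) v \<noteq> 0" "x ((x ^^ m) v) = 0" by blast
      have "y ((x ^^ m) v) = 0" if "y \<in> X" "y v = 0" for y
        by (induction m) (simp_all add: that comm x)
      hence "{y\<in>X. y ((x ^^ m) v) \<noteq> 0} \<subset> {y\<in>X. y v \<noteq> 0}" using x m(2) by blast
      with less show ?thesis using m(1) by (meson finite_subset psubset_card_mono psubset_imp_subset)
    qed
  qed
  with that show thesis by blast
qed

section \<open>Modes of the generators\<close>

lemma nest_0 [simp]: "f 0 = 0 \<Longrightarrow> nest S T f 0 = 0"
  by (simp add: nest_def)

lemma mul1_add: "mul1 (P + Q) = mul1 P + mul1 (Q :: 'm::ab_group_add poly poly)"
  by (rule map_poly_additive) simp_all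

lemma nest_pCons:
  assumes "f 0 = 0" "S 0 = 0" "\<And>x y. S (x + y) = S x + S y"
  shows "nest S T f (pCons a P) = subst T (\<lambda>y. [:[:y:]:]) (f a) + S (nest S T f P)"
  unfolding nest_def by (subst subst_pCons) (simp_all add: assms)

lemma coeff_subst_mul1:
  fixes P :: "'m::ab_group_add poly"
  shows "subst mul1 (\<lambda>y. [:[:y:]:]) P = [:P:]"
  by (induction P) (simp_all add: subst_pCons mul1_add map_poly_pCons)

lemma coeff_subst_mul2:
  fixes P :: "'m::ab_group_add poly"
  shows "coeff (coeff (subst mul2 (\<lambda>y. [:[:y:]:]) P) n) m = (if m = 0 then coeff P n else 0)"
  by (induction P arbitrary: n) (auto simp: subst_pCons coeff_pCons split: nat.split)

lemma coeff_nest_21: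
  fixes f :: "'r::zero \<Rightarrow> 'm::ab_group_add poly"
  assumes "f 0 = 0"
  shows "coeff (coeff (nest mul2 mul1 f P) n) m = coeff (f (coeff P n)) m"
  using assms by (induction P arbitrary: n)
    (auto simp: nest_pCons coeff_subst_mul1 coeff_pCons split: nat.split)

lemma coeff_nest_12:
  fixes f :: "'r::zero \<Rightarrow> 'm::ab_group_add poly"
  assumes "f 0 = 0"
  shows "coeff (coeff (nest mul1 mul2 f P) n) m = coeff (f (coeff P m)) n"
  using assms by (induction P arbitrary: m)
    (auto simp: nest_pCons coeff_subst_mul2 coeff_pCons mul1_add coeff_map_poly split: nat.split)

text \<open>This is the binomial expansion of \<open>(\<lambda> + \<mu>)^(m+n)\<close>, with
  \<open>m\<close> the exponent of \<lambda> and \<open>n\<close> that of \<mu>; the induction is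
  Pascal's rule.\<close>

lemma coeff_subst_mul12:
  fixes P :: "'m::ab_group_add poly"
  assumes "module sc"
  shows "coeff (coeff (subst mul12 (\<lambda>y. [:[:y:]:]) P) n) m =
    sc (of_nat ((m + n) choose n)) (coeff P (m + n))"
proof -
  interpret module sc by fact
  show ?thesis
  proof (induction P arbitrary: m n)
    case (pCons a P)
    have "subst mul12 (\<lambda>y. [:[:y:]:]) (pCons a P) = [:[:a:]:] + mul12 (subst mul12 (\<lambda>y. [:[:y:]:]) P)"
      by (rule subst_pCons) (simp_all add: mul1_add add_ac)
    hence "coeff (coeff (subst mul12 (\<lambda>y. [:[:y:]:]) (pCons a P)) n) m =
      (if n = 0 \<and> m = 0 then a else 0)
      + (case m of 0 \<Rightarrow> 0 | Suc m \<Rightarrow> sc (of_nat ((m + n) choose n)) (coeff P (m + n)))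
      + (case n of 0 \<Rightarrow> 0 | Suc n \<Rightarrow> sc (of_nat ((m + n) choose n)) (coeff P (m + n)))"
      by (simp add: coeff_pCons coeff_map_poly pCons.IH split: nat.split)
    also have "\<dots> = sc (of_nat ((m + n) choose n)) (coeff (pCons a P) (m + n))"
      by (cases m; cases n) (simp_all add: scale_left_distrib[symmetric] add.commute)
    finally show ?case .
  qed simp
qed

lemma extend_single: "extend f (Poly_Mapping.single a 1) (Poly_Mapping.single b 1) = f a b"
  by (rule ev_eqI) (simp add: ev_extend_keys)

abbreviation gen_elem :: "'a \<Rightarrow> 'a free"
  where "gen_elem g \<equiv> Poly_Mapping.single g 1"

lemma gen_elem_part: "gen_elem g \<in> free_part par (par g)"
  by (simp add: free_part_def)

lemma free_induct:
  fixes x :: "'a free"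
  assumes "\<And>b q. P (Poly_Mapping.single b q)" "\<And>x y. \<lbrakk>P x; P y\<rbrakk> \<Longrightarrow> P (x + y)"
  shows "P x"
proof -
  have x: "x = (\<Sum>b\<in>Poly_Mapping.keys x. Poly_Mapping.single b (Poly_Mapping.lookup x b))"
  proof (rule poly_mapping_eqI)
    fix b show "Poly_Mapping.lookup x b =
      Poly_Mapping.lookup (\<Sum>b\<in>Poly_Mapping.keys x. Poly_Mapping.single b (Poly_Mapping.lookup x b)) b"
      by (simp add: lookup_sum lookup_single when_def in_keys_iff)
  qed
  have "P 0" using assms(1)[of undefined 0] by simp
  hence "P (\<Sum>b\<in>A. Poly_Mapping.single b (Poly_Mapping.lookup x b))" for A
    by (induction A rule: infinite_finite_induct) (simp_all add: assms)
  with x show ?thesis by metis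
qed

lemma free_smul_single: "free_smul q (Poly_Mapping.single b r) = Poly_Mapping.single b (q * r)"
  by (rule poly_mapping_eqI) (simp add: lookup_free_smul lookup_single when_def)

section \<open>The modes of a conformal module\<close>

locale K_module = conformal_module "K_alg p" M
  for p :: complex and M :: "(gen free, 'm::ab_group_add) conf_mod"
begin

sublocale S: module "smul M"
  by (rule M.module)

sublocale V: vector_space "cmul (smul M)"
  by (rule vector_space_cmul) unfold_locales

abbreviation cm :: "complex \<Rightarrow> 'm \<Rightarrow> 'm" (infixr "\<cdot>" 75)
  where "c \<cdot> v \<equiv> cmul (smul M) c v"

abbreviation D :: "'m \<Rightarrow> 'm"
  where "D \<equiv> deriv_op (smul M)"

text \<open>
  The factorial makes the structure constants of the commutators linear in the indices of the modes.
\<close>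

definition md :: "gen \<Rightarrow> nat \<Rightarrow> 'm \<Rightarrow> 'm"
  where "md g n v = fact n \<cdot> coeff (act M (gen_elem g) v) n"

lemma D_add: "D (u + v) = D u + D v"
  by (simp add: deriv_op_def S.scale_right_distrib)

lemma D_cm: "D (c \<cdot> v) = c \<cdot> D v"
  by (simp add: deriv_op_def cmul_def mult.commute)

lemma D_smul: "D (smul M q v) = smul M q (D v)"
  by (simp add: deriv_op_def mult.commute)

lemma smul_pCons: "smul M (pCons a q) v = a \<cdot> v + D (smul M q v)"
  by (simp add: cmul_def deriv_op_def S.scale_left_distrib[symmetric])

lemma act_0_left [simp]: "act M 0 v = 0"
  using add_left[of 0 0 v] by simp

lemma act_0_right [simp]: "act M a 0 = 0"
  using add_right[of a 0 0] by simp

lemma coeff_act: "coeff (act M (gen_elem g) v) n = inverse (fact n) \<cdot> md g n v"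
  by (simp add: md_def)

lemma md_add: "md g n (u + v) = md g n u + md g n v"
  by (simp add: md_def add_right V.scale_right_distrib)

lemma md_cm: "md g n (c \<cdot> v) = c \<cdot> md g n v"
  by (simp add: md_def cmul_right coeff_map_poly mult.commute)

lemma md_0 [simp]: "md g n 0 = 0"
  using md_add[of g n 0 0] by simp

text \<open>Coefficient of \<open>\<lambda>^n\<close> in \<open>a\<^sub>\<lambda>(\<partial>v) =
  (\<partial>+\<lambda>) a\<^sub>\<lambda> v\<close>, so that
  \<open>[x(n), \<partial>] = n x(n-1)\<close>. For \<open>n = 0\<close> the truncated index carries
  the factor 0.\<close>

lemma md_D: "md g n (D v) = D (md g n v) + of_nat n \<cdot> md g (n - 1) v"
proof -
  have *: "D 0 = 0" using D_add[of 0 0] by simp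
  have "coeff (act M (gen_elem g) (D v)) n =
    D (coeff (act M (gen_elem g) v) n) + (case n of 0 \<Rightarrow> 0 | Suc n \<Rightarrow> coeff (act M (gen_elem g) v) n)"
    by (simp add: deriv_right deriv_plus_lam_def coeff_map_poly * coeff_pCons)
  thus ?thesis
    by (cases n) (simp_all add: md_def V.scale_right_distrib D_cm D_add algebra_simps)
qed

lemma md_eventually: "\<exists>N. \<forall>n\<ge>N. md g n v = 0"
  by (intro exI[of _ "Suc (degree (act M (gen_elem g) v))"]) (auto simp: md_def coeff_eq_0)

lemma md_part: "v \<in> part M i \<Longrightarrow> md g n v \<in> part M (gen_parity g + i)"
  using parity[of "gen_elem g" "gen_parity g" v i n] gen_elem_part[of g gen_parity]
    S.subspace_scale[OF M.subspace_part] by (simp add: md_def cmul_def)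

section \<open>Commutators of the modes\<close>

lemma act_single_const: "act M (Poly_Mapping.single c [:a:]) v = map_poly (cm a) (act M (gen_elem c) v)"
  using cmul_left[of a "gen_elem c" v] by (simp add: cmul_def[of free_smul] free_smul_single)

lemma act_single_deriv:
  "act M (Poly_Mapping.single c (pCons 0 q)) v = - mul_lam (act M (Poly_Mapping.single c q) v)"
  using deriv_left[of "Poly_Mapping.single c q" v] by (simp add: deriv_op_def free_smul_single)

text \<open>Coefficient of \<open>\<lambda>^m \<mu>^n\<close> in the module identity, times
  \<open>m! n!\<close>, for a bracket \<open>(A\<partial> + B\<lambda>) c + C c'\<close>. In the
  action at \<lambda>+\<mu>, \<partial> becomes \<open>-(\<lambda>+\<mu>)\<close> and contributes
  \<open>-A(m+n)\<close>, while \<lambda> contributes \<open>B m\<close>. For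
  \<open>m = n = 0\<close> the truncated index carries the factor 0.\<close>

lemma md_bracket:
  assumes "K_bracket p a b = [: Poly_Mapping.single c [:0, A:] + Poly_Mapping.single c' [:C:],
    Poly_Mapping.single c [:B:] :]"
  shows "md a m (md b n v) - koszul (gen_parity a) (gen_parity b) (md b n (md a m v)) =
    (B * of_nat m - A * of_nat (m + n)) \<cdot> md c (m + n - 1) v + C \<cdot> md c' (m + n) v"
proof -
  let ?f = "\<lambda>x. act M x v"
  define k :: "'m \<Rightarrow> 'm" where "k = koszul (gen_parity a) (gen_parity b)"
  have k: "k (c \<cdot> x) = c \<cdot> k x" for c x by (simp add: k_def koszul_def)
  have kc: "coeff (coeff (koszul (gen_parity a) (gen_parity b) Q) n) m = k (coeff (coeff Q n) m)" for Q
    by (simp add: k_def koszul_def)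
  have a0: "coeff (?f (Poly_Mapping.single c [:0, A:] + Poly_Mapping.single c' [:C:])) l =
    (if l = 0 then 0 else - (A \<cdot> coeff (?f (gen_elem c)) (l - 1))) + C \<cdot> coeff (?f (gen_elem c')) l" for l
    by (simp add: add_left act_single_const act_single_deriv coeff_map_poly coeff_pCons split: nat.split)
  have a1: "coeff (?f (Poly_Mapping.single c [:B:])) l = B \<cdot> coeff (?f (gen_elem c)) l" for l
    by (simp add: act_single_const coeff_map_poly)
  have "nest mul1 mul12 ?f [:X, Y:] = subst mul12 (\<lambda>y. [:[:y:]:]) (?f X) + mul1 (subst mul12 (\<lambda>y. [:[:y:]:]) (?f Y))" for X Y
    by (simp add: nest_pCons mul1_add)
  hence N: "coeff (coeff (nest mul1 mul12 ?f (K_bracket p a b)) n) m =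
    of_nat ((m + n) choose n) \<cdot> ((if m + n = 0 then 0 else - (A \<cdot> coeff (?f (gen_elem c)) (m + n - 1))) + C \<cdot> coeff (?f (gen_elem c')) (m + n))
    + (if m = 0 then 0 else of_nat ((m - 1 + n) choose n) \<cdot> B \<cdot> coeff (?f (gen_elem c)) (m - 1 + n))"
    by (simp add: assms coeff_map_poly coeff_pCons a0 a1 coeff_subst_mul12[OF V.module_axioms] split: nat.split)
  have "nest mul1 mul12 ?f (K_bracket p a b) =
      nest mul2 mul1 (act M (gen_elem a)) (act M (gen_elem b) v)
      - koszul (gen_parity a) (gen_parity b) (nest mul1 mul2 (act M (gen_elem b)) (act M (gen_elem a) v))"
    using act_bracket[of "gen_elem a" "gen_parity a" "gen_elem b" "gen_parity b" v]
    by (simp add: gen_elem_part extend_single)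
  hence "coeff (coeff (nest mul1 mul12 ?f (K_bracket p a b)) n) m =
    coeff (act M (gen_elem a) (coeff (act M (gen_elem b) v) n)) m
    - k (coeff (act M (gen_elem b) (coeff (act M (gen_elem a) v) m)) n)"
    by (simp add: coeff_nest_21 coeff_nest_12 kc)
  moreover have inv: "fact m * fact n * (inverse (fact m) * inverse (fact n)) = (1::complex)"
    "fact m * fact n * (inverse (fact n) * inverse (fact m)) = (1::complex)"
    using fact_nonzero[of m, where 'a=complex] fact_nonzero[of n, where 'a=complex]
    by (simp_all add: nonzero_mult_div_cancel_left divide_simps)
  ultimately have "(fact m * fact n) \<cdot> coeff (coeff (nest mul1 mul12 ?f (K_bracket p a b)) n) m =
      (fact m * fact n * (inverse (fact m) * inverse (fact n))) \<cdot> md a m (md b n v)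
      - (fact m * fact n * (inverse (fact n) * inverse (fact m))) \<cdot> k (md b n (md a m v))"
    by (simp only: coeff_act md_cm k V.scale_right_diff_distrib V.scale_scale mult.assoc)
  hence "(fact m * fact n) \<cdot> coeff (coeff (nest mul1 mul12 ?f (K_bracket p a b)) n) m =
    md a m (md b n v) - k (md b n (md a m v))"
    by (simp only: inv V.scale_one)
  moreover have "(fact m * fact n) \<cdot> coeff (coeff (nest mul1 mul12 ?f (K_bracket p a b)) n) m =
    (B * of_nat m - A * of_nat (m + n)) \<cdot> md c (m + n - 1) v + C \<cdot> md c' (m + n) v"
  proof -
    have 1: "fact m * fact n * of_nat ((m + n) choose n) = (fact (m + n) :: complex)" for m n
    proof -
      have "fact n * fact m * ((m + n) choose n) = (fact (m + n) :: nat)"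
        using binomial_fact_lemma[of n "m + n"] by simp
      hence "of_nat (fact n * fact m * ((m + n) choose n)) = (of_nat (fact (m + n)) :: complex)" by (rule arg_cong)
      thus ?thesis by (simp only: of_nat_mult of_nat_fact mult.commute)
    qed
    have 2: "fact m * fact n * of_nat ((m - 1 + n) choose n) = of_nat m * (fact (m + n - 1) :: complex)" if "m \<noteq> 0"
    proof -
      from that obtain l where l: "m = Suc l" by (cases m) auto
      have "fact m * fact n * of_nat ((m - 1 + n) choose n) = of_nat m * (fact l * fact n * of_nat ((l + n) choose n) :: complex)"
        by (simp add: l)
      thus ?thesis by (simp only: 1) (simp add: l)
    qed
    have 3: "fact (m + n) = of_nat (m + n) * (fact (m + n - 1) :: complex)" if "m + n \<noteq> 0"
      using that by (simp add: fact_reduce)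
    show ?thesis
    proof (cases "m + n = 0")
      case True
      thus ?thesis unfolding N by (simp add: coeff_act)
    next
      case False
      define x where "x = coeff (?f (gen_elem c)) (m + n - 1)"
      define y where "y = coeff (?f (gen_elem c')) (m + n)"
      have 5: "(if m = 0 then 0 else of_nat ((m - 1 + n) choose n) \<cdot> B \<cdot> coeff (?f (gen_elem c)) (m - 1 + n))
        = (if m = 0 then 0 else of_nat ((m - 1 + n) choose n)) \<cdot> B \<cdot> x"
        by (cases m) (simp_all add: x_def)
      have 4: "fact m * fact n * (if m = 0 then 0 else of_nat ((m - 1 + n) choose n)) = of_nat m * (fact (m + n - 1) :: complex)"
        using 2 by simp
      have "(fact m * fact n) \<cdot> coeff (coeff (nest mul1 mul12 ?f (K_bracket p a b)) n) m =
        (fact m * fact n * of_nat ((m + n) choose n)) \<cdot> (- (A \<cdot> x) + C \<cdot> y)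
        + (fact m * fact n * (if m = 0 then 0 else of_nat ((m - 1 + n) choose n))) \<cdot> B \<cdot> x"
        unfolding N 5 using False
        by (simp only: V.scale_right_distrib V.scale_scale mult.assoc if_False x_def y_def)
      also have "\<dots> = (of_nat (m + n) * fact (m + n - 1)) \<cdot> (- (A \<cdot> x)) + fact (m + n) \<cdot> C \<cdot> y + (of_nat m * fact (m + n - 1)) \<cdot> B \<cdot> x"
        by (simp only: 1 4 V.scale_right_distrib) (simp only: 3[OF False])
      also have "\<dots> = (B * of_nat m - A * of_nat (m + n)) \<cdot> fact (m + n - 1) \<cdot> x + C \<cdot> fact (m + n) \<cdot> y"
        by (simp add: V.scale_left_diff_distrib right_diff_distrib mult_ac del: of_nat_add)
      finally show ?thesis by (simp add: md_def x_def y_def)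
    qed
  qed
  ultimately show ?thesis by (simp add: k_def)
qed

text \<open>For \<open>i = j = 0\<close> these are, up to the factor \<open>p\<close>, the relations
  of the vector fields \<open>-t^m d/dt\<close>. Here and in the next three lemmas the commutator of
  \<open>L\<^sub>0(1)\<close> with a mode is a multiple of that mode, its weight.\<close>

lemma L_L: "md (L i) m (md (L j) n v) = md (L j) n (md (L i) m v)
    + ((of_nat j + p) * of_nat m - (of_nat i + p) * of_nat n) \<cdot> md (L (i + j)) (m + n - 1) v"
proof -
  \<comment> \<open>The bracket is brought to the form of \<open>md_bracket\<close>; summands with
    coefficient 0 are padded with the arbitrary generator \<open>L 0\<close>.\<close>
  have *: "K_bracket p (L i) (L j) = [: Poly_Mapping.single (L (i + j)) [:0, of_nat i + p:]
      + Poly_Mapping.single (L 0) [:0:], Poly_Mapping.single (L (i + j)) [:of_nat i + of_nat j + 2 * p:] :]"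
    by (simp add: K_bracket_def term_of_basis_def map_poly_pCons)
  have e: "(of_nat i + of_nat j + 2 * p) * of_nat m - (of_nat i + p) * of_nat (m + n) = (of_nat j + p) * of_nat m - (of_nat i + p) * of_nat n"
    by (simp add: algebra_simps)
  from md_bracket[OF *, of m n v, unfolded e] show ?thesis
    by (simp add: koszul_def diff_eq_eq add_ac eq_neg_iff_add_eq_0 del: of_nat_add)
qed

lemma L_J: "md (L i) m (md (J j) n v) = md (J j) n (md (L i) m v)
    + (of_nat j * of_nat m - (of_nat i + p) * of_nat n) \<cdot> md (J (i + j)) (m + n - 1) v"
proof -
  have *: "K_bracket p (L i) (J j) = [: Poly_Mapping.single (J (i + j)) [:0, of_nat i + p:]
      + Poly_Mapping.single (L 0) [:0:], Poly_Mapping.single (J (i + j)) [:of_nat i + of_nat j + p:] :]"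
    by (simp add: K_bracket_def term_of_basis_def map_poly_pCons)
  have e: "(of_nat i + of_nat j + p) * of_nat m - (of_nat i + p) * of_nat (m + n) = of_nat j * of_nat m - (of_nat i + p) * of_nat n"
    by (simp add: algebra_simps)
  from md_bracket[OF *, of m n v, unfolded e] show ?thesis
    by (simp add: koszul_def diff_eq_eq add_ac eq_neg_iff_add_eq_0 del: of_nat_add)
qed

lemma L_Gp: "md (L i) m (md (Gp j) n v) = md (Gp j) n (md (L i) m v)
    + ((of_nat j + p / 2) * of_nat m - (of_nat i + p) * of_nat n) \<cdot> md (Gp (i + j)) (m + n - 1) v"
proof -
  have *: "K_bracket p (L i) (Gp j) = [: Poly_Mapping.single (Gp (i + j)) [:0, of_nat i + p:]
      + Poly_Mapping.single (L 0) [:0:], Poly_Mapping.single (Gp (i + j)) [:of_nat i + of_nat j + 3/2 * p:] :]"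
    by (simp add: K_bracket_def term_of_basis_def map_poly_pCons)
  have e: "(of_nat i + of_nat j + 3/2 * p) * of_nat m - (of_nat i + p) * of_nat (m + n) = (of_nat j + p / 2) * of_nat m - (of_nat i + p) * of_nat n"
    by (simp add: algebra_simps)
  from md_bracket[OF *, of m n v, unfolded e] show ?thesis
    by (simp add: koszul_def diff_eq_eq add_ac eq_neg_iff_add_eq_0 del: of_nat_add)
qed

lemma L_Gm: "md (L i) m (md (Gm j) n v) = md (Gm j) n (md (L i) m v)
    + ((of_nat j + p / 2) * of_nat m - (of_nat i + p) * of_nat n) \<cdot> md (Gm (i + j)) (m + n - 1) v"
proof -
  have *: "K_bracket p (L i) (Gm j) = [: Poly_Mapping.single (Gm (i + j)) [:0, of_nat i + p:]
      + Poly_Mapping.single (L 0) [:0:], Poly_Mapping.single (Gm (i + j)) [:of_nat i + of_nat j + 3/2 * p:] :]"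
    by (simp add: K_bracket_def term_of_basis_def map_poly_pCons)
  have e: "(of_nat i + of_nat j + 3/2 * p) * of_nat m - (of_nat i + p) * of_nat (m + n) = (of_nat j + p / 2) * of_nat m - (of_nat i + p) * of_nat n"
    by (simp add: algebra_simps)
  from md_bracket[OF *, of m n v, unfolded e] show ?thesis
    by (simp add: koszul_def diff_eq_eq add_ac eq_neg_iff_add_eq_0 del: of_nat_add)
qed

lemma J_J: "md (J i) m (md (J j) n v) = md (J j) n (md (J i) m v)"
proof -
  have *: "K_bracket p (J i) (J j) = [: Poly_Mapping.single (L 0) [:0, 0:]
      + Poly_Mapping.single (L 0) [:0:], Poly_Mapping.single (L 0) [:0:] :]"
    by (simp add: K_bracket_def)
  from md_bracket[OF *, of m n v] show ?thesis by (simp add: koszul_def)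
qed

lemma J_Gp: "md (J i) m (md (Gp j) n v) = md (Gp j) n (md (J i) m v) + md (Gp (i + j)) (m + n) v"
proof -
  have *: "K_bracket p (J i) (Gp j) = [: Poly_Mapping.single (L 0) [:0, 0:]
      + Poly_Mapping.single (Gp (i + j)) [:1:], Poly_Mapping.single (L 0) [:0:] :]"
    by (simp add: K_bracket_def term_of_basis_def map_poly_pCons)
  from md_bracket[OF *, of m n v] show ?thesis by (simp add: koszul_def algebra_simps)
qed

lemma J_Gm: "md (J i) m (md (Gm j) n v) = md (Gm j) n (md (J i) m v) - md (Gm (i + j)) (m + n) v"
proof -
  have *: "K_bracket p (J i) (Gm j) = [: Poly_Mapping.single (L 0) [:0, 0:]
      + Poly_Mapping.single (Gm (i + j)) [:-1:], Poly_Mapping.single (L 0) [:0:] :]"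
    by (simp add: K_bracket_def term_of_basis_def map_poly_pCons)
  from md_bracket[OF *, of m n v] show ?thesis by (simp add: koszul_def algebra_simps)
qed

lemma Gp_Gp: "md (Gp i) m (md (Gp j) n v) = - md (Gp j) n (md (Gp i) m v)"
proof -
  have *: "K_bracket p (Gp i) (Gp j) = [: Poly_Mapping.single (L 0) [:0, 0:]
      + Poly_Mapping.single (L 0) [:0:], Poly_Mapping.single (L 0) [:0:] :]"
    by (simp add: K_bracket_def)
  from md_bracket[OF *, of m n v] show ?thesis by (simp add: koszul_def eq_neg_iff_add_eq_0)
qed

lemma Gm_Gm: "md (Gm i) m (md (Gm j) n v) = - md (Gm j) n (md (Gm i) m v)"
proof -
  have *: "K_bracket p (Gm i) (Gm j) = [: Poly_Mapping.single (L 0) [:0, 0:]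
      + Poly_Mapping.single (L 0) [:0:], Poly_Mapping.single (L 0) [:0:] :]"
    by (simp add: K_bracket_def)
  from md_bracket[OF *, of m n v] show ?thesis by (simp add: koszul_def eq_neg_iff_add_eq_0)
qed

lemma Gp_Gm: "md (Gp i) m (md (Gm j) n v) = - md (Gm j) n (md (Gp i) m v)
    + ((2 * of_nat j + p) * of_nat m - (2 * of_nat i + p) * of_nat n) \<cdot> md (J (i + j)) (m + n - 1) v
    + 2 \<cdot> md (L (i + j)) (m + n) v"
proof -
  have *: "K_bracket p (Gp i) (Gm j) = [: Poly_Mapping.single (J (i + j)) [:0, 2 * of_nat i + p:]
      + Poly_Mapping.single (L (i + j)) [:2:], Poly_Mapping.single (J (i + j)) [:2 * (of_nat i + of_nat j + p):] :]"
    by (simp add: K_bracket_def term_of_basis_def map_poly_pCons add_ac)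
  have e: "(2 * (of_nat i + of_nat j + p)) * of_nat m - (2 * of_nat i + p) * of_nat (m + n) = (2 * of_nat j + p) * of_nat m - (2 * of_nat i + p) * of_nat n"
    by (simp add: algebra_simps)
  have "x = - y + a + b" if "x - - y = a + b" for x y a b :: 'm
    using that by (simp add: algebra_simps)
  moreover from md_bracket[OF *, of m n v, unfolded e]
  have "md (Gp i) m (md (Gm j) n v) - - md (Gm j) n (md (Gp i) m v) =
    ((2 * of_nat j + p) * of_nat m - (2 * of_nat i + p) * of_nat n) \<cdot> md (J (i + j)) (m + n - 1) v
    + 2 \<cdot> md (L (i + j)) (m + n) v"
    by (simp add: koszul_def del: of_nat_add)
  ultimately show ?thesis by blast
qed

section \<open>Linearity of the modes, and submodules given by kernels\<close>

lemma md_endo: "endo (cmul (smul M)) (md g n)"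
  by unfold_locales (simp_all add: md_add md_cm)

lemma md0_endo: "endo (smul M) (md g 0)"
proof
  show "md g 0 (smul M q v) = smul M q (md g 0 v)" for q v
    by (induction q) (simp_all add: smul_pCons md_add md_cm md_D)
qed (rule md_add)

lemma md_minus: "md g n (- v) = - md g n v"
  using md_add[of g n v "- v"] by (simp add: eq_neg_iff_add_eq_0 add.commute)

lemma md_diff: "md g n (u - v) = md g n u - md g n v"
  using md_add[of g n u "- v"] by (simp add: md_minus)

lemma md_cendo: "cendo (cmul (smul M)) (md g n)"
  using md_endo by (simp add: cendo_def)

text \<open>In the first argument \<partial> acts as \<open>-\<lambda>\<close>, so the action of
  every algebra element is expressed through the modes of the generators.\<close>

lemma act_closed:
  assumes "S.subspace N" "\<And>g n. md g n v \<in> N"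
  shows "coeff (act M a v) n \<in> N"
proof -
  have c: "c \<cdot> x \<in> N" if "x \<in> N" for c x
    using S.subspace_scale[OF assms(1) that] by (simp add: cmul_def)
  have gen: "coeff (act M (Poly_Mapping.single g q) v) n \<in> N" for g q n
  proof (induction q arbitrary: n)
    case (pCons c q)
    have "Poly_Mapping.single g (pCons c q) = Poly_Mapping.single g [:c:] + Poly_Mapping.single g (pCons 0 q)"
      by (simp flip: single_add)
    moreover have "coeff (act M (gen_elem g) v) n \<in> N"
      unfolding coeff_act by (rule c) (rule assms)
    moreover have "coeff (act M (Poly_Mapping.single g (pCons 0 q)) v) n \<in> N"
      using pCons.IH S.subspace_0[OF assms(1)] S.subspace_neg[OF assms(1)]
      unfolding act_single_deriv coeff_minus by (auto simp: coeff_pCons split: nat.split)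
    ultimately show ?case
      by (simp add: add_left act_single_const coeff_map_poly c S.subspace_add[OF assms(1)])
  qed (simp add: S.subspace_0[OF assms(1)])
  show ?thesis
    by (induction a rule: free_induct) (simp_all add: gen add_left S.subspace_add[OF assms(1)])
qed

definition homog :: "('m \<Rightarrow> 'm) \<Rightarrow> bool"
  where "homog x \<longleftrightarrow> (\<forall>u v. x (u + v) = x u + x v) \<and>
    (\<exists>d. \<forall>i v. v \<in> part M i \<longrightarrow> x v \<in> part M (d + i))"

lemma homog_md: "homog (md g n)"
  unfolding homog_def using md_add md_part by blast

lemma part_cm: "v \<in> part M i \<Longrightarrow> c \<cdot> v \<in> part M i"
  using S.subspace_scale[OF M.subspace_part] by (simp add: cmul_def)

lemma part_D: "v \<in> part M i \<Longrightarrow> D v \<in> part M i"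
  using S.subspace_scale[OF M.subspace_part] by (simp add: deriv_op_def)

lemma homog_shift:
  assumes "homog x" "\<And>i v. v \<in> part M i \<Longrightarrow> x v \<in> part M i"
  shows "homog (\<lambda>v. x v - c \<cdot> v)"
proof -
  have "x v - c \<cdot> v \<in> part M (0 + i)" if "v \<in> part M i" for i v
    using S.subspace_diff[OF M.subspace_part assms(2)[OF that] part_cm[OF that, of c]] by (simp only: add_0)
  moreover have "x (u + v) - c \<cdot> (u + v) = (x u - c \<cdot> u) + (x v - c \<cdot> v)" for u v
    using assms(1) by (simp add: homog_def V.scale_right_distrib)
  ultimately show ?thesis unfolding homog_def by blast
qed

lemma homog_kernel:
  assumes "homog x" "x (y + z) = 0" "y \<in> part M 0" "z \<in> part M 1"
  shows "x y = 0" "x z = 0"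
proof -
  from assms(1) obtain d where d: "\<And>i v. v \<in> part M i \<Longrightarrow> x v \<in> part M (d + i)"
    and a: "\<And>u v. x (u + v) = x u + x v"
    unfolding homog_def by blast
  have e: "x y = - x z" using assms(2) by (simp add: a eq_neg_iff_add_eq_0)
  have "x y \<in> part M (d + 0)" "x y \<in> part M (d + 1)"
    using d[OF assms(3)] d[OF assms(4)] S.subspace_neg[OF M.subspace_part] unfolding e by auto
  hence "x y \<in> part M 0 \<inter> part M 1" by (cases d) auto
  hence "x y = 0" using M.part_Int by blast
  thus "x y = 0" "x z = 0" using e by simp_all
qed

text \<open>Homogeneity makes the common kernel graded. Stability is required only on the common
  kernel, so commutators may mix the members of \<open>X\<close>.\<close>

lemma kernel_submodule:
  assumes hom: "\<And>x. x \<in> X \<Longrightarrow> homog x"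
    and D: "\<And>x v. \<lbrakk>x \<in> X; \<And>x. x \<in> X \<Longrightarrow> x v = 0\<rbrakk> \<Longrightarrow> x (D v) = 0"
    and cm: "\<And>x c v. \<lbrakk>x \<in> X; \<And>x. x \<in> X \<Longrightarrow> x v = 0\<rbrakk> \<Longrightarrow> x (c \<cdot> v) = 0"
    and md: "\<And>x g n v. \<lbrakk>x \<in> X; \<And>x. x \<in> X \<Longrightarrow> x v = 0\<rbrakk> \<Longrightarrow> x (md g n v) = 0"
  shows "conformal_submodule M {v. \<forall>x\<in>X. x v = 0}"
proof -
  let ?N = "{v. \<forall>x\<in>X. x v = 0}"
  have add: "x (u + v) = x u + x v" if "x \<in> X" for x u v using hom[OF that] by (simp add: homog_def)
  have 0: "x 0 = 0" if "x \<in> X" for x using add[OF that, of 0 0] by simp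
  have "smul M q v \<in> ?N" if "v \<in> ?N" for q v
    using that by (induction q) (auto simp: 0 smul_pCons add cm D)
  hence sub: "S.subspace ?N" by (auto simp: S.subspace_def 0 add)
  moreover have "\<exists>x0\<in>?N \<inter> part M 0. \<exists>x1\<in>?N \<inter> part M 1. v = x0 + x1" if "v \<in> ?N" for v
  proof -
    from M.part_sum obtain y z where v: "y \<in> part M 0" "z \<in> part M 1" "v = y + z" by blast
    have "x y = 0 \<and> x z = 0" if "x \<in> X" for x
      using homog_kernel[OF hom[OF that] _ v(1,2)] \<open>v \<in> ?N\<close> that v(3) by simp
    with v show ?thesis by (intro bexI[of _ y] bexI[of _ z]) auto
  qed
  moreover have "\<forall>a. \<forall>v\<in>?N. \<forall>n. coeff (act M a v) n \<in> ?N"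
  proof (intro allI ballI)
    fix a v n assume "v \<in> ?N"
    hence "md g n v \<in> ?N" for g n using md by blast
    thus "coeff (act M a v) n \<in> ?N" by (rule act_closed[OF sub])
  qed
  ultimately show ?thesis unfolding conformal_submodule_def by simp
qed

text \<open>By \<open>[x(n+1), \<partial>] = (n+1) x(n)\<close> on the eigenvector,
  \<open>x(n+1) v = 0\<close> implies \<open>x(n) v = 0\<close>; the descent starts at a large
  index, where the modes kill \<open>v\<close>.\<close>

lemma md_zero_of_deriv_eigenvector:
  assumes "D v = t \<cdot> v" shows "md g n v = 0"
proof -
  from md_eventually obtain N where N: "\<And>n. n \<ge> N \<Longrightarrow> md g n v = 0" by blast
  have step: "md g n v = 0" if "md g (Suc n) v = 0" for n
  proof -
    have "md g (Suc n) (D v) = 0" using that by (simp add: assms md_cm)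
    hence "of_nat (Suc n) \<cdot> md g n v = 0"
      using D_add[of 0 0] that unfolding md_D by simp
    thus ?thesis by (simp del: of_nat_Suc)
  qed
  have "md g (n + k) v = 0 \<longrightarrow> md g n v = 0" for k
    by (induction k) (use step in auto)
  with N[of "n + N"] show ?thesis by simp
qed

end

section \<open>Irreducible modules\<close>

locale K_irr = K_module p M
  for p :: complex and M :: "(gen free, 'm::ab_group_add) conf_mod" +
  assumes p_nz: "p \<noteq> 0"
    and nontriv: "nontrivial_module M"
    and fin: "finite_module M"
    and irr: "irreducible_module M"
begin

text \<open>A substitute for Schur's lemma: the common kernel is a submodule and contains the
  nonzero vector \<open>w\<close>.\<close>

lemma irr_kernel:
  assumes "\<And>x. x \<in> X \<Longrightarrow> homog x"
    and "\<And>x v. \<lbrakk>x \<in> X; \<And>x. x \<in> X \<Longrightarrow> x v = 0\<rbrakk> \<Longrightarrow> x (D v) = 0"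
    and "\<And>x c v. \<lbrakk>x \<in> X; \<And>x. x \<in> X \<Longrightarrow> x v = 0\<rbrakk> \<Longrightarrow> x (c \<cdot> v) = 0"
    and "\<And>x g n v. \<lbrakk>x \<in> X; \<And>x. x \<in> X \<Longrightarrow> x v = 0\<rbrakk> \<Longrightarrow> x (md g n v) = 0"
    and "w \<noteq> 0" "\<And>x. x \<in> X \<Longrightarrow> x w = 0" "x \<in> X"
  shows "x v = 0"
proof -
  have "conformal_submodule M {v. \<forall>x\<in>X. x v = 0}"
    by (rule kernel_submodule[where X = X], rule assms(1), assumption, rule assms(2), assumption, assumption,
        rule assms(3), assumption, assumption, rule assms(4), assumption, assumption)
  hence "{v. \<forall>x\<in>X. x v = 0} \<in> {{0}, UNIV}"
    using irr unfolding irreducible_module_def by blast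
  moreover have "w \<in> {v. \<forall>x\<in>X. x v = 0}" using assms by blast
  ultimately have "{v. \<forall>x\<in>X. x v = 0} = UNIV" using \<open>w \<noteq> 0\<close> by blast
  with \<open>x \<in> X\<close> show ?thesis by blast
qed

lemma md_nontrivial: "\<exists>g n v. md g n v \<noteq> 0"
proof (rule ccontr)
  assume "\<not> ?thesis"
  hence "coeff (act M a v) n \<in> {0}" for a v n
    by (intro act_closed) (auto simp: S.subspace_def)
  hence "act M a v = 0" for a v by (intro poly_eqI) simp
  with nontriv show False by (simp add: nontrivial_module_def)
qed

section \<open>Algebraic modes and the vanishing of generators of large index\<close>

lemma algebraic:
  assumes "endo (smul M) x" "endo (smul M) h"
    and "\<And>u v. y (u + v) = y u + y v" "\<And>c v. y (c \<cdot> v) = c \<cdot> y v" "\<And>v. y (D v) = D (y v) + h v"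
    and "\<And>v. y (x v) = x (y v)" "\<And>v. h (x v) = x (h v)" "\<And>v. y (h v) = h (y v)"
  obtains q e where "q \<noteq> 0" "\<And>v. app (cmul (smul M)) x q ((h ^^ e) v) = 0"
proof -
  from fin obtain G where "finite G" "S.span G = UNIV" unfolding finite_module_def by blast
  from algebraic_endomorphism[OF S.module_axioms this assms] that show thesis by blast
qed

text \<open>The commutator of \<open>y\<close> with \<partial> is a multiple of \<open>x\<close>
  here, so the factor \<open>h^e\<close> from \<open>algebraic\<close> is a polynomial in
  \<open>x\<close> and is absorbed into \<open>q\<close>.\<close>

lemma algebraic_self:
  assumes x: "endo (smul M) x" and k: "k \<noteq> 0"
    and "\<And>u v. y (u + v) = y u + y v" "\<And>c v. y (c \<cdot> v) = c \<cdot> y v" "\<And>v. y (D v) = D (y v) + k \<cdot> x v"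
    and "\<And>v. y (x v) = x (y v)"
  obtains q where "q \<noteq> 0" "\<And>v. app (cmul (smul M)) x q v = 0"
proof -
  interpret x: endo "smul M" x by fact
  interpret c: cendo "cmul (smul M)" x using endo_cmul[OF x] by (simp add: cendo_def)
  have h: "endo (smul M) (\<lambda>v. k \<cdot> x v)"
    by unfold_locales (simp_all add: x.x_add V.scale_right_distrib x.x_scale cmul_def S.scale_right_distrib mult.commute)
  obtain q e where q: "q \<noteq> 0" "\<And>v. app (cmul (smul M)) x q (((\<lambda>v. k \<cdot> x v) ^^ e) v) = 0"
    by (rule algebraic[OF x h assms(3-6)]) (auto simp: assms c.x_scale)
  have "((\<lambda>v. k \<cdot> x v) ^^ e) v = k ^ e \<cdot> (x ^^ e) v" for e v
    by (induction e) (simp_all add: c.x_scale mult.commute)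
  hence "app (cmul (smul M)) x (q * monom (k ^ e) e) v = 0" for v
    using q(2)[of v] by (simp only: c.app_mult c.app_monom)
  moreover have "q * monom (k ^ e) e \<noteq> 0" using q(1) k by (simp add: monom_eq_0_iff)
  ultimately show thesis using that by blast
qed

text \<open>The commutator of \<open>J\<^sub>j(1)\<close> with \<partial> is
  \<open>J\<^sub>j(0)\<close>, which is therefore algebraic; its weight \<open>j\<close> under
  \<open>L\<^sub>0(1)\<close> is nonzero.\<close>

lemma nilp_J0: assumes "j \<ge> 1" shows "nilp (md (J j) 0)"
proof -
  interpret cendo "cmul (smul M)" "md (J j) 0" by (rule md_cendo)
  obtain q where q: "q \<noteq> 0" "\<And>v. app (cmul (smul M)) (md (J j) 0) q v = 0"
    using algebraic_self[of "md (J j) 0" 1 "md (J j) 1"]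
    by (auto simp: md0_endo md_add md_cm md_D intro: J_J)
  show ?thesis
    by (rule nilp_of_weight[OF q, of "md (L 0) 1" "of_nat j"])
      (use assms in \<open>auto simp: md_add md_cm L_J\<close>)
qed

lemma G_eventually_zero: "\<exists>N. \<forall>j\<ge>N. \<forall>n v. md (Gp j) n v = 0 \<and> md (Gm j) n v = 0"
proof -
  have "\<exists>N. \<forall>j\<ge>N. \<forall>v. md (Gp j) 0 v = 0"
    by (rule nilp_ad[OF nilp_J0[of 1]]) (simp_all add: md_diff J_Gp)
  then obtain N where N: "\<And>j v. j \<ge> N \<Longrightarrow> md (Gp j) 0 v = 0" by blast
  have "\<exists>N. \<forall>j\<ge>N. \<forall>v. md (Gm j) 0 v = 0"
    by (rule nilp_ad[OF nilp_J0[of 1]]) (simp_all add: md_diff J_Gm)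
  then obtain N' where N': "\<And>j v. j \<ge> N' \<Longrightarrow> md (Gm j) 0 v = 0" by blast
  \<comment> \<open>The other modes are recovered from
    \<open>[J\<^sub>0(n), G\<^sub>j(0)] = G\<^sub>j(n)\<close>, up to sign.\<close>
  have "md (Gp j) n v = 0" if "j \<ge> N" for j n v
    using J_Gp[of 0 n j 0 v] N[OF that] by simp
  moreover have "md (Gm j) n v = 0" if "j \<ge> N'" for j n v
    using J_Gm[of 0 n j 0 v] N'[OF that] by simp
  ultimately show ?thesis by (intro exI[of _ "max N N'"]) auto
qed

text \<open>The brackets of \<open>G\<^sub>0\<^sup>+\<close> with \<open>G\<^sub>K\<^sup>-\<close>
  and of \<open>G\<^sub>K\<^sup>+\<close> with \<open>G\<^sub>0\<^sup>-\<close> make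
  \<open>2 L\<^sub>K(n+1)\<close> equal to both \<open>p(n+1) J\<^sub>K(n)\<close> and its negative;
  as \<open>p \<noteq> 0\<close>, both vanish.\<close>

lemma J_L_zero_of_G_zero:
  assumes "\<And>n v. md (Gp K) n v = 0" "\<And>n v. md (Gm K) n v = 0"
  shows "md (J K) n v = 0" "md (L K) n v = 0"
proof -
  have 1: "((2 * of_nat K + p) * of_nat m - p * of_nat n) \<cdot> md (J K) (m + n - 1) v
      + 2 \<cdot> md (L K) (m + n) v = 0"
    and 2: "(p * of_nat m - (2 * of_nat K + p) * of_nat n) \<cdot> md (J K) (m + n - 1) v
      + 2 \<cdot> md (L K) (m + n) v = 0" for m n
    using Gp_Gm[of 0 m K n v] Gp_Gm[of K m 0 n v] by (simp_all add: assms)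
  have "2 \<cdot> md (L K) (Suc n) v = (p * of_nat (Suc n)) \<cdot> md (J K) n v"
    using 1[of 0 "Suc n"] by (simp add: neg_eq_iff_add_eq_0[symmetric] del: of_nat_Suc)
  moreover have "2 \<cdot> md (L K) (Suc n) v = - ((p * of_nat (Suc n)) \<cdot> md (J K) n v)" for n
    using 2[of "Suc n" 0] by (simp add: eq_neg_iff_add_eq_0 add.commute del: of_nat_Suc)
  ultimately have *: "2 \<cdot> md (L K) (Suc n) v = (p * of_nat (Suc n)) \<cdot> md (J K) n v"
    "2 \<cdot> md (L K) (Suc n) v = - ((p * of_nat (Suc n)) \<cdot> md (J K) n v)" for n
    using 1[of 0 "Suc n"] by (simp_all add: neg_eq_iff_add_eq_0[symmetric] del: of_nat_Suc)
  have "(2 * (p * of_nat (Suc n))) \<cdot> md (J K) n v = 0" for n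
    using *[of n] by (metis V.scale_left_distrib add.right_inverse mult_2)
  thus J: "md (J K) n v = 0" for n using p_nz by (simp del: of_nat_Suc)
  have "md (L K) (Suc n) v = 0" for n using *(1)[of n] J[of n] by simp
  moreover have "md (L K) 0 v = 0" using 1[of 0 0] by simp
  ultimately show "md (L K) n v = 0" by (cases n) auto
qed

definition vanish :: "nat \<Rightarrow> bool"
  where "vanish K \<longleftrightarrow> (\<forall>n v. md (L K) n v = 0 \<and> md (J K) n v = 0 \<and> md (Gp K) n v = 0 \<and> md (Gm K) n v = 0)"

lemma vanish_eventually: "\<exists>N. \<forall>j\<ge>N. vanish j"
  using G_eventually_zero J_L_zero_of_G_zero unfolding vanish_def by meson

lemma not_all_vanish: "\<exists>K. \<not> vanish K"
proof (rule ccontr)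
  assume "\<not> ?thesis"
  hence "md g n v = 0" for g n v by (cases g) (auto simp: vanish_def)
  with md_nontrivial show False by blast
qed

text \<open>Every \<open>G\<^sub>i(n)\<close> is, up to sign, its own commutator with
  \<open>J\<^sub>0(0)\<close>. If the latter were nilpotent, \<open>nilp_ad\<close> for a constant
  sequence would kill all odd generators, hence everything.\<close>

lemma not_nilp_J0: "\<not> nilp (md (J 0) 0)"
proof
  assume nil: "nilp (md (J 0) 0)"
  have "\<exists>N::nat. \<forall>j\<ge>N. \<forall>v. md (Gp i) n v = 0" for i n
    by (rule nilp_ad[OF nil, where G = "\<lambda>_. md (Gp i) n"]) (simp_all add: md_diff J_Gp)
  moreover have "\<exists>N::nat. \<forall>j\<ge>N. \<forall>v. md (Gm i) n v = 0" for i n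
    by (rule nilp_ad[OF nil, where G = "\<lambda>_. md (Gm i) n"]) (simp_all add: md_diff J_Gm)
  ultimately have "md (Gp i) n v = 0" "md (Gm i) n v = 0" for i n v by blast+
  with J_L_zero_of_G_zero have "vanish i" for i unfolding vanish_def by blast
  with not_all_vanish show False by blast
qed

text \<open>
  The operator \<open>\<partial> - L\<^sub>0(0)/p\<close> commutes with the whole action. It has an eigenvalue since \<open>J\<^sub>0(0)\<close> is
  not nilpotent and \<open>[J\<^sub>0(1), \<partial>] = J\<^sub>0(0)\<close>.
\<close>

lemma L00_scalar: "\<exists>\<alpha>. \<forall>v. md (L 0) 0 v = p \<cdot> (D v + \<alpha> \<cdot> v)"
proof -
  define T where "T v = D v - inverse p \<cdot> md (L 0) 0 v" for v
  interpret l: endo "smul M" "md (L 0) 0" by (rule md0_endo)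
  have T: "endo (smul M) T"
    by unfold_locales
      (simp_all add: T_def D_add V.scale_right_distrib md_add D_smul l.x_scale S.scale_right_diff_distrib S.scale_right_distrib cmul_def mult.commute)
  interpret T: cendo "cmul (smul M)" T using endo_cmul[OF T] by (simp add: cendo_def)
  have Tmd: "T (md g n v) = md g n (T v)" for g n v
  proof -
    have "md (L 0) 0 (md g n v) = md g n (md (L 0) 0 v) - (p * of_nat n) \<cdot> md g (n - 1) v"
      using L_L[of 0 0 _ n v] by (cases g) (simp_all add: L_J L_Gp L_Gm)
    thus ?thesis using p_nz
      by (simp add: T_def md_diff md_cm md_D V.scale_right_diff_distrib)
  qed
  obtain q e where q: "q \<noteq> 0" "\<And>v. app (cmul (smul M)) T q ((md (J 0) 0 ^^ e) v) = 0"
    using algebraic[OF T md0_endo[of "J 0"], of "md (J 0) 1"]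
    by (auto simp: md_add md_cm md_D Tmd intro: J_J)
  from not_nilp_J0 obtain v where "(md (J 0) 0 ^^ e) v \<noteq> 0" unfolding nilp_def by blast
  from T.obtain_eigenvector[OF q this] obtain w t where w: "w \<noteq> 0" "T w = t \<cdot> w" by metis
  have Tp: "T v \<in> part M i" if "v \<in> part M i" for i v
    using md_part[OF that, of "L 0" 0] that unfolding T_def gen_parity.simps add_0
    by (intro S.subspace_diff[OF M.subspace_part] part_D part_cm)
  have homog_T: "homog T" unfolding homog_def using Tp T.x_add by (metis add_0)
  have TD: "T (D v) = D (T v)" for v using T unfolding endo_def endo_axioms_def deriv_op_def by blast
  have "T v - t \<cdot> v = 0" for v
    by (rule irr_kernel[of "{\<lambda>v. T v - t \<cdot> v}" w "\<lambda>v. T v - t \<cdot> v" v])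
      (use w in \<open>auto simp: homog_shift[OF homog_T Tp] Tmd TD T.x_scale mult.commute md_cm[symmetric] D_cm[symmetric]\<close>)
  hence "inverse p \<cdot> md (L 0) 0 v = D v + (- t) \<cdot> v" for v
    by (simp add: T_def algebra_simps)
  hence "p \<cdot> (inverse p \<cdot> md (L 0) 0 v) = p \<cdot> (D v + (- t) \<cdot> v)" for v by simp
  thus ?thesis using p_nz by (intro exI[of _ "- t"]) simp
qed

section \<open>The scalar \<alpha> and the absence of torsion\<close>

definition \<alpha> :: complex
  where "\<alpha> = (SOME \<alpha>. \<forall>v. md (L 0) 0 v = p \<cdot> (D v + \<alpha> \<cdot> v))"

lemma L00: "md (L 0) 0 v = p \<cdot> (D v + \<alpha> \<cdot> v)"
  using someI_ex[OF L00_scalar] unfolding \<alpha>_def by blast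

text \<open>The kernel of \<open>L\<^sub>0(0)\<close> is the eigenspace of \<partial> for
  \<open>-\<alpha>\<close>, on which all modes vanish. If nonzero, it would be a submodule, hence
  everything, and the action would be trivial.\<close>

lemma L00_inj:
  assumes "md (L 0) 0 v = 0" shows "v = 0"
proof (rule ccontr)
  assume "v \<noteq> 0"
  have *: "md g n w = 0" if "md (L 0) 0 w = 0" for g n w
  proof (rule md_zero_of_deriv_eigenvector[of _ "- \<alpha>"])
    show "D w = - \<alpha> \<cdot> w" using that p_nz by (simp add: L00 eq_neg_iff_add_eq_0)
  qed
  have "md (L 0) 0 w = 0" for w
    by (rule irr_kernel[of "{md (L 0) 0}" v]) (use \<open>v \<noteq> 0\<close> assms * in \<open>auto simp: homog_md md_D md_cm D_add[of 0 0, simplified]\<close>)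
  with * md_nontrivial show False by blast
qed

text \<open>Each factor \<open>\<partial> - t\<close> of \<open>q\<close> is injective: an
  eigenvector of \<partial> would be killed by all modes, among them the injective
  \<open>L\<^sub>0(0)\<close>.\<close>

lemma torsion_free:
  assumes "smul M q v = 0" "q \<noteq> 0" shows "v = 0"
  using assms
proof (induction "degree q" arbitrary: q)
  case 0
  then obtain c where c: "q = [:c:]" "c \<noteq> 0" by (metis degree_eq_zeroE pCons_0_0)
  with 0 have "c \<cdot> v = 0" by (simp add: cmul_def)
  with c show ?case by simp
next
  case (Suc n)
  then obtain t where t: "poly q t = 0"
    by (metis constant_degree fundamental_theorem_of_algebra nat.distinct(1))
  then obtain q' where q': "q = [:- t, 1:] * q'" by (metis dvd_def poly_eq_0_iff_dvd)
  with Suc.prems(2) have "q' \<noteq> 0" by auto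
  with Suc.hyps(2) have "n = degree q'"
    using degree_mult_eq[of "[:- t, 1:]" q'] unfolding q' by simp
  have lin: "smul M [:- t, 1:] w = D w - t \<cdot> w" for w
  proof -
    have "smul M [:- t, 1:] w = (- t) \<cdot> w + D (smul M 1 w)" unfolding smul_pCons one_pCons ..
    thus ?thesis by simp
  qed
  have "D (smul M q' v) = t \<cdot> smul M q' v"
    using Suc.prems(1) lin[of "smul M q' v"] unfolding q' S.scale_scale[symmetric] by simp
  hence "smul M q' v = 0" by (rule L00_inj[OF md_zero_of_deriv_eigenvector])
  with Suc.hyps(1)[OF \<open>n = degree q'\<close>] \<open>q' \<noteq> 0\<close> show ?case by blast
qed

end

section \<open>Commutators in the opposite order\<close>

context K_module
begin

lemma J_L: "md (J i) m (md (L j) n v) = md (L j) n (md (J i) m v)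
    - (of_nat i * of_nat n - (of_nat j + p) * of_nat m) \<cdot> md (J (i + j)) (m + n - 1) v"
  using L_J[of j n i m v] by (simp add: add.commute)

lemma Gp_L: "md (Gp i) m (md (L j) n v) = md (L j) n (md (Gp i) m v)
    - ((of_nat i + p / 2) * of_nat n - (of_nat j + p) * of_nat m) \<cdot> md (Gp (i + j)) (m + n - 1) v"
  using L_Gp[of j n i m v] by (simp add: add.commute)

lemma Gm_L: "md (Gm i) m (md (L j) n v) = md (L j) n (md (Gm i) m v)
    - ((of_nat i + p / 2) * of_nat n - (of_nat j + p) * of_nat m) \<cdot> md (Gm (i + j)) (m + n - 1) v"
  using L_Gm[of j n i m v] by (simp add: add.commute)

lemma Gp_J: "md (Gp i) m (md (J j) n v) = md (J j) n (md (Gp i) m v) - md (Gp (i + j)) (m + n) v"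
  using J_Gp[of j n i m v] by (simp add: add.commute)

lemma Gm_J: "md (Gm i) m (md (J j) n v) = md (J j) n (md (Gm i) m v) + md (Gm (i + j)) (m + n) v"
  using J_Gm[of j n i m v] by (simp add: add.commute)

lemma Gm_Gp: "md (Gm i) m (md (Gp j) n v) = - md (Gp j) n (md (Gm i) m v)
    + ((2 * of_nat i + p) * of_nat n - (2 * of_nat j + p) * of_nat m) \<cdot> md (J (i + j)) (m + n - 1) v
    + 2 \<cdot> md (L (i + j)) (m + n) v"
  using Gp_Gm[of j n i m v] by (simp add: add.commute eq_neg_iff_add_eq_0 neg_eq_iff_add_eq_0 add_ac)

lemma md_nilp_square:
  shows "md (Gp i) n (md (Gp i) n v) = 0" and "md (Gm i) n (md (Gm i) n v) = 0"
proof -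
  have *: "x = 0" if "x = - x" for x :: 'm
  proof -
    have "2 \<cdot> x = x + x" using V.scale_left_distrib[of 1 1 x] by simp
    with that have "2 \<cdot> x = 0" by (simp add: eq_neg_iff_add_eq_0)
    thus ?thesis by simp
  qed
  show "md (Gp i) n (md (Gp i) n v) = 0" "md (Gm i) n (md (Gm i) n v) = 0"
    using Gp_Gp[of i n i n v] Gm_Gm[of i n i n v] by (auto intro: *)
qed

lemma nilp_G: "nilp (md (Gp i) n)" "nilp (md (Gm i) n)"
  unfolding nilp_def by (rule exI[of _ 2], simp add: numeral_2_eq_2 md_nilp_square)+

definition kills :: "nat \<Rightarrow> 'm \<Rightarrow> bool"
  where "kills K v \<longleftrightarrow> (\<forall>n. md (L K) n v = 0 \<and> md (J K) n v = 0 \<and> md (Gp K) n v = 0 \<and> md (Gm K) n v = 0)"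

text \<open>The index of a bracket is the sum of the indices, so moving a mode of index
  \<open>K\<close> past \<open>md g n\<close> leaves only modes of index at least \<open>K\<close>,
  which kill \<open>w\<close>.\<close>

lemma kills_md:
  assumes "\<And>j. j \<ge> K \<Longrightarrow> kills j w"
  shows "kills K (md g n w)"
proof -
  have k: "md (L (K + i)) n w = 0" "md (J (K + i)) n w = 0" "md (Gp (K + i)) n w = 0" "md (Gm (K + i)) n w = 0"
    for i n using assms[of "K + i"] by (simp_all add: kills_def)
  note k0 = k[of 0, simplified]
  show ?thesis
  proof (cases g)
    case (L i)
    show ?thesis using L_L[of K _ i n w]
      by (simp add: kills_def L J_L Gp_L Gm_L k k0)
  next
    case (J i)
    show ?thesis using J_J[of K _ i n w]
      by (simp add: kills_def J L_J Gp_J Gm_J k k0)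
  next
    case (Gp i)
    show ?thesis using Gp_Gp[of K _ i n w]
      by (simp add: kills_def Gp L_Gp J_Gp Gm_Gp k k0)
  next
    case (Gm i)
    show ?thesis using Gm_Gm[of K _ i n w]
      by (simp add: kills_def Gm L_Gm J_Gm Gp_Gm k k0)
  qed
qed

definition gens :: "nat \<Rightarrow> gen set"
  where "gens K = {L K, J K, Gp K, Gm K}"

lemma finite_nonzero_md:
  assumes "finite A" shows "finite {x \<in> {md g n | g n. g \<in> A}. x v \<noteq> 0}"
proof -
  from md_eventually have "\<forall>g. \<exists>N. \<forall>n\<ge>N. md g n v = 0" by blast
  then obtain N where N: "\<And>g n. n \<ge> N g \<Longrightarrow> md g n v = 0" by metis
  have "{x \<in> {md g n | g n. g \<in> A}. x v \<noteq> 0} \<subseteq> (\<lambda>(g, n). md g n) ` (SIGMA g:A. {..<N g})"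
    using N by (force simp: not_le[symmetric])
  thus ?thesis by (rule finite_subset) (use assms in auto)
qed

end

section \<open>Generators of the largest surviving index\<close>

context K_irr
begin

lemma vanish_iff_kills: "vanish K \<longleftrightarrow> (\<forall>v. kills K v)"
  unfolding vanish_def kills_def by blast

lemma vanishD: "vanish K \<Longrightarrow> md (L K) n v = 0" "vanish K \<Longrightarrow> md (J K) n v = 0"
  "vanish K \<Longrightarrow> md (Gp K) n v = 0" "vanish K \<Longrightarrow> md (Gm K) n v = 0"
  unfolding vanish_def by blast+

lemma gens_commute:
  assumes "vanish (K + K)" "g \<in> gens K" "h \<in> gens K" "md h n v = 0"
  shows "md h n (md g m v) = 0"
  using assms(2-4) L_L[of K n K m v]
  by (auto simp: gens_def L_J L_Gp L_Gm J_L Gp_L Gm_L J_Gp J_Gm Gp_J Gm_J Gp_Gm Gm_Gp vanishD[OF assms(1)]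
      Gp_Gp[of K n K m v] Gm_Gm[of K n K m v] J_J[of K n K m v])

text \<open>The commutator with \<open>L\<^sub>0(n+1)\<close> takes \<open>J\<^sub>j(0)\<close> to a
  nonzero multiple of \<open>J\<^sub>j(n)\<close>, and this to a multiple of
  \<open>J\<^sub>j(2n)\<close>, so \<open>nilp_derivation\<close> passes nilpotency from mode 0 to
  mode \<open>n\<close>.\<close>

lemma nilp_J: assumes "j \<ge> 1" shows "nilp (md (J j) n)"
proof -
  interpret endo "cmul (smul M)" "md (J j) 0" by (rule md_endo)
  show ?thesis
    by (rule nilp_derivation[OF nilp_J0[OF assms], where E = "md (L 0) (Suc n)"
          and k = "of_nat j * of_nat (Suc n)" and z = "md (J j) (n + n)" and l = "of_nat j * of_nat (Suc n) - p * of_nat n"])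
      (use assms in \<open>auto simp: md_add md_cm L_J md_endo J_J[of j _ j] simp del: of_nat_Suc\<close>)
qed

lemma vanish_of_nilp:
  assumes K: "K \<ge> 1" and top: "\<And>j. j > K \<Longrightarrow> vanish j" and nil: "\<And>n. nilp (md (L K) n)"
  shows "vanish K"
proof -
  define X where "X = {md g n | g n. g \<in> gens K}"
  have K2: "vanish (K + K)" using K by (intro top) simp
  from md_nontrivial obtain v :: 'm where v: "v \<noteq> 0" by blast
  obtain w where w: "w \<noteq> 0" "\<And>x. x \<in> X \<Longrightarrow> x w = 0"
  proof (rule common_kernel[of X v])
    show "y (x v) = 0" if "x \<in> X" "y \<in> X" "y v = 0" for x y v
      using that gens_commute[OF K2] unfolding X_def by blast
    show "nilp x" if "x \<in> X" for x
      using that nil nilp_J[OF K] nilp_G unfolding X_def gens_def by blast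
    show "finite {x\<in>X. x v \<noteq> 0}"
      unfolding X_def by (rule finite_nonzero_md) (simp add: gens_def)
  qed (use v in auto)
  have kX: "kills K v" if "\<And>x. x \<in> X \<Longrightarrow> x v = 0" for v
    using that unfolding kills_def X_def gens_def by blast
  have Xk: "x v = 0" if "kills K v" "x \<in> X" for v x
    using that unfolding kills_def X_def gens_def by blast
  have D0: "D 0 = 0" using D_add[of 0 0] by simp
  have "x v = 0" if "x \<in> X" for x v
  proof (rule irr_kernel[of X w x v])
    show "homog x" if "x \<in> X" for x using that homog_md unfolding X_def by blast
    show "x (D v) = 0" if "x \<in> X" "\<And>x. x \<in> X \<Longrightarrow> x v = 0" for x v
    proof (rule Xk[OF _ that(1)])
      have "kills K v" by (rule kX) (rule that(2))
      thus "kills K (D v)" by (simp add: kills_def md_D D0)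
    qed
    show "x (c \<cdot> v) = 0" if "x \<in> X" "\<And>x. x \<in> X \<Longrightarrow> x v = 0" for x c v
    proof (rule Xk[OF _ that(1)])
      have "kills K v" by (rule kX) (rule that(2))
      thus "kills K (c \<cdot> v)" by (simp add: kills_def md_cm)
    qed
    show "x (md g n v) = 0" if "x \<in> X" "\<And>x. x \<in> X \<Longrightarrow> x v = 0" for x g n v
    proof (rule Xk[OF _ that(1)])
      have "kills K v" by (rule kX) (rule that(2))
      thus "kills K (md g n v)"
        by (intro kills_md) (metis le_neq_implies_less top vanish_iff_kills)
    qed
  qed (use w that in auto)
  thus ?thesis using kX vanish_iff_kills by blast
qed

lemma algebraic_L:
  assumes "vanish (K + K)"
  obtains q where "q \<noteq> 0" "\<And>v. app (cmul (smul M)) (md (L K) 0) q v = 0"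
  using algebraic_self[of "md (L K) 0" 1 "md (L K) 1"] L_L[of K 1 K 0]
  by (auto simp: md0_endo md_add md_cm md_D vanishD[OF assms])

text \<open>The weight \<open>K + p\<close> of \<open>L\<^sub>K(0)\<close> under
  \<open>L\<^sub>0(1)\<close> is nonzero, so \<open>L\<^sub>K(0)\<close> is nilpotent; commutators
  with \<open>L\<^sub>0(n+1)\<close> carry this over to \<open>L\<^sub>K(n)\<close>.\<close>

lemma vanish_generic:
  assumes K: "K \<ge> 1" and top: "\<And>j. j > K \<Longrightarrow> vanish j" and p: "of_nat K + p \<noteq> 0"
  shows "vanish K"
proof (rule vanish_of_nilp[OF K top])
  have K2: "vanish (K + K)" using K by (intro top) simp
  have comm: "md (L K) i (md (L K) j v) = md (L K) j (md (L K) i v)" for i j v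
    using L_L[of K i K j v] by (simp add: vanishD[OF K2])
  interpret cendo "cmul (smul M)" "md (L K) 0" by (rule md_cendo)
  obtain q where q: "q \<noteq> 0" "\<And>v. app (cmul (smul M)) (md (L K) 0) q v = 0" using algebraic_L[OF K2] by metis
  have nil: "nilp (md (L K) 0)"
    by (rule nilp_of_weight[OF q, of "md (L 0) 1" "of_nat K + p"])
      (use p L_L[of 0 1 K 0] in \<open>auto simp: md_add md_cm\<close>)
  show "nilp (md (L K) n)" for n
  proof (rule nilp_derivation[OF nil, where E = "md (L 0) (Suc n)"
          and k = "(of_nat K + p) * of_nat (Suc n)" and z = "md (L K) (n + n)"
          and l = "(of_nat K + p) * of_nat (Suc n) - p * of_nat n"])
  qed (use p L_L[of 0 "Suc n" K] comm in \<open>auto simp: md_add md_cm md_endo simp del: of_nat_Suc\<close>)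
qed

text \<open>
  For \<open>p = -K\<close> the operator \<open>L\<^sub>K(0)\<close> is central and its weight is zero, so that it need not be nilpotent.
  If it vanishes, then \<open>L\<^sub>K(1)\<close> commutes with \<open>\<partial>\<close> and takes its place. Otherwise, for \<open>K \<ge> 2\<close>, the operators
  \<open>L\<^sub>1(1)\<close> and \<open>L\<^bsub>K-1\<^esub>(0)\<close> would form a Heisenberg pair although the second one is algebraic.
\<close>

lemma vanish_special:
  assumes K: "K \<ge> 1" and top: "\<And>j. j > K \<Longrightarrow> vanish j" and p: "of_nat K + p = 0"
    and c: "\<And>v. md (L K) 0 v = 0"
  shows "vanish K"
proof (rule vanish_of_nilp[OF K top])
  have K2: "vanish (K + K)" using K by (intro top) simp
  have comm: "md (L K) i (md (L K) j v) = md (L K) j (md (L K) i v)" for i j v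
    using L_L[of K i K j v] by (simp add: vanishD[OF K2])
  interpret cendo "cmul (smul M)" "md (L K) 1" by (rule md_cendo)
  have e: "endo (smul M) (md (L K) 1)"
  proof
    show "md (L K) 1 (smul M q v) = smul M q (md (L K) 1 v)" for q v
      by (induction q) (simp_all add: smul_pCons md_add md_cm md_D c)
  qed (rule md_add)
  \<comment> \<open>The factor 2 comes from
    \<open>[L\<^sub>K(2), \<partial>] = 2 L\<^sub>K(1)\<close>.\<close>
  obtain q where q: "q \<noteq> 0" "\<And>v. app (cmul (smul M)) (md (L K) 1) q v = 0"
    using algebraic_self[OF e, of 2 "md (L K) 2"] comm[of 2 1] by (auto simp: md_add md_cm md_D)
  have nil: "nilp (md (L K) 1)"
    by (rule nilp_of_weight[OF q, of "md (L 0) 1" "- p"])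
      (use p p_nz L_L[of 0 1 K 1] in \<open>auto simp: md_add md_cm\<close>)
  show "nilp (md (L K) n)" for n
  \<comment> \<open>Since \<open>K + p = 0\<close>, the commutator of \<open>L\<^sub>0(n)\<close>
    with \<open>L\<^sub>K(1)\<close> is \<open>-p L\<^sub>K(n)\<close>, with a factor that is
    nonzero for all \<open>n\<close>.\<close>
  proof (rule nilp_derivation[OF nil, where E = "md (L 0) n"
          and k = "- p" and z = "md (L K) (n + n - 1)" and l = "- p * of_nat n"])
    show "(of_nat (Suc i) * - p) \<cdot> v = 0 \<Longrightarrow> v = 0" for i v using p_nz by (simp del: of_nat_Suc)
  qed (use p L_L[of 0 n K] comm in \<open>auto simp: md_add md_cm md_endo\<close>)
qed

text \<open>For \<open>p = -K\<close> all structure constants of commutators with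
  \<open>L\<^sub>K(0)\<close> vanish, so it commutes with the whole action. Being algebraic, it has
  an eigenvalue, and irreducibility makes it that scalar.\<close>

lemma L_scalar:
  assumes K: "K \<ge> 1" and top: "\<And>j. j > K \<Longrightarrow> vanish j" and p: "of_nat K + p = 0"
  obtains c where "\<And>v. md (L K) 0 v = c \<cdot> v"
proof -
  have K2: "vanish (K + K)" using K by (intro top) simp
  interpret cendo "cmul (smul M)" "md (L K) 0" by (rule md_cendo)
  obtain q where q: "q \<noteq> 0" "\<And>v. app (cmul (smul M)) (md (L K) 0) q v = 0" using algebraic_L[OF K2] by metis
  from md_nontrivial obtain v :: 'm where "v \<noteq> 0" by blast
  from obtain_eigenvector[OF q this] obtain w t where w: "w \<noteq> 0" "md (L K) 0 w = t \<cdot> w" by metis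
  have comm: "md (L K) 0 (md g n v) = md g n (md (L K) 0 v)" for g n v
    using L_L[of K 0 _ n v] by (cases g) (simp_all add: p L_J L_Gp L_Gm)
  have hs: "homog (\<lambda>v. md (L K) 0 v - t \<cdot> v)"
    by (rule homog_shift[OF homog_md], drule md_part[of _ _ "L K" 0], simp only: gen_parity.simps add_0)
  have "md (L K) 0 v - t \<cdot> v = 0" for v
    by (rule irr_kernel[of "{\<lambda>v. md (L K) 0 v - t \<cdot> v}" w "\<lambda>v. md (L K) 0 v - t \<cdot> v" v])
      (use w hs in \<open>auto simp: comm md_D md_cm D_cm mult.commute\<close>)
  with that[of t] show thesis by simp
qed

lemma no_heisenberg:
  assumes K: "K \<ge> 2" and top: "\<And>j. j > K \<Longrightarrow> vanish j" and p: "of_nat K + p = 0"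
    and c: "\<And>v. md (L K) 0 v = c \<cdot> v"
  shows "c = 0"
proof (rule ccontr)
  assume "c \<noteq> 0"
  let ?x = "md (L (K - 1)) 0"
  interpret cendo "cmul (smul M)" ?x by (rule md_cendo)
  have top': "vanish (K + (K - 1))" using K by (intro top) simp
  have comm: "md (L K) 1 (?x v) = ?x (md (L K) 1 v)" for v
    using L_L[of K 1 "K - 1" 0 v] by (simp only: vanishD[OF top'] V.scale_zero_right add_0_right)
  have h: "endo (smul M) (\<lambda>v. c \<cdot> v)"
    by unfold_locales (simp_all add: S.scale_right_distrib cmul_def mult.commute)
  \<comment> \<open>\<open>L\<^sub>K(1)\<close> commutes with \<open>?x\<close> because the index
    \<open>2 K - 1\<close> exceeds \<open>K\<close>; its commutator with \<partial> is the nonzero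
    scalar \<open>c\<close>, which can be cancelled.\<close>
  obtain q e where q: "q \<noteq> 0" "\<And>v. app (cmul (smul M)) ?x q (((\<lambda>v. c \<cdot> v) ^^ e) v) = 0"
    using algebraic[OF md0_endo[of "L (K - 1)"] h, of "md (L K) 1"] comm
    by (auto simp: md_add md_cm md_D c)
  have pow: "((\<lambda>v. c \<cdot> v) ^^ e) v = c ^ e \<cdot> v" for e v by (induction e) simp_all
  have q': "app (cmul (smul M)) ?x q v = 0" for v
    using q(2)[of v] \<open>c \<noteq> 0\<close> unfolding pow app_scale_right by simp
  from K have K': "of_nat (K - 1) = (of_nat K - 1 :: complex)" "Suc (K - 1) = K" by (simp_all add: of_nat_diff)
  have "v = 0" for v :: 'm
  \<comment> \<open>The commutator of \<open>L\<^sub>1(1)\<close> with \<open>?x\<close> is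
    \<open>K - 1 + p = -1\<close> times \<open>L\<^sub>K(0)\<close>, that is,
    \<open>-c\<close>.\<close>
  proof (rule algebraic_not_conjugate[OF q(1) q', of "md (L 1) 1" "- c"])
    have e: "of_nat K - 1 + p = - 1" using p by (simp add: algebra_simps)
    thus "md (L 1) 1 (?x v) = ?x (md (L 1) 1 v) + - c \<cdot> v" for v
      using L_L[of 1 1 "K - 1" 0 v] K' e by (simp add: c)
  qed (use \<open>c \<noteq> 0\<close> in \<open>simp_all add: md_add md_cm\<close>)
  with md_nontrivial show False by blast
qed

lemma vanish_ge_2: "j \<ge> 2 \<Longrightarrow> vanish j"
proof -
  have step: "vanish K" if K: "K \<ge> 2" and top: "\<And>j. j > K \<Longrightarrow> vanish j" for K
  proof (cases "of_nat K + p = 0")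
    case True
    have "K \<ge> 1" using K by simp
    from L_scalar[OF this top True] obtain c where c: "\<And>v. md (L K) 0 v = c \<cdot> v" by metis
    with no_heisenberg[OF K top True c] vanish_special[OF \<open>K \<ge> 1\<close> top True] show ?thesis by simp
  qed (use vanish_generic[of K] K top in auto)
  from vanish_eventually obtain N where N: "\<And>j. j \<ge> N \<Longrightarrow> vanish j" by blast
  have "\<forall>j\<ge>2. j + k \<ge> N \<longrightarrow> vanish j" for k
  proof (induction k)
    case (Suc k)
    show ?case
    proof (intro allI impI)
      fix j assume "2 \<le> j" "N \<le> j + Suc k"
      show "vanish j" by (rule step) (use Suc.IH \<open>2 \<le> j\<close> \<open>N \<le> j + Suc k\<close> in simp_all)
    qed
  qed (use N in simp)
  from this[of N] show "vanish j" if "j \<ge> 2" using that by simp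
qed

lemma L1_scalar: "\<exists>c. (\<forall>v. md (L 1) 0 v = c \<cdot> v) \<and> (c = 0 \<longrightarrow> vanish 1) \<and> (c \<noteq> 0 \<longrightarrow> p = - 1)"
proof (cases "p = - 1")
  case True
  obtain c where "\<And>v. md (L 1) 0 v = c \<cdot> v" using L_scalar[of 1] vanish_ge_2 True by auto
  with True vanish_special[of 1] vanish_ge_2 show ?thesis by auto
next
  case False
  have "vanish 1"
    by (rule vanish_generic) (use False vanish_ge_2 in \<open>auto simp: eq_neg_iff_add_eq_0 add.commute\<close>)
  thus ?thesis by (intro exI[of _ 0]) (simp add: vanishD)
qed

end

section \<open>Highest weight vectors\<close>

lemma (in cendo) app_eigenvector: "x v = sc t v \<Longrightarrow> app sc x q v = sc (poly q t) v"
  by (induction q) (simp_all add: x_scale scale_left_distrib mult.commute)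

context K_irr
begin

section \<open>Finite dimension of the spaces killed by almost all
  \<open>L\<^sub>0(n)\<close>\<close>

lemma md_sum: "md g n (\<Sum>i\<in>A. f i) = (\<Sum>i\<in>A. md g n (f i))"
  by (induction A rule: infinite_finite_induct) (simp_all add: md_add)

text \<open>Moving \<open>L\<^sub>0(N+d)\<close> past a power of \<partial> lowers its index by at
  most the exponent. Only \<open>\<partial>^d\<close> reaches \<open>L\<^sub>0(N)\<close>; lower
  powers leave modes that kill \<open>u\<close>.\<close>

lemma L0_smul:
  assumes "\<And>n. n \<ge> Suc N \<Longrightarrow> md (L 0) n u = 0" "degree q \<le> d"
  shows "md (L 0) (N + d) (smul M q u) = (coeff q d * (fact (N + d) / fact N)) \<cdot> md (L 0) N u"
  using assms(2)
proof (induction q arbitrary: d)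
  case (pCons a q)
  have D0: "D 0 = 0" using D_add[of 0 0] by simp
  show ?case
  proof (cases d)
    case 0
    with pCons.prems have "q = 0" by (cases "q = 0") auto
    with 0 D0 show ?thesis by (simp add: smul_pCons md_add md_cm md_D)
  next
    case (Suc e)
    have q: "degree q \<le> e" using pCons.prems Suc by (cases "q = 0") auto
    hence "coeff q (Suc e) = 0" by (intro coeff_eq_0) simp
    with pCons.IH[of "Suc e"] q have 1: "md (L 0) (N + Suc e) (smul M q u) = 0" by simp
    have 2: "md (L 0) (N + e) (smul M q u) = (coeff q e * (fact (N + e) / fact N)) \<cdot> md (L 0) N u"
      by (rule pCons.IH[OF q])
    have "md (L 0) (N + Suc e) (smul M (pCons a q) u) = of_nat (Suc (N + e)) \<cdot> md (L 0) (N + e) (smul M q u)"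
      using 1 by (simp add: smul_pCons md_add md_cm md_D assms(1) D0 del: of_nat_Suc)
    also have "\<dots> = (coeff (pCons a q) d * (fact (N + d) / fact N)) \<cdot> md (L 0) N u"
      unfolding 2 Suc by (simp add: mult_ac del: of_nat_Suc)
    finally show ?thesis unfolding Suc .
  qed
qed simp

text \<open>Any \<open>card G + 1\<close> vectors satisfy a relation over \<complex>[\<partial>]. If
  \<open>d\<close> is its largest degree, \<open>L\<^sub>0(N+d)\<close> turns it into a complex
  relation between the \<open>L\<^sub>0(N) (u i)\<close>, with the coefficients of
  \<open>\<partial>^d\<close>. The iteration below needs \<open>k\<close> to be independent of
  \<open>N\<close>.\<close>

lemma L0_dependence_step:
  "\<exists>k>0. \<forall>N (u :: nat \<Rightarrow> 'm). (\<forall>i. \<forall>n\<ge>Suc N. md (L 0) n (u i) = 0) \<longrightarrow>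
    (\<exists>c. (\<exists>i<k. c i \<noteq> 0) \<and> md (L 0) N (\<Sum>i<k. c i \<cdot> u i) = 0)"
proof -
  from fin obtain G where G: "finite G" "S.span G = UNIV" unfolding finite_module_def by blast
  let ?k = "Suc (card G)"
  have "\<exists>c. (\<exists>i<?k. c i \<noteq> 0) \<and> md (L 0) N (\<Sum>i<?k. c i \<cdot> u i) = 0"
    if u: "\<forall>i. \<forall>n\<ge>Suc N. md (L 0) n (u i) = 0" for N and u :: "nat \<Rightarrow> 'm"
  proof -
    obtain q where q: "\<exists>i\<in>{..<?k}. q i \<noteq> 0" "(\<Sum>i<?k. smul M (q i) (u i)) = 0"
      using linear_dependence[OF S.module_axioms G(1), of "{..<?k}" u] G(2) by auto
    let ?I = "{i. i < ?k \<and> q i \<noteq> 0}"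
    define d where "d = Max ((\<lambda>i. degree (q i)) ` ?I)"
    have "d \<in> (\<lambda>i. degree (q i)) ` ?I" unfolding d_def using q(1) by (intro Max_in) auto
    then obtain i0 where i0: "i0 < ?k" "q i0 \<noteq> 0" "d = degree (q i0)" by blast
    have deg: "degree (q i) \<le> d" if "i < ?k" for i
      unfolding d_def using that by (cases "q i = 0") (auto intro!: Max_ge)
    have "0 = md (L 0) (N + d) (\<Sum>i<?k. smul M (q i) (u i))" by (simp only: q(2) md_0)
    also have "\<dots> = (\<Sum>i<?k. (coeff (q i) d * (fact (N + d) / fact N)) \<cdot> md (L 0) N (u i))"
      unfolding md_sum by (intro sum.cong refl L0_smul) (use u deg in auto)
    also have "\<dots> = (fact (N + d) / fact N) \<cdot> md (L 0) N (\<Sum>i<?k. coeff (q i) d \<cdot> u i)"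
      by (simp only: md_sum md_cm V.scale_sum_right V.scale_scale mult.commute)
    finally have "md (L 0) N (\<Sum>i<?k. coeff (q i) d \<cdot> u i) = 0" by simp
    thus ?thesis using i0 by (intro exI[of _ "\<lambda>i. coeff (q i) d"]) auto
  qed
  thus ?thesis by (intro exI[of _ ?k]) blast
qed

text \<open>Applied to blocks of \<open>k\<close> vectors, the previous lemma gives combinations
  killed by one more mode. After \<open>N\<close> rounds the injectivity of
  \<open>L\<^sub>0(0)\<close> applies, so \<open>k^N\<close> of the vectors are dependent.\<close>

lemma L0_dependence:
  fixes u :: "nat \<Rightarrow> 'm"
  assumes u: "\<And>i n. n \<ge> N \<Longrightarrow> md (L 0) n (u i) = 0"
  obtains c B where "\<exists>i<B. c i \<noteq> 0" "(\<Sum>i<(B::nat). c i \<cdot> u i) = 0"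
proof -
  from L0_dependence_step obtain k where k1: "k > 0"
    "\<forall>N (u :: nat \<Rightarrow> 'm). (\<forall>i. \<forall>n\<ge>Suc N. md (L 0) n (u i) = 0) \<longrightarrow>
      (\<exists>c. (\<exists>i<k. c i \<noteq> 0) \<and> md (L 0) N (\<Sum>i<k. c i \<cdot> u i) = 0)" by blast
  have k: "k > 0" "\<exists>c. (\<exists>i<k. c i \<noteq> 0) \<and> md (L 0) N (\<Sum>i<k. c i \<cdot> u i) = 0"
    if "\<And>i n. n \<ge> Suc N \<Longrightarrow> md (L 0) n (u i) = 0" for N and u :: "nat \<Rightarrow> 'm"
    using k1 that by auto
  have "\<exists>c. (\<exists>i<k^N. c i \<noteq> 0) \<and> (\<Sum>i<k^N. c i \<cdot> u i) = 0"
    if "\<And>i n. n \<ge> N \<Longrightarrow> md (L 0) n (u i) = 0" for u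
    using that
  proof (induction N arbitrary: u)
    case 0
    have "u 0 = 0" by (rule L00_inj) (simp add: 0)
    thus ?case by (intro exI[of _ "\<lambda>_. 1"]) simp
  next
    case (Suc N)
    have "\<exists>c. (\<exists>i<k. c i \<noteq> 0) \<and> md (L 0) N (\<Sum>i<k. c i \<cdot> u (a * k + i)) = 0" for a
      by (rule k(2)) (rule Suc.prems)
    then obtain c where c: "\<And>a. \<exists>i<k. c a i \<noteq> 0" "\<And>a. md (L 0) N (\<Sum>i<k. c a i \<cdot> u (a * k + i)) = 0"
      by metis
    define z where "z a = (\<Sum>i<k. c a i \<cdot> u (a * k + i))" for a
    have "md (L 0) n (z a) = 0" if "n \<ge> N" for n a
    proof (cases "n = N")
      case False
      with that Suc.prems show ?thesis by (simp add: z_def md_sum md_cm)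
    qed (use c in \<open>simp add: z_def\<close>)
    from Suc.IH[of z, OF this] obtain e where e: "\<exists>i<k^N. e i \<noteq> 0" "(\<Sum>i<k^N. e i \<cdot> z i) = 0" by blast
    define f where "f i = e (i div k) * c (i div k) (i mod k)" for i
    have f: "f (a * k + i) = e a * c a i" if "i < k" for a i
      using that k1(1) by (simp add: f_def)
    have "(\<Sum>i<k^Suc N. f i \<cdot> u i) = (\<Sum>a<k^N. \<Sum>i\<in>{a*k..<a*k+k}. f i \<cdot> u i)"
      by (simp add: sum.nat_group mult.commute)
    also have "\<dots> = (\<Sum>a<k^N. e a \<cdot> z a)"
    proof (rule sum.cong[OF refl])
      fix a
      have "(\<Sum>i\<in>{a*k..<a*k+k}. f i \<cdot> u i) = (\<Sum>i<k. f (a * k + i) \<cdot> u (a * k + i))"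
        by (simp add: sum.atLeastLessThan_shift_0[of _ "a*k"] lessThan_atLeast0 add.commute)
      also have "\<dots> = (\<Sum>i<k. e a \<cdot> c a i \<cdot> u (a * k + i))" by (simp add: f)
      finally show "(\<Sum>i\<in>{a*k..<a*k+k}. f i \<cdot> u i) = e a \<cdot> z a"
        by (simp only: z_def V.scale_sum_right)
    qed
    finally have "(\<Sum>i<k^Suc N. f i \<cdot> u i) = 0" using e(2) by simp
    moreover have "\<exists>i<k^Suc N. f i \<noteq> 0"
    proof -
      from e(1) obtain a where a: "a < k^N" "e a \<noteq> 0" by blast
      from c(1)[of a] obtain i where i: "i < k" "c a i \<noteq> 0" by blast
      have "a * k + i < (a + 1) * k" using i(1) by simp
      also have "\<dots> \<le> k^N * k" using a(1) by (intro mult_right_mono) auto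
      finally have "a * k + i < k ^ Suc N" by (simp add: mult.commute)
      with f[OF i(1)] a i show ?thesis by (intro exI[of _ "a * k + i"]) simp
    qed
    ultimately show ?case by blast
  qed
  from this[of u, OF u] that show thesis by blast
qed

lemma invariant_eigenvector:
  assumes U: "\<And>u v. \<lbrakk>u \<in> U; v \<in> U\<rbrakk> \<Longrightarrow> u + v \<in> U" "\<And>c u. u \<in> U \<Longrightarrow> c \<cdot> u \<in> U"
    and N: "\<And>u n. \<lbrakk>u \<in> U; n \<ge> N\<rbrakk> \<Longrightarrow> md (L 0) n u = 0"
    and E: "cendo (cmul (smul M)) E" "\<And>u. u \<in> U \<Longrightarrow> E u \<in> U"
    and u: "u \<in> U" "u \<noteq> 0"
  obtains v t where "v \<in> U" "v \<noteq> 0" "E v = t \<cdot> v"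
proof -
  interpret cendo "cmul (smul M)" E by fact
  have pow: "(E ^^ i) u \<in> U" for i by (induction i) (simp_all add: u E)
  obtain c B where c: "\<exists>i<B. c i \<noteq> 0" "(\<Sum>i<(B::nat). c i \<cdot> (E ^^ i) u) = 0"
    by (rule L0_dependence[of N "\<lambda>i. (E ^^ i) u"]) (use N[OF pow] in auto)
  define q where "q = (\<Sum>i<B. monom (c i) i)"
  have "coeff q i = (if i < B then c i else 0)" for i by (auto simp: q_def coeff_sum)
  hence "q \<noteq> 0" using c(1) by (metis coeff_0)
  moreover have "app (cmul (smul M)) E q u = 0" using c(2) by (simp add: q_def app_sum app_monom)
  ultimately obtain r t where r: "app (cmul (smul M)) E r u \<noteq> 0"
    "E (app (cmul (smul M)) E r u) = t \<cdot> app (cmul (smul M)) E r u"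
    using obtain_eigenvector u(2) by metis
  have "0 \<in> U" using U(2)[OF u(1), of 0] by simp
  hence "app (cmul (smul M)) E r u \<in> U" for r
    by (induction r) (simp_all add: U u E)
  with r that show thesis by blast
qed

text \<open>\<open>L\<^sub>0(1)\<close> has finitely many eigenvalues \<open>t\<close> on
  \<open>U\<close>. One with minimal \<open>Re (t / p)\<close> is taken: each \<open>x\<close> in
  \<open>X\<close> lowers \<open>t / p\<close> by a positive real number, so it kills the
  eigenvector.\<close>

lemma lowest_weight_vector:
  assumes U: "\<And>u v. \<lbrakk>u \<in> U; v \<in> U\<rbrakk> \<Longrightarrow> u + v \<in> U" "\<And>c u. u \<in> U \<Longrightarrow> c \<cdot> u \<in> U"
    and N: "\<And>u n. \<lbrakk>u \<in> U; n \<ge> N\<rbrakk> \<Longrightarrow> md (L 0) n u = 0"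
    and E_inv: "\<And>u. u \<in> U \<Longrightarrow> md (L 0) 1 u \<in> U"
    and X: "\<And>x u. \<lbrakk>x \<in> X; u \<in> U\<rbrakk> \<Longrightarrow> x u \<in> U"
      "\<And>x. x \<in> X \<Longrightarrow> \<exists>r>0. \<forall>u. md (L 0) 1 (x u) = x (md (L 0) 1 u) - (p * complex_of_real r) \<cdot> x u"
      "\<And>x c u. x \<in> X \<Longrightarrow> x (c \<cdot> u) = c \<cdot> x u"
    and u: "u \<in> U" "u \<noteq> 0"
  obtains v t where "v \<in> U" "v \<noteq> 0" "md (L 0) 1 v = t \<cdot> v" "\<And>x. x \<in> X \<Longrightarrow> x v = 0"
proof -
  define E where "E = md (L 0) 1"
  note E_inv = E_inv[folded E_def] and X = X[folded E_def]
  have E: "cendo (cmul (smul M)) E" unfolding E_def by (rule md_cendo)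
  then interpret cendo "cmul (smul M)" E .
  define Sp where "Sp = {t. \<exists>v\<in>U. v \<noteq> 0 \<and> E v = t \<cdot> v}"
  obtain v t where "v \<in> U" "v \<noteq> 0" "E v = t \<cdot> v"
    by (rule invariant_eigenvector[OF U N E E_inv u])
  hence "Sp \<noteq> {}" unfolding Sp_def by blast
  have "finite Sp"
  proof (rule ccontr)
    assume "infinite Sp"
    then obtain f :: "nat \<Rightarrow> complex" where f: "inj f" "range f \<subseteq> Sp"
      using infinite_countable_subset by blast
    have "\<forall>i. \<exists>v. v \<in> U \<and> v \<noteq> 0 \<and> E v = f i \<cdot> v" using f(2) unfolding Sp_def by blast
    then obtain w where w: "\<And>i. w i \<in> U" "\<And>i. w i \<noteq> 0" "\<And>i. E (w i) = f i \<cdot> w i" by metis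
    obtain c B where c: "\<exists>i<B. c i \<noteq> 0" "(\<Sum>i<(B::nat). c i \<cdot> w i) = 0"
      by (rule L0_dependence[of N w]) (use N[OF w(1)] in auto)
    from c(1) obtain i0 where i0: "i0 < B" "c i0 \<noteq> 0" by blast
    \<comment> \<open>This polynomial vanishes at the eigenvalues \<open>f i\<close> with
      \<open>i < B\<close> except \<open>f i0\<close>, so \<open>P(E)\<close> isolates one term of
      the relation.\<close>
    define P where "P = (\<Prod>j\<in>{..<B} - {i0}. [:- f j, 1:])"
    have P: "poly P z = (\<Prod>j\<in>{..<B} - {i0}. z - f j)" for z by (simp add: P_def poly_prod)
    have P0: "poly P (f i0) \<noteq> 0" unfolding P using f(1) by (auto simp: inj_eq)
    have P1: "poly P (f i) = 0" if "i < B" "i \<noteq> i0" for i unfolding P using that by auto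
    have "app (cmul (smul M)) E P (\<Sum>i\<in>A. c i \<cdot> w i) = (\<Sum>i\<in>A. (c i * poly P (f i)) \<cdot> w i)" for A
      by (induction A rule: infinite_finite_induct)
        (simp_all add: app_add_right app_scale_right app_eigenvector[OF w(3)])
    from this[of "{..<B}"] c(2) have "0 = (\<Sum>i<B. (c i * poly P (f i)) \<cdot> w i)" by simp
    also have "\<dots> = (\<Sum>i\<in>{i0}. (c i * poly P (f i)) \<cdot> w i)"
      by (rule sum.mono_neutral_right) (use i0 P1 in auto)
    finally show False using i0 P0 w(2) by simp
  qed
  have "Min ((\<lambda>t. Re (t / p)) ` Sp) \<in> (\<lambda>t. Re (t / p)) ` Sp"
    using \<open>finite Sp\<close> \<open>Sp \<noteq> {}\<close> by (intro Min_in) auto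
  then obtain t where t: "t \<in> Sp" "Re (t / p) = Min ((\<lambda>t. Re (t / p)) ` Sp)" by fastforce
  have min: "Re (t / p) \<le> Re (t' / p)" if "t' \<in> Sp" for t'
    unfolding t(2) using \<open>finite Sp\<close> that by (intro Min_le) auto
  from t(1) obtain v where v: "v \<in> U" "v \<noteq> 0" "E v = t \<cdot> v" unfolding Sp_def by blast
  have "x v = 0" if "x \<in> X" for x
  proof (rule ccontr)
    assume nz: "x v \<noteq> 0"
    from X(2)[OF that] obtain r where r: "r > 0" "E (x v) = x (E v) - (p * complex_of_real r) \<cdot> x v" by blast
    hence "E (x v) = (t - p * complex_of_real r) \<cdot> x v"
      by (simp add: v(3) X(3)[OF that] V.scale_left_diff_distrib)
    with nz X(1)[OF that v(1)] have "t - p * complex_of_real r \<in> Sp" unfolding Sp_def by blast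
    from min[OF this] p_nz r(1) show False by (simp add: diff_divide_distrib)
  qed
  with v that show thesis unfolding E_def by blast
qed

end

section \<open>Vectors killed by the modes of positive degree\<close>

context K_module
begin

text \<open>The commutator of \<open>x(n)\<close> and \<open>y(m)\<close> involves modes
  \<open>n + m\<close> and \<open>n + m - 1\<close>, at least \<open>N\<close> if
  \<open>m \<ge> 1\<close>. The operator \<open>J\<^sub>0(0)\<close> is allowed too, as its
  commutators have no term with mode \<open>n - 1\<close>.\<close>

lemma bounded_modes_closed:
  assumes v: "\<And>g n. n \<ge> N \<Longrightarrow> md g n v = 0" and m: "m \<ge> 1 \<or> g = J 0" and n: "n \<ge> N"
  shows "md h n (md g m v) = 0"
proof (cases "m \<ge> 1")
  case True
  hence "md h (n + m - Suc 0) v = 0" "md h (n + m) v = 0" for h using n by (simp_all add: v)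
  note * = this v[OF n]
  show ?thesis
    by (cases h; cases g)
      (simp_all add: L_L[of _ n _ m] L_J L_Gp L_Gm J_L Gp_L Gm_L J_J[of _ n _ m] J_Gp J_Gm Gp_J Gm_J
        Gp_Gp[of _ n _ m] Gm_Gm[of _ n _ m] Gp_Gm Gm_Gp *)
next
  case False
  with m have "m = 0" "g = J 0" by auto
  thus ?thesis using v[OF n] J_J[of _ n 0 0 v]
    by (cases h) (simp_all add: L_J Gp_J Gm_J)
qed

text \<open>\<open>L 1\<close> is left out because \<open>L\<^sub>1(0)\<close> acts by a scalar,
  which may be nonzero for \<open>p = -1\<close>.\<close>

definition kill1 :: "'m \<Rightarrow> bool"
  where "kill1 v \<longleftrightarrow> (\<forall>n. md (J 1) n v = 0 \<and> md (Gp 1) n v = 0 \<and> md (Gm 1) n v = 0)"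

lemma kill1_add: "kill1 u \<Longrightarrow> kill1 v \<Longrightarrow> kill1 (u + v)"
  by (simp add: kill1_def md_add)

lemma kill1_cm: "kill1 v \<Longrightarrow> kill1 (c \<cdot> v)"
  by (simp add: kill1_def md_cm)

lemma kill1_L0: "kill1 v \<Longrightarrow> kill1 (md (L 0) m v)"
  by (simp add: kill1_def J_L Gp_L Gm_L)

lemma kill1_J0: "kill1 v \<Longrightarrow> kill1 (md (J 0) m v)"
  using J_J[of 1 _ 0 m v] by (simp add: kill1_def Gp_J Gm_J)

text \<open>The bracket of odd generators of indices 1 and 0 can contain \<open>L\<^sub>1\<close> at
  mode \<open>n + m\<close>; for \<open>m \<ge> 1\<close> that mode kills \<open>v\<close>.\<close>

lemma kill1_G0:
  assumes "kill1 v" "\<And>n. n \<ge> 1 \<Longrightarrow> md (L 1) n v = 0" "m \<ge> 1"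
  shows "kill1 (md (Gp 0) m v)" "kill1 (md (Gm 0) m v)"
  using assms Gp_Gp[of 1 _ 0 m v] Gm_Gm[of 1 _ 0 m v]
  by (simp_all add: kill1_def J_Gp J_Gm Gp_Gm Gm_Gp)

end

context K_irr
begin

text \<open>
  The number \<open>c\<close> is the scalar by which \<open>L\<^sub>1(0)\<close> acts; the parameter \<open>\<beta>\<close> of the modules for \<open>p = -1\<close> is
  \<open>2 c s\<close>.
\<close>

definition highest :: "'m \<Rightarrow> complex \<Rightarrow> complex \<Rightarrow> complex \<Rightarrow> bool"
  where "highest v \<Delta> \<Lambda> c \<longleftrightarrow> v \<noteq> 0 \<and> (\<forall>u. md (L 1) 0 u = c \<cdot> u) \<and> (c = 0 \<longrightarrow> vanish 1) \<and> (c \<noteq> 0 \<longrightarrow> p = - 1)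
    \<and> kill1 v \<and> (\<forall>n\<ge>1. md (L 1) n v = 0)
    \<and> (\<forall>n\<ge>2. md (L 0) n v = 0) \<and> (\<forall>n\<ge>1. md (J 0) n v = 0 \<and> md (Gp 0) n v = 0 \<and> md (Gm 0) n v = 0)
    \<and> md (L 0) 1 v = (p * \<Delta>) \<cdot> v \<and> md (J 0) 0 v = \<Lambda> \<cdot> v"

lemma bounded_modes: "\<exists>N. \<forall>g. \<forall>n\<ge>N. md g n v = 0"
proof -
  from md_eventually have "\<forall>g. \<exists>N. \<forall>n\<ge>N. md g n v = 0" by blast
  then obtain N where N: "\<And>g n. n \<ge> N g \<Longrightarrow> md g n v = 0" by metis
  let ?A = "gens 0 \<union> gens 1"
  have "md g n v = 0" if "n \<ge> Max (N ` ?A)" for g n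
  proof (cases "g \<in> ?A")
    case True
    hence "N g \<le> Max (N ` ?A)" by (intro Max_ge) (auto simp: gens_def)
    with that N show ?thesis by simp
  next
    case False
    have "vanish j" if "j \<noteq> 0" "j \<noteq> 1" for j using that by (intro vanish_ge_2) simp
    with False show ?thesis by (cases g) (auto simp: gens_def vanishD)
  qed
  thus ?thesis by blast
qed

lemma ex_kill1: "\<exists>v. v \<noteq> 0 \<and> kill1 v"
proof -
  define X where "X = {md g n | g n. g \<in> {J 1, Gp 1, Gm 1}}"
  have v2: "vanish (1 + 1)" by (rule vanish_ge_2) simp
  from md_nontrivial obtain v :: 'm where v: "v \<noteq> 0" by blast
  obtain w where w: "w \<noteq> 0" "\<And>x. x \<in> X \<Longrightarrow> x w = 0"
  proof (rule common_kernel[of X v])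
    show "y (x v) = 0" if "x \<in> X" "y \<in> X" "y v = 0" for x y v
    proof -
      from that obtain g m h n where "x = md g m" "y = md h n" "g \<in> gens 1" "h \<in> gens 1"
        unfolding X_def gens_def by blast
      with that(3) show ?thesis using gens_commute[OF v2] by blast
    qed
    show "nilp x" if "x \<in> X" for x
      using that nilp_J[of 1] nilp_G unfolding X_def by auto
    show "finite {x\<in>X. x v \<noteq> 0}"
      unfolding X_def by (rule finite_nonzero_md) simp
  qed (use v in auto)
  moreover from w(2) have "kill1 w" unfolding kill1_def X_def by blast
  ultimately show ?thesis by blast
qed

text \<open>Three stages among the vectors with \<open>kill1\<close> and bounded modes: first the
  \<open>L\<^sub>1(n)\<close> with \<open>n \<ge> 1\<close> are killed, as \<open>kill1_G0\<close>
  needs this, then the modes of positive degree of index 0; finally an eigenvector of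
  \<open>J\<^sub>0(0)\<close> is taken.\<close>

lemma ex_highest:
  obtains v \<Delta> \<Lambda> c i where "highest v \<Delta> \<Lambda> c" "v \<in> part M i"
proof -
  obtain c where c: "\<And>u. md (L 1) 0 u = c \<cdot> u" "c = 0 \<longrightarrow> vanish 1" "c \<noteq> 0 \<longrightarrow> p = - 1"
    using L1_scalar by blast
  obtain v1 where v1: "v1 \<noteq> 0" "kill1 v1" using ex_kill1 by blast
  obtain N where N: "\<And>g n. n \<ge> N \<Longrightarrow> md g n v1 = 0" using bounded_modes by blast
  have v2: "vanish (1 + 1)" by (rule vanish_ge_2) simp
  have v2': "vanish (Suc (Suc 0))" by (rule vanish_ge_2) simp
  define B where "B = {v. \<forall>g n. n \<ge> N \<longrightarrow> md g n v = 0}"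
  have B_add: "u + v \<in> B" if "u \<in> B" "v \<in> B" for u v using that by (simp add: B_def md_add)
  have B_cm: "c \<cdot> v \<in> B" if "v \<in> B" for c v using that by (simp add: B_def md_cm)
  have B_md: "md g m v \<in> B" if "v \<in> B" "m \<ge> 1 \<or> g = J 0" for g m v
    using that bounded_modes_closed[of N v m g] by (simp add: B_def)
  have kill1_L1: "kill1 (md (L 1) m v)" if "kill1 v" for m v
    using that by (simp add: kill1_def J_L Gp_L Gm_L vanishD[OF v2'])
  define U1 where "U1 = {v \<in> B. kill1 v}"
  obtain v where v: "v \<in> U1" "v \<noteq> 0" "\<And>n. n \<ge> 1 \<Longrightarrow> md (L 1) n v = 0"
  proof (rule lowest_weight_vector[of U1 N "{md (L 1) n | n. n \<ge> 1}" v1])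
    show "\<exists>r>0. \<forall>u. md (L 0) 1 (x u) = x (md (L 0) 1 u) - (p * complex_of_real r) \<cdot> x u"
      if "x \<in> {md (L 1) n | n. n \<ge> 1}" for x
    proof -
      from that obtain n where n: "x = md (L 1) n" "n \<ge> 1" by blast
      \<comment> \<open>If \<open>c = 0\<close>, then \<open>L\<^sub>1\<close> vanishes; otherwise
        \<open>p = -1\<close>, and the weight \<open>1 + p - p n\<close> of
        \<open>L\<^sub>1(n)\<close> is \<open>-p n\<close>.\<close>
      have "(of_nat 1 + p) - p * of_nat n = - (p * of_nat n)" if "p = - 1" using that by simp
      hence "md (L 0) 1 (x u) = x (md (L 0) 1 u) - (p * complex_of_real (real n)) \<cdot> x u" for u
        using c L_L[of 0 1 1 n u] by (cases "c = 0") (auto simp: n vanishD)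
      with n(2) show ?thesis by (intro exI[of _ "real n"]) simp
    qed
  qed (use v1 N in \<open>auto simp: U1_def B_add B_cm B_md kill1_add kill1_cm kill1_L0 kill1_L1 md_cm, simp_all add: B_def kill1_L1[simplified]\<close>)
  define U2 where "U2 = {v \<in> B. kill1 v \<and> (\<forall>n\<ge>1. md (L 1) n v = 0)}"
  have U2_L: "md (L 0) m u \<in> U2" if "u \<in> U2" "m \<ge> 1" for u m
    using that L_L[of 1 _ 0 m u] by (auto simp: U2_def B_md kill1_L0)
  have U2_J: "md (J 0) m u \<in> U2" if "u \<in> U2" for u m
    using that B_md[of u m "J 0"] by (auto simp: U2_def kill1_J0 L_J) (simp_all add: kill1_def)
  have U2_G: "md (Gp 0) m u \<in> U2" "md (Gm 0) m u \<in> U2" if "u \<in> U2" "m \<ge> 1" for u m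
    using that kill1_G0[of u m] by (auto simp: U2_def B_md L_Gp L_Gm) (simp_all add: kill1_def)
  define X where "X = {md (L 0) n | n. n \<ge> 2} \<union> {md g n | g n. n \<ge> 1 \<and> g \<in> {J 0, Gp 0, Gm 0}}"
  have U2_add: "u + v \<in> U2" if "u \<in> U2" "v \<in> U2" for u v
    using that by (simp add: U2_def B_add kill1_add md_add)
  have U2_cm: "c \<cdot> v \<in> U2" if "v \<in> U2" for c v
    using that by (simp add: U2_def B_cm kill1_cm md_cm)
  have U2_N: "md g n u = 0" if "u \<in> U2" "n \<ge> N" for g n u using that by (simp add: U2_def B_def)
  have "v \<in> U2" using v by (simp add: U1_def U2_def)
  obtain v t where v: "v \<in> U2" "v \<noteq> 0" "md (L 0) 1 v = t \<cdot> v" "\<And>x. x \<in> X \<Longrightarrow> x v = 0"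
  proof (rule lowest_weight_vector[OF U2_add U2_cm U2_N U2_L _ _ _ \<open>v \<in> U2\<close> \<open>v \<noteq> 0\<close>, of N X])
    show "\<exists>r>0. \<forall>u. md (L 0) 1 (x u) = x (md (L 0) 1 u) - (p * complex_of_real r) \<cdot> x u"
      if "x \<in> X" for x
    proof -
      \<comment> \<open>The weights are \<open>-p(n-1)\<close> for \<open>L\<^sub>0(n)\<close>,
        \<open>-p n\<close> for \<open>J\<^sub>0(n)\<close> and \<open>-p(n-1/2)\<close> for
        \<open>G\<^sub>0(n)\<close>: negative multiples of \<open>p\<close> throughout
        \<open>X\<close>.\<close>
      from that consider n where "x = md (L 0) n" "n \<ge> 2" | n where "x = md (J 0) n" "n \<ge> 1"
        | n where "x = md (Gp 0) n" "n \<ge> 1" | n where "x = md (Gm 0) n" "n \<ge> 1"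
        unfolding X_def by blast
      thus ?thesis
      proof cases
        case (1 n)
        thus ?thesis using L_L[of 0 1 0 n]
          by (intro exI[of _ "real n - 1"]) (auto simp: right_diff_distrib V.scale_left_diff_distrib)
      next
        case (2 n)
        thus ?thesis by (intro exI[of _ "real n"]) (auto simp: L_J)
      next
        case (3 n)
        thus ?thesis by (intro exI[of _ "real n - 1/2"])
          (auto simp: L_Gp right_diff_distrib V.scale_left_diff_distrib)
      next
        case (4 n)
        thus ?thesis by (intro exI[of _ "real n - 1/2"])
          (auto simp: L_Gm right_diff_distrib V.scale_left_diff_distrib)
      qed
    qed
    show "x u \<in> U2" if "x \<in> X" "u \<in> U2" for x u
      using that U2_L U2_J U2_G unfolding X_def by auto
    show "x (c \<cdot> u) = c \<cdot> x u" if "x \<in> X" for x c u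
      using that unfolding X_def by (auto simp: md_cm)
  qed auto
  \<comment> \<open>\<open>J\<^sub>0(0)\<close> preserves \<open>U3\<close>: it commutes with
    \<open>L\<^sub>0(1)\<close>, and its commutators with members of \<open>X\<close> are zero or,
    up to sign, members of \<open>X\<close>.\<close>
  define U3 where "U3 = {v \<in> U2. md (L 0) 1 v = t \<cdot> v \<and> (\<forall>x\<in>X. x v = 0)}"
  have U3_X: "x u = 0" if "u \<in> U3" "x \<in> X" for x u using that unfolding U3_def by blast
  obtain v \<Lambda> where v: "v \<in> U3" "v \<noteq> 0" "md (J 0) 0 v = \<Lambda> \<cdot> v"
  proof (rule invariant_eigenvector[of U3 N "md (J 0) 0" v])
    have X_add: "x (u + v) = x u + x v" if "x \<in> X" for x u v using that unfolding X_def by (auto simp: md_add)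
    have X_cm: "x (c \<cdot> u) = c \<cdot> x u" if "x \<in> X" for x c u using that unfolding X_def by (auto simp: md_cm)
    show "u + w \<in> U3" if uw: "u \<in> U3" "w \<in> U3" for u w
    proof -
      have "x (u + w) = 0" if "x \<in> X" for x using X_add[OF that, of u w] U3_X[OF uw(1) that] U3_X[OF uw(2) that] by simp
      with uw show ?thesis by (simp add: U3_def U2_add md_add V.scale_right_distrib)
    qed
    show "c \<cdot> u \<in> U3" if u: "u \<in> U3" for c u
    proof -
      have "x (c \<cdot> u) = 0" if "x \<in> X" for x using X_cm[OF that, of c u] U3_X[OF u that] by simp
      with u show ?thesis by (simp add: U3_def U2_cm md_cm mult.commute)
    qed
    show "md (L 0) n u = 0" if "u \<in> U3" "n \<ge> N" for n u using that U2_N by (simp add: U3_def)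
    show "md (J 0) 0 u \<in> U3" if u: "u \<in> U3" for u
    proof -
      have "x (md (J 0) 0 u) = 0" if "x \<in> X" for x
      proof -
        have "md (L 0) n u = 0" if "n \<ge> 2" for n using u that unfolding U3_def X_def by blast
        moreover have "md (J 0) n u = 0" "md (Gp 0) n u = 0" "md (Gm 0) n u = 0" if "n \<ge> 1" for n
          using u that unfolding U3_def X_def by blast+
        ultimately show ?thesis using \<open>x \<in> X\<close> J_J[of 0 _ 0 0 u] unfolding X_def by (auto simp: L_J Gp_J Gm_J)
      qed
      with u show ?thesis by (simp add: U3_def U2_J L_J md_cm)
    qed
    show "v \<in> U3" using v by (simp add: U3_def)
  qed (use v md_cendo in auto)
  \<comment> \<open>All conditions found so far say that homogeneous operators kill
    \<open>v\<close>, so they pass to its parity components, one of which is nonzero.\<close>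
  from M.part_sum obtain y z where yz: "y \<in> part M 0" "z \<in> part M 1" "v = y + z" by blast
  have comp: "x y = 0" "x z = 0" if "homog x" "x v = 0" for x
    using homog_kernel[OF that(1) _ yz(1,2)] that(2) yz(3) by simp_all
  have "\<exists>u i. u \<noteq> 0 \<and> u \<in> part M i \<and> (\<forall>x. homog x \<and> x v = 0 \<longrightarrow> x u = 0)"
    using yz comp v(2) by (metis add_0 add_0_right)
  then obtain u i where u: "u \<noteq> 0" "u \<in> part M i" "\<And>x. \<lbrakk>homog x; x v = 0\<rbrakk> \<Longrightarrow> x u = 0" by blast
  have u_md: "md g n u = 0" if "md g n v = 0" for g n using u(3) homog_md that by blast
  have homog_t: "homog (\<lambda>v. md (L 0) 1 v - t \<cdot> v)"
    by (rule homog_shift[OF homog_md], drule md_part[of _ _ "L 0" 1], simp only: gen_parity.simps add_0)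
  have homog_\<Lambda>: "homog (\<lambda>v. md (J 0) 0 v - \<Lambda> \<cdot> v)"
    by (rule homog_shift[OF homog_md], drule md_part[of _ _ "J 0" 0], simp only: gen_parity.simps add_0)
  have Xv: "md (L 0) n v = 0" if "n \<ge> 2" for n using v(1) that unfolding U3_def X_def by blast
  have Xv': "md (J 0) n v = 0" "md (Gp 0) n v = 0" "md (Gm 0) n v = 0" if "n \<ge> 1" for n
    using v(1) that unfolding U3_def X_def by blast+
  have "highest u (t / p) \<Lambda> c"
    unfolding highest_def
  proof (intro conjI)
    show "md (L 0) 1 u = (p * (t / p)) \<cdot> u" using u(3)[OF homog_t] v(1) p_nz by (simp add: U3_def)
    show "md (J 0) 0 u = \<Lambda> \<cdot> u" using u(3)[OF homog_\<Lambda>] v(3) by simp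
    show "kill1 u" using v(1) u_md by (simp add: U3_def U2_def kill1_def)
    show "\<forall>n\<ge>1. md (L 1) n u = 0" using v(1) u_md by (simp add: U3_def U2_def)
    show "\<forall>n\<ge>2. md (L 0) n u = 0" using Xv u_md by blast
    show "\<forall>n\<ge>1. md (J 0) n u = 0 \<and> md (Gp 0) n u = 0 \<and> md (Gm 0) n u = 0" using Xv' u_md by blast
  qed (use u c in auto)
  with u(2) that show thesis by blast
qed

text \<open>Stability under modes is checked only on \<open>B\<close>, since
  \<open>[x(n), \<partial>] = n x(n-1)\<close> extends it to the \<complex>[\<partial>]-span; a span
  of homogeneous vectors is graded.\<close>

lemma span_UNIV:
  assumes hom: "\<And>e. e \<in> B \<Longrightarrow> \<exists>i. e \<in> part M i"
    and md: "\<And>e g n. e \<in> B \<Longrightarrow> md g n e \<in> S.span B"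
    and e: "e \<in> B" "e \<noteq> 0"
  shows "S.span B = UNIV"
proof -
  have D: "D z \<in> S.span B" if "z \<in> S.span B" for z
    using S.span_scale[OF that] by (simp add: deriv_op_def)
  have cm: "k \<cdot> z \<in> S.span B" if "z \<in> S.span B" for k z
    using S.span_scale[OF that] by (simp add: cmul_def)
  have smul: "md g n (smul M q e) \<in> S.span B" if "e \<in> B" for e g n q
  proof (induction q arbitrary: n)
    case (pCons k q)
    thus ?case by (simp add: smul_pCons md_add md_cm md_D S.span_add D cm md[OF that])
  qed (simp add: S.span_zero)
  have "md g n z \<in> S.span B" if "z \<in> S.span B" for z g n
    using that by (induction rule: S.span_induct_alt) (simp_all add: S.span_zero S.span_add md_add smul)
  hence "coeff (act M x z) n \<in> S.span B" if "z \<in> S.span B" for x z n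
    using that by (intro act_closed S.subspace_span)
  moreover have "\<exists>y\<in>S.span B \<inter> part M 0. \<exists>z\<in>S.span B \<inter> part M 1. x = y + z" if "x \<in> S.span B" for x
    using that
  proof (induction rule: S.span_induct_alt)
    case base
    show ?case using S.subspace_0[OF M.subspace_part] S.span_zero by force
  next
    case (step q e x)
    from step.IH obtain y z where yz: "y \<in> S.span B" "y \<in> part M 0" "z \<in> S.span B" "z \<in> part M 1" "x = y + z"
      by blast
    from hom[OF step.hyps] obtain i where "e \<in> part M i" by blast
    hence q: "smul M q e \<in> part M i" "smul M q e \<in> S.span B"
      using S.subspace_scale[OF M.subspace_part] S.span_scale[OF S.span_base[OF step.hyps]] by auto
    show ?case
    proof (cases "i = 0")
      case True
      with q yz show ?thesis
        by (intro bexI[of _ "smul M q e + y"] bexI[of _ z])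
          (auto simp: S.span_add S.subspace_add[OF M.subspace_part])
    next
      case False
      hence "i = 1" by (cases i) auto
      with q yz show ?thesis
        by (intro bexI[of _ y] bexI[of _ "smul M q e + z"])
          (auto simp: S.span_add S.subspace_add[OF M.subspace_part] algebra_simps)
    qed
  qed
  ultimately have "conformal_submodule M (S.span B)"
    unfolding conformal_submodule_def using S.subspace_span by blast
  with irr e S.span_base[OF e(1)] show ?thesis unfolding irreducible_module_def by blast
qed

lemma independent_parts:
  assumes "x \<in> part M i" "y \<in> part M (i + 1)" "x + y = 0"
  shows "x = 0" "y = 0"
proof -
  have "x = - y" using assms(3) by (simp add: eq_neg_iff_add_eq_0)
  hence "x \<in> part M (i + 1)" using S.subspace_neg[OF M.subspace_part assms(2)] by simp
  with assms(1) have "x \<in> part M 0 \<inter> part M 1" by (cases i) auto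
  hence "x = 0" using M.part_Int by blast
  thus "x = 0" "y = 0" using assms(3) by simp_all
qed

lemma part_smul: "x \<in> part M i \<Longrightarrow> smul M q x \<in> part M i"
  by (rule S.subspace_scale[OF M.subspace_part])

end

locale K_hw = K_irr p M for p :: complex and M :: "(gen free, 'm::ab_group_add) conf_mod" +
  fixes s \<Delta> \<Lambda> c :: complex and v :: 'm and i :: bit
  assumes s2: "s^2 = p" and hw: "highest v \<Delta> \<Lambda> c" and v_part: "v \<in> part M i"
begin

section \<open>The action on the vectors \<open>v\<close>, \<open>A\<close>, \<open>B\<close>,
  \<open>W\<close>\<close>

lemma s_nz: "s \<noteq> 0" using s2 p_nz by auto

lemma p_s: "p = s * s" using s2 by (simp add: power2_eq_square)

lemma v_nz: "v \<noteq> 0" using hw by (simp add: highest_def)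

abbreviation y :: "'m \<Rightarrow> 'm" where "y u \<equiv> D u + \<alpha> \<cdot> u"

text \<open>
  The vectors \<open>v\<close>, \<open>W\<close>, \<open>A\<close>, \<open>B\<close> play the roles of the basis vectors \<open>u1\<close>, \<open>u2\<close>, \<open>w1\<close>, \<open>w2\<close>.
\<close>

definition A :: 'm where "A = inverse s \<cdot> md (Gp 0) 0 v"
definition B :: 'm where "B = inverse s \<cdot> md (Gm 0) 0 v"
definition W :: 'm where "W = inverse p \<cdot> md (Gp 0) 0 (md (Gm 0) 0 v)"

lemma vanish2: "md (L (Suc (Suc j))) n u = 0" "md (J (Suc (Suc j))) n u = 0"
  "md (Gp (Suc (Suc j))) n u = 0" "md (Gm (Suc (Suc j))) n u = 0"
  using vanish_ge_2[of "Suc (Suc j)"] by (simp_all add: vanishD)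

lemma L1: "md (L (Suc 0)) 0 u = c \<cdot> u"
  using hw by (simp add: highest_def)

lemma v_md:
  "md (L 0) (Suc 0) v = (p * \<Delta>) \<cdot> v" "md (L 0) (Suc (Suc n)) v = 0"
  "md (J 0) 0 v = \<Lambda> \<cdot> v" "md (J 0) (Suc n) v = 0" "md (Gp 0) (Suc n) v = 0" "md (Gm 0) (Suc n) v = 0"
  "md (L (Suc 0)) (Suc n) v = 0" "md (J (Suc 0)) n v = 0" "md (Gp (Suc 0)) n v = 0" "md (Gm (Suc 0)) n v = 0"
  using hw by (simp_all add: highest_def kill1_def)

lemma v_G: "md (Gp 0) 0 v = s \<cdot> A" "md (Gm 0) 0 v = s \<cdot> B"
  using s_nz by (simp_all add: A_def B_def)

text \<open>Each mode is commuted past \<open>G\<^sub>0\<^sup>+(0)\<close> and applied to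
  \<open>v\<close>. The multiples of \<open>v\<close> that appear, with factors
  \<open>2 \<Delta> - \<Lambda>\<close> and \<open>c\<close>, prevent \<open>A\<close> from being
  zero or highest.\<close>

lemma A_md:
  "md (L 0) (Suc 0) A = (p * (\<Delta> + 1/2)) \<cdot> A" "md (L 0) (Suc (Suc n)) A = 0"
  "md (J 0) 0 A = (\<Lambda> + 1) \<cdot> A" "md (J 0) (Suc n) A = 0"
  "md (Gp 0) n A = 0"
  "md (Gm 0) (Suc 0) A = (s * (2 * \<Delta> - \<Lambda>)) \<cdot> v" "md (Gm 0) (Suc (Suc n)) A = 0"
  "md (L (Suc 0)) (Suc n) A = 0" "md (J (Suc 0)) n A = 0" "md (Gp (Suc 0)) n A = 0"
  "md (Gm (Suc 0)) 0 A = (2 * c / s) \<cdot> v" "md (Gm (Suc 0)) (Suc n) A = 0"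
proof -
  have PP: "md (Gp 0) n (md (Gp 0) 0 v) = 0" "md (Gp (Suc 0)) n (md (Gp 0) 0 v) = 0"
    using Gp_Gp[of 0 n 0 0 v] Gp_Gp[of "Suc 0" n 0 0 v] md_nilp_square(1)[of 0 0 v]
    by (cases n; simp add: v_md)+
  show "md (Gp 0) n A = 0" "md (Gp (Suc 0)) n A = 0" by (simp_all add: A_def md_cm PP)
  show "md (L 0) (Suc 0) A = (p * (\<Delta> + 1/2)) \<cdot> A" "md (L 0) (Suc (Suc n)) A = 0"
    "md (J 0) 0 A = (\<Lambda> + 1) \<cdot> A" "md (J 0) (Suc n) A = 0"
    "md (L (Suc 0)) (Suc n) A = 0" "md (J (Suc 0)) n A = 0"
    by (simp_all add: A_def md_cm L_Gp J_Gp v_md) (simp_all add: algebra_simps)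
  have "s * (2 * \<Delta> - \<Lambda>) = inverse s * (2 * (p * \<Delta>) - p * \<Lambda>)"
    using s_nz by (simp add: p_s field_simps)
  thus "md (Gm 0) (Suc 0) A = (s * (2 * \<Delta> - \<Lambda>)) \<cdot> v"
    by (simp add: A_def md_cm Gm_Gp v_md V.scale_left_diff_distrib V.scale_right_diff_distrib right_diff_distrib)
  show "md (Gm 0) (Suc (Suc n)) A = 0" by (simp add: A_def md_cm Gm_Gp v_md)
  show "md (Gm (Suc 0)) 0 A = (2 * c / s) \<cdot> v" "md (Gm (Suc 0)) (Suc n) A = 0"
    by (simp_all add: A_def md_cm Gm_Gp v_md L1 field_simps)
qed

lemma GpGmv: "md (Gp 0) 0 (md (Gm 0) 0 v) = p \<cdot> W"
  using p_nz by (simp add: W_def)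

lemma A_Gm: "md (Gm 0) 0 A = (2 * s) \<cdot> y v - s \<cdot> W"
proof -
  have e: "inverse s * (2 * p) = 2 * s" "inverse s * p = s" using s_nz by (simp_all add: p_s)
  have "md (Gm 0) 0 A = inverse s \<cdot> ((2 * p) \<cdot> y v - p \<cdot> W)"
    by (simp add: A_def md_cm Gm_Gp L00 GpGmv)
  also have "\<dots> = (inverse s * (2 * p)) \<cdot> y v - (inverse s * p) \<cdot> W"
    by (simp only: V.scale_right_diff_distrib V.scale_scale)
  finally show ?thesis unfolding e .
qed

lemma B_md:
  "md (L 0) (Suc 0) B = (p * (\<Delta> + 1/2)) \<cdot> B" "md (L 0) (Suc (Suc n)) B = 0"
  "md (J 0) 0 B = (\<Lambda> - 1) \<cdot> B" "md (J 0) (Suc n) B = 0"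
  "md (Gm 0) n B = 0" "md (Gp 0) 0 B = s \<cdot> W"
  "md (Gp 0) (Suc 0) B = (s * (2 * \<Delta> + \<Lambda>)) \<cdot> v" "md (Gp 0) (Suc (Suc n)) B = 0"
  "md (L (Suc 0)) (Suc n) B = 0" "md (J (Suc 0)) n B = 0" "md (Gm (Suc 0)) n B = 0"
  "md (Gp (Suc 0)) 0 B = (2 * c / s) \<cdot> v" "md (Gp (Suc 0)) (Suc n) B = 0"
proof -
  have PP: "md (Gm 0) n (md (Gm 0) 0 v) = 0" "md (Gm (Suc 0)) n (md (Gm 0) 0 v) = 0"
    using Gm_Gm[of 0 n 0 0 v] Gm_Gm[of "Suc 0" n 0 0 v] md_nilp_square(2)[of 0 0 v]
    by (cases n; simp add: v_md)+
  show "md (Gm 0) n B = 0" "md (Gm (Suc 0)) n B = 0" by (simp_all add: B_def md_cm PP)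
  have "inverse s * p = s" using s_nz by (simp add: p_s)
  thus "md (Gp 0) 0 B = s \<cdot> W" by (simp add: B_def md_cm GpGmv)
  show "md (L 0) (Suc 0) B = (p * (\<Delta> + 1/2)) \<cdot> B" "md (L 0) (Suc (Suc n)) B = 0"
    "md (J 0) 0 B = (\<Lambda> - 1) \<cdot> B" "md (J 0) (Suc n) B = 0"
    "md (L (Suc 0)) (Suc n) B = 0" "md (J (Suc 0)) n B = 0"
    by (simp_all add: B_def md_cm L_Gm J_Gm v_md) (simp_all add: algebra_simps)
  have "s * (2 * \<Delta> + \<Lambda>) = inverse s * (p * \<Lambda> + 2 * (p * \<Delta>))"
    using s_nz by (simp add: p_s field_simps)
  thus "md (Gp 0) (Suc 0) B = (s * (2 * \<Delta> + \<Lambda>)) \<cdot> v"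
    by (simp add: B_def md_cm Gp_Gm v_md V.scale_left_distrib V.scale_right_distrib distrib_left)
  show "md (Gp 0) (Suc (Suc n)) B = 0" by (simp add: B_def md_cm Gp_Gm v_md)
  show "md (Gp (Suc 0)) 0 B = (2 * c / s) \<cdot> v" "md (Gp (Suc 0)) (Suc n) B = 0"
    by (simp_all add: B_def md_cm Gp_Gm v_md L1 field_simps)
qed

lemma W_B: "W = inverse s \<cdot> md (Gp 0) 0 B"
  using s_nz by (simp add: B_md)

text \<open>\<open>W\<close> is a multiple of \<open>G\<^sub>0\<^sup>+(0) B\<close>, so its table
  follows from that of \<open>B\<close> by one more commutation.\<close>

lemma W_md:
  "md (L 0) (Suc 0) W = (p * (\<Delta> + 1)) \<cdot> W" "md (L 0) (Suc (Suc 0)) W = (p * (2 * \<Delta> + \<Lambda>)) \<cdot> v"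
  "md (L 0) (Suc (Suc (Suc n))) W = 0"
  "md (J 0) 0 W = \<Lambda> \<cdot> W" "md (J 0) (Suc 0) W = (2 * \<Delta> + \<Lambda>) \<cdot> v" "md (J 0) (Suc (Suc n)) W = 0"
  "md (Gp 0) 0 W = 0" "md (Gp 0) (Suc 0) W = (- s * (2 * \<Delta> + \<Lambda>)) \<cdot> A" "md (Gp 0) (Suc (Suc n)) W = 0"
  "md (Gm 0) 0 W = (2 * s) \<cdot> y B" "md (Gm 0) (Suc 0) W = (s * (2 * \<Delta> - \<Lambda> + 2)) \<cdot> B"
  "md (Gm 0) (Suc (Suc n)) W = 0"
  "md (L (Suc 0)) (Suc 0) W = c \<cdot> v" "md (L (Suc 0)) (Suc (Suc n)) W = 0"
  "md (J (Suc 0)) 0 W = (2 * c / p) \<cdot> v" "md (J (Suc 0)) (Suc n) W = 0"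
  "md (Gp (Suc 0)) 0 W = (- 2 * c / s) \<cdot> A" "md (Gp (Suc 0)) (Suc n) W = 0"
  "md (Gm (Suc 0)) 0 W = (2 * c / s) \<cdot> B" "md (Gm (Suc 0)) (Suc n) W = 0"
proof -
  \<comment> \<open>\<open>B_md(6)\<close> is left out: it would rewrite
    \<open>md (Gp 0) 0 B\<close> back to a multiple of \<open>W\<close> before the mode is commuted
    past it.\<close>
  note W_simps = md_cm L_Gp J_Gp Gm_Gp B_md(1-5,7-) vanish2 V.scale_right_distrib
  have iss: "inverse s * s = 1" "inverse s * (s * x) = x" for x using s_nz by simp_all
  have ps: "inverse s * (p * x) = s * x" "inverse s * p = s" for x using s_nz by (simp_all add: p_s)
  have W_eq: "md g n W = inverse s \<cdot> md g n (md (Gp 0) 0 B)" for g n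
    by (simp only: W_B md_cm[symmetric])
  have "md (L 0) (Suc 0) W = inverse s \<cdot> ((p * (\<Delta> + 1/2)) \<cdot> s \<cdot> W + (p / 2) \<cdot> s \<cdot> W)"
    unfolding W_eq by (simp add: W_simps) (simp add: B_md(6) mult_ac)
  also have "\<dots> = (inverse s * (p * (\<Delta> + 1/2) * s) + inverse s * (p / 2 * s)) \<cdot> W"
    by (simp only: V.scale_right_distrib V.scale_left_distrib V.scale_scale)
  also have "inverse s * (p * (\<Delta> + 1/2) * s) + inverse s * (p / 2 * s) = p * (\<Delta> + 1)"
    using s_nz by (simp add: field_simps)
  finally show "md (L 0) (Suc 0) W = (p * (\<Delta> + 1)) \<cdot> W" .
  show "md (L 0) (Suc (Suc 0)) W = (p * (2 * \<Delta> + \<Lambda>)) \<cdot> v"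
    unfolding W_eq by (simp add: W_simps, (simp add: s_nz field_simps)?)
  show "md (L 0) (Suc (Suc (Suc n))) W = 0" unfolding W_eq by (simp add: W_simps)
  have "md (J 0) 0 W = inverse s \<cdot> ((\<Lambda> - 1) \<cdot> s \<cdot> W + s \<cdot> W)"
    unfolding W_eq by (simp add: W_simps) (simp add: B_md(6) mult_ac)
  also have "\<dots> = (inverse s * ((\<Lambda> - 1) * s) + inverse s * s) \<cdot> W"
    by (simp only: V.scale_right_distrib V.scale_left_distrib V.scale_scale)
  also have "inverse s * ((\<Lambda> - 1) * s) + inverse s * s = \<Lambda>" using s_nz by (simp add: field_simps)
  finally show "md (J 0) 0 W = \<Lambda> \<cdot> W" .
  show "md (J 0) (Suc 0) W = (2 * \<Delta> + \<Lambda>) \<cdot> v" unfolding W_eq by (simp add: W_simps iss)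
  show "md (J 0) (Suc (Suc n)) W = 0" unfolding W_eq by (simp add: W_simps)
  show "md (Gp 0) 0 W = 0" unfolding W_eq by (simp add: md_cm md_nilp_square)
  show "md (Gp 0) (Suc 0) W = (- s * (2 * \<Delta> + \<Lambda>)) \<cdot> A"
    unfolding W_eq by (simp add: Gp_Gp[of 0 "Suc 0" 0 0] md_cm B_md(1-5,7-) v_G, (simp add: s_nz field_simps)?)
  show "md (Gp 0) (Suc (Suc n)) W = 0" unfolding W_eq by (simp add: Gp_Gp[of 0 "Suc (Suc n)" 0 0] md_cm B_md(1-5,7-))
  have e: "inverse s * (2 * p) = 2 * s" using s_nz by (simp add: p_s)
  have "md (Gm 0) 0 W = (inverse s * (2 * p)) \<cdot> y B"
    unfolding W_eq by (simp add: W_simps L00 mult_ac)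
  thus "md (Gm 0) 0 W = (2 * s) \<cdot> y B" unfolding e .
  have "md (Gm 0) (Suc 0) W = inverse s \<cdot> ((- (p * (\<Lambda> - 1))) \<cdot> B + (2 * (p * (\<Delta> + 1/2))) \<cdot> B)"
    unfolding W_eq by (simp add: W_simps)
  also have "\<dots> = (inverse s * (- (p * (\<Lambda> - 1))) + inverse s * (2 * (p * (\<Delta> + 1/2)))) \<cdot> B"
    by (simp only: V.scale_right_distrib V.scale_left_distrib V.scale_scale)
  also have "inverse s * (- (p * (\<Lambda> - 1))) + inverse s * (2 * (p * (\<Delta> + 1/2))) = s * (2 * \<Delta> - \<Lambda> + 2)"
    using s_nz by (simp add: p_s field_simps)
  finally show "md (Gm 0) (Suc 0) W = (s * (2 * \<Delta> - \<Lambda> + 2)) \<cdot> B" .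
  show "md (Gm 0) (Suc (Suc n)) W = 0" unfolding W_eq by (simp add: W_simps)
  show "md (L (Suc 0)) (Suc 0) W = c \<cdot> v" unfolding W_eq by (simp add: W_simps, simp add: field_simps p_s s_nz)
  show "md (L (Suc 0)) (Suc (Suc n)) W = 0" unfolding W_eq by (simp add: W_simps)
  show "md (J (Suc 0)) 0 W = (2 * c / p) \<cdot> v"
    unfolding W_eq by (simp add: W_simps, simp add: field_simps p_s s_nz)
  show "md (J (Suc 0)) (Suc n) W = 0" unfolding W_eq by (simp add: W_simps)
  show "md (Gp (Suc 0)) 0 W = (- 2 * c / s) \<cdot> A"
    unfolding W_eq by (simp add: Gp_Gp[of "Suc 0" 0 0 0] md_cm B_md(1-5,7-) v_G, simp add: field_simps p_s s_nz)
  show "md (Gp (Suc 0)) (Suc n) W = 0" unfolding W_eq by (simp add: Gp_Gp[of "Suc 0" "Suc n" 0 0] md_cm B_md(1-5,7-))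
  show "md (Gm (Suc 0)) 0 W = (2 * c / s) \<cdot> B"
    unfolding W_eq by (simp add: W_simps L1, simp add: field_simps p_s s_nz)
  show "md (Gm (Suc 0)) (Suc n) W = 0" unfolding W_eq by (simp add: W_simps)
qed

lemma A_part: "A \<in> part M (i + 1)"
  unfolding A_def using part_cm[OF md_part[OF v_part, of "Gp 0" 0]] by (simp only: gen_parity.simps add.commute)

lemma B_part: "B \<in> part M (i + 1)"
  unfolding B_def using part_cm[OF md_part[OF v_part, of "Gm 0" 0]] by (simp only: gen_parity.simps add.commute)

lemma W_part: "W \<in> part M i"
proof -
  have "1 + (i + 1) = i" by (cases i) auto
  with part_cm[OF md_part[OF B_part, of "Gp 0" 0], of "inverse s"] show ?thesis
    unfolding W_B by (simp only: gen_parity.simps)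
qed

end

section \<open>Isomorphisms with the free modules\<close>

lemma coeff_term: "coeff (t \<odot> b) n = Poly_Mapping.single b (coeff t n)"
  by (simp add: term_of_basis_def coeff_map_poly)

section \<open>Linear maps out of free modules\<close>

context K_irr
begin

definition lin :: "('b \<Rightarrow> 'm) \<Rightarrow> 'b free \<Rightarrow> 'm"
  where "lin e x = (\<Sum>b\<in>UNIV. smul M (Poly_Mapping.lookup x b) (e b))"

lemma lin_0 [simp]: "lin e 0 = 0"
  by (simp add: lin_def)

lemma lin_add: "lin e (x + y) = lin e x + lin e y"
  by (simp add: lin_def lookup_add S.scale_left_distrib sum.distrib)

lemma lin_smul: "lin e (free_smul q x) = smul M q (lin e x)"
  by (simp add: lin_def lookup_free_smul S.scale_sum_right)

lemma lin_cmul: "lin e (cmul free_smul k x) = k \<cdot> lin e x"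
  by (simp add: cmul_def lin_smul)

lemma lin_deriv: "lin e (deriv_op free_smul x) = D (lin e x)"
  by (simp add: deriv_op_def lin_smul)

lemma lin_minus: "lin e (- x) = - lin e x"
  using lin_add[of e x "- x"] by (simp add: eq_neg_iff_add_eq_0 add.commute)

lemma lin_single:
  assumes "finite (UNIV :: 'b set)"
  shows "lin e (Poly_Mapping.single (b::'b) q) = smul M q (e b)"
proof -
  have "smul M (Poly_Mapping.lookup (Poly_Mapping.single b q) x) (e x) = (if b = x then smul M q (e x) else 0)" for x
    by (simp add: lookup_single when_def)
  thus ?thesis using assms by (simp add: lin_def)
qed

text \<open>Both sides obey the same sesquilinearity rules, so equality on generators and basis
  vectors suffices. It is extended first in the module argument, then in the algebra
  argument.\<close>

lemma free_action_eq:
  fixes e :: "'b \<Rightarrow> 'm" and V :: "(gen free, 'b free) conf_mod"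
  assumes fin: "finite (UNIV :: 'b set)"
    and V: "smul V = free_smul" "part V = free_part par"
    and par: "\<And>g b b' d l. par b' \<noteq> gen_parity g + par b \<Longrightarrow> ev (f g b) b' d l = 0"
    and act: "\<And>g b. act M (gen_elem g) (e b) = map_poly (lin e) (f g b)"
  shows "act M a (lin e x) = map_poly (lin e) (extend f a x)"
proof -
  interpret X: sesquilinear_action "K_alg p" V "extend f"
    by (rule sesquilinear_action_extend[OF K_alg_simps(1,2) V]) (rule par)
  note X = X.add_left X.add_right X.cmul_left X.cmul_right X.deriv_left X.deriv_right
  note X = X[unfolded V K_alg_simps]
  note Y = add_left add_right cmul_left cmul_right deriv_left deriv_right
  note Y = Y[unfolded K_alg_simps]
  have m_add: "map_poly (lin e) (P + Q) = map_poly (lin e) P + map_poly (lin e) Q" for P Q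
    by (rule map_poly_additive) (simp_all add: lin_add)
  have m_cm: "map_poly (lin e) (map_poly (cmul free_smul k) P) = map_poly (cm k) (map_poly (lin e) P)" for k P
    by (rule poly_eqI) (simp add: coeff_map_poly lin_smul cmul_def)
  have m_lam: "map_poly (lin e) (- mul_lam P) = - mul_lam (map_poly (lin e) P)" for P
    by (rule poly_eqI) (simp add: coeff_map_poly lin_minus coeff_pCons split: nat.split)
  have m_dlam: "map_poly (lin e) (deriv_plus_lam free_smul P) = deriv_plus_lam (smul M) (map_poly (lin e) P)" for P
    by (rule poly_eqI) (simp add: deriv_plus_lam_def m_add coeff_map_poly lin_smul deriv_op_def coeff_pCons split: nat.split)
  have split: "Poly_Mapping.single b (pCons k q) =
    cmul free_smul k (gen_elem b) + deriv_op free_smul (Poly_Mapping.single b q)" for b :: 'c and k q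
    by (simp add: cmul_def deriv_op_def free_smul_single flip: single_add)
  have 1: "act M (gen_elem g) (lin e (Poly_Mapping.single b q)) = map_poly (lin e) (extend f (gen_elem g) (Poly_Mapping.single b q))" for g b q
  proof (induction q)
    case (pCons k q)
    have "act M (gen_elem g) (lin e (gen_elem b)) = map_poly (lin e) (extend f (gen_elem g) (gen_elem b))"
      by (simp add: lin_single[OF fin] act extend_single)
    thus ?case by (simp only: split X Y lin_add lin_cmul lin_deriv m_add m_cm m_dlam pCons.IH)
  next
    case 0
    show ?case using X(2)[of "gen_elem g" 0 0] by simp
  qed
  have 2: "act M (gen_elem g) (lin e x) = map_poly (lin e) (extend f (gen_elem g) x)" for g x
    by (induction x rule: free_induct) (simp_all add: 1 X Y lin_add m_add)
  have 3: "act M (Poly_Mapping.single g q) (lin e x) = map_poly (lin e) (extend f (Poly_Mapping.single g q) x)" for g q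
  proof (induction q)
    case (pCons k q)
    show ?case by (simp only: split X Y m_add m_cm m_lam 2 pCons.IH)
  next
    case 0
    show ?case using X(1)[of 0 0 x] by simp
  qed
  show ?thesis
    by (induction a rule: free_induct) (simp_all add: 3 X Y m_add)
qed

text \<open>The isomorphism is the inverse of \<open>lin e\<close>. The offset \<open>i\<close>
  between the parities of the basis and of its images decides between \<open>V\<close> and its
  parity change.\<close>

lemma isomorphic_free:
  fixes e :: "'b \<Rightarrow> 'm" and V :: "(gen free, 'b free) conf_mod"
  assumes fin: "finite (UNIV :: 'b set)"
    and V: "smul V = free_smul" "part V = free_part par" "act V = extend f"
    and par: "\<And>g b b' d l. par b' \<noteq> gen_parity g + par b \<Longrightarrow> ev (f g b) b' d l = 0"
    and act: "\<And>g b. act M (gen_elem g) (e b) = map_poly (lin e) (f g b)"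
    and e_part: "\<And>b. e b \<in> part M (par b + i)"
    and span: "S.span (range e) = UNIV"
    and indep: "\<And>q b. (\<Sum>b\<in>UNIV. smul M (q b) (e b)) = 0 \<Longrightarrow> q b = 0"
  shows "isomorphic_upto_parity M V"
proof -
  interpret V: graded_module V by (rule graded_module_free[OF V(1,2)])
  let ?\<psi> = "lin e"
  have inj: "inj ?\<psi>"
  proof (rule injI)
    fix x y assume "?\<psi> x = ?\<psi> y"
    hence "?\<psi> (x + - y) = 0" unfolding lin_add lin_minus by simp
    hence "Poly_Mapping.lookup (x + - y) b = 0" for b unfolding lin_def by (rule indep)
    hence "x + - y = 0" by (intro poly_mapping_eqI) simp
    thus "x = y" by simp
  qed
  have surj: "surj ?\<psi>"
  proof -
    have "z \<in> range ?\<psi>" if "z \<in> S.span (range e)" for z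
      using that
    proof (induction rule: S.span_induct_alt)
      case base
      show ?case using lin_0 by (metis rangeI)
    next
      case (step q x y)
      then obtain b u where "x = e b" "y = ?\<psi> u" by blast
      hence "smul M q x + y = ?\<psi> (Poly_Mapping.single b q + u)" by (simp add: lin_add lin_single[OF fin])
      thus ?case by simp
    qed
    thus ?thesis using span by auto
  qed
  let ?\<phi> = "inv ?\<psi>"
  have \<psi>\<phi>: "?\<psi> (?\<phi> z) = z" for z using surj by (rule surj_f_inv_f)
  have \<phi>\<psi>: "?\<phi> (?\<psi> x) = x" for x using inj by (rule inv_f_f)
  have bij: "bij ?\<phi>" using inj surj bij_imp_bij_inv unfolding bij_def by blast
  have hom: "module_hom (smul M) (smul V) ?\<phi>"
    unfolding module_hom_iff
  proof (intro conjI allI)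
    show "module (smul M)" "module (smul V)" by (rule M.module V.module)+
    show "?\<phi> (x + y) = ?\<phi> x + ?\<phi> y" for x y
      by (metis \<psi>\<phi> \<phi>\<psi> lin_add)
    show "?\<phi> (smul M q x) = smul V q (?\<phi> x)" for q x
      unfolding V by (metis \<psi>\<phi> \<phi>\<psi> lin_smul)
  qed
  have part1: "?\<psi> x \<in> part M (j + i)" if "x \<in> part V j" for x j
    unfolding lin_def
  proof (rule S.subspace_sum[OF M.subspace_part])
    fix b
    show "smul M (Poly_Mapping.lookup x b) (e b) \<in> part M (j + i)"
    proof (cases "b \<in> Poly_Mapping.keys x")
      case True
      with that have "par b = j" by (auto simp: V free_part_def)
      with part_smul[OF e_part] show ?thesis by blast
    qed (simp add: in_keys_iff S.subspace_0[OF M.subspace_part])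
  qed
  \<comment> \<open>The preimage of \<open>z\<close> is split into parity components; by
    \<open>independent_parts\<close> the component of the right parity is already mapped to
    \<open>z\<close>.\<close>
  have part2: "?\<phi> z \<in> part V j" if z: "z \<in> part M (j + i)" for z j
  proof -
    obtain x y where xy: "x \<in> part V j" "y \<in> part V (j + 1)" "?\<phi> z = x + y"
    proof (cases "j = 0")
      case True
      with V.part_sum[of "?\<phi> z"] that show thesis by auto
    next
      case False
      hence "j = 1" by (cases j) auto
      moreover from V.part_sum[of "?\<phi> z"] obtain x0 x1 where "x0 \<in> part V 0" "x1 \<in> part V 1" "?\<phi> z = x0 + x1" by blast
      ultimately show thesis using that[of x1 x0] by (simp add: add.commute)
    qed
    have "?\<psi> x - z \<in> part M (j + i)" using part1[OF xy(1)] z by (rule S.subspace_diff[OF M.subspace_part])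
    moreover have "?\<psi> y \<in> part M (j + i + 1)" using part1[OF xy(2)] by (simp only: add_ac)
    moreover have "?\<psi> x - z + ?\<psi> y = 0" using \<psi>\<phi>[of z] unfolding xy(3) lin_add by (simp add: algebra_simps)
    ultimately have "?\<psi> x - z = 0" by (rule independent_parts)
    hence "?\<phi> z = x" using \<phi>\<psi>[of x] by simp
    with xy(1) show ?thesis by simp
  qed
  have part: "?\<phi> ` part M j = part V (j + i)" for j
  proof -
    have ji: "j + i + i = j" by (cases i) (simp_all add: add.assoc)
    show ?thesis
    proof
      show "?\<phi> ` part M j \<subseteq> part V (j + i)" using part2[of _ "j + i"] unfolding ji by blast
      show "part V (j + i) \<subseteq> ?\<phi> ` part M j"
      proof
        fix x assume "x \<in> part V (j + i)"
        from part1[OF this] have "?\<psi> x \<in> part M j" unfolding ji .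
        thus "x \<in> ?\<phi> ` part M j" using \<phi>\<psi>[of x] by force
      qed
    qed
  qed
  have act': "act V a (?\<phi> z) = map_poly ?\<phi> (act M a z)" for a z
  proof -
    have "?\<phi> 0 = 0" using \<phi>\<psi>[of 0] by simp
    have "act M a z = map_poly ?\<psi> (extend f a (?\<phi> z))"
      using free_action_eq[OF fin V(1,2) par act, of a "?\<phi> z"] by (simp add: \<psi>\<phi>)
    thus ?thesis by (intro poly_eqI) (simp add: coeff_map_poly \<open>?\<phi> 0 = 0\<close> \<phi>\<psi> V)
  qed
  show ?thesis
  proof (cases "i = 0")
    case True
    have "isomorphic M V"
      unfolding isomorphic_def using bij hom part act' True by (intro exI[of _ ?\<phi>]) simp
    thus ?thesis by (simp add: isomorphic_upto_parity_def)
  next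
    case False
    hence "i = 1" by (cases i) auto
    hence "isomorphic M (parity_change V)"
      unfolding isomorphic_def using bij hom part act'
      by (intro exI[of _ ?\<phi>]) (simp add: parity_change_def)
    thus ?thesis by (simp add: isomorphic_upto_parity_def)
  qed
qed

lemma act_of_modes:
  assumes "\<And>n. md g n u = fact n \<cdot> lin e (coeff P n)"
  shows "act M (gen_elem g) u = map_poly (lin e) P"
  by (rule poly_eqI) (simp add: coeff_act assms coeff_map_poly)

end

lemma nat_cases4:
  obtains "n = 0" | "n = Suc 0" | "n = Suc (Suc 0)" | k where "n = Suc (Suc (Suc k))"
  by (metis not0_implies_Suc)

lemma gen_cases:
  obtains "g = L 0" | "g = J 0" | "g = Gp 0" | "g = Gm 0"
    | "g = L (Suc 0)" | "g = J (Suc 0)" | "g = Gp (Suc 0)" | "g = Gm (Suc 0)"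
    | j where "g = L (Suc (Suc j))" | j where "g = J (Suc (Suc j))"
    | j where "g = Gp (Suc (Suc j))" | j where "g = Gm (Suc (Suc j))"
  by (cases g) (metis not0_implies_Suc)+

lemma UNIV_basis4: "UNIV = {u1, u2, w1, w2}"
  using basis4.exhaust by blast

lemma UNIV_basis2: "UNIV = {v0, v1}"
  using basis2.exhaust by blast

lemma V4_parity: "basis4_parity b' \<noteq> gen_parity g + basis4_parity b \<Longrightarrow> ev (V4_act p s \<Delta> \<Lambda> \<alpha> g b) b' d l = 0"
  by (cases g rule: gen_cases; cases b; cases b'; simp)

lemma V4b_parity: "basis4_parity b' \<noteq> gen_parity g + basis4_parity b \<Longrightarrow> ev (V4b_act s \<Delta> \<Lambda> \<alpha> \<beta> g b) b' d l = 0"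
  by (cases g rule: gen_cases; cases b; cases b'; simp)

lemma V1_parity: "basis2_parity b' \<noteq> gen_parity g + basis2_parity b \<Longrightarrow> ev (V1_act p s \<Delta> \<alpha> g b) b' d l = 0"
  by (cases g rule: gen_cases; cases b; cases b'; simp)

lemma V2_parity: "basis2_parity b' \<noteq> gen_parity g + basis2_parity b \<Longrightarrow> ev (V2_act p s \<Delta> \<alpha> g b) b' d l = 0"
  by (cases g rule: gen_cases; cases b; cases b'; simp)

section \<open>Modules of rank four\<close>

context K_hw
begin

definition e4 :: "basis4 \<Rightarrow> 'm"
  where "e4 b = (case b of u1 \<Rightarrow> v | u2 \<Rightarrow> W | w1 \<Rightarrow> A | w2 \<Rightarrow> B)"

lemma e4_simps [simp]: "e4 u1 = v" "e4 u2 = W" "e4 w1 = A" "e4 w2 = B"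
  by (simp_all add: e4_def)

lemmas md_tables = v_md v_G A_md A_Gm B_md W_md L00 L1 vanish2

lemma span4: "S.span {v, A, B, W} = UNIV"
proof (rule span_UNIV)
  show "\<exists>i. e \<in> part M i" if "e \<in> {v, A, B, W}" for e
    using that v_part A_part B_part W_part by blast
  define N where "N = S.span {v, A, B, W}"
  have cl: "k \<cdot> z \<in> N" "D z \<in> N" "- z \<in> N" if "z \<in> N" for k z
    using S.span_scale[of z "{v, A, B, W}"] S.span_neg[of z "{v, A, B, W}"] that
    by (simp_all add: N_def cmul_def deriv_op_def)
  have cl2: "x + z \<in> N" "x - z \<in> N" if "x \<in> N" "z \<in> N" for x z
    using that by (simp_all add: N_def S.span_add S.span_diff)
  have base: "v \<in> N" "A \<in> N" "B \<in> N" "W \<in> N" "0 \<in> N"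
    unfolding N_def by (auto intro: S.span_base S.span_zero)
  note md_tables = md_tables base cl cl2
  have "md g n v \<in> N" for g n
    by (cases g rule: gen_cases; cases n rule: nat_cases4; simp add: md_tables)
  moreover have "md g n A \<in> N" for g n
    by (cases g rule: gen_cases; cases n rule: nat_cases4; simp add: md_tables)
  moreover have "md g n B \<in> N" for g n
    by (cases g rule: gen_cases; cases n rule: nat_cases4; simp add: md_tables)
  moreover have "md g n W \<in> N" for g n
    by (cases g rule: gen_cases; cases n rule: nat_cases4; simp add: md_tables)
  ultimately show "md g n e \<in> S.span {v, A, B, W}" if "e \<in> {v, A, B, W}" for e g n
    using that unfolding N_def[symmetric] by blast
qed (use v_nz in auto)

lemma fin4: "finite (UNIV :: basis4 set)"
  by (simp add: UNIV_basis4)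

lemma lin4: "lin e4 (Poly_Mapping.single b q) = smul M q (e4 b)"
  by (rule lin_single[OF fin4])

lemmas act_simps = coeff_term lin4 smul_pCons lin_add lin_minus D_add D_cm md_cm md_add
  V.scale_right_distrib V.scale_right_diff_distrib power2_eq_square

lemma D_0 [simp]: "D 0 = 0"
  using D_add[of 0 0] by simp

lemma act4_0: "g \<in> {L 0, J 0, Gp 0, Gm 0} \<Longrightarrow> act M (gen_elem g) (e4 b) = map_poly (lin e4) (V4_act p s \<Delta> \<Lambda> \<alpha> g b)"
proof (rule act_of_modes)
  fix n assume "g \<in> {L 0, J 0, Gp 0, Gm 0}"
  thus "md g n (e4 b) = fact n \<cdot> lin e4 (coeff (V4_act p s \<Delta> \<Lambda> \<alpha> g b) n)"
    by (cases b; cases n rule: nat_cases4; elim insertE emptyE)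
      (simp_all add: md_tables act_simps algebra_simps)
qed

lemma act4_vanish:
  assumes "c = 0 \<or> g \<notin> {L (Suc 0), J (Suc 0), Gp (Suc 0), Gm (Suc 0)}"
  shows "act M (gen_elem g) (e4 b) = map_poly (lin e4) (V4_act p s \<Delta> \<Lambda> \<alpha> g b)"
proof (cases "g \<in> {L 0, J 0, Gp 0, Gm 0}")
  case True
  thus ?thesis by (rule act4_0)
next
  case False
  have v1: "vanish (Suc 0)" if "c = 0" using hw that by (simp add: highest_def)
  have "md g n u = 0" for n u
    using False assms by (cases g rule: gen_cases) (auto simp: vanish2 vanishD v1)
  moreover have "V4_act p s \<Delta> \<Lambda> \<alpha> g b = 0"
    using False by (cases g rule: gen_cases; cases b; simp)
  ultimately show ?thesis by (intro act_of_modes) simp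
qed

lemma act4b:
  assumes "p = - 1"
  shows "act M (gen_elem g) (e4 b) = map_poly (lin e4) (V4b_act s \<Delta> \<Lambda> \<alpha> (2 * c * s) g b)"
proof (cases "g \<in> {L (Suc 0), J (Suc 0), Gp (Suc 0), Gm (Suc 0)}")
  case False
  have "V4b_act s \<Delta> \<Lambda> \<alpha> (2 * c * s) g b = V4_act p s \<Delta> \<Lambda> \<alpha> g b"
    using False assms by (cases g rule: gen_cases; cases b; simp)
  with False act4_vanish show ?thesis by simp
next
  case True
  have ss: "s * s = - 1" using p_s assms by simp
  \<comment> \<open>This choice makes \<open>-(s/2) \<beta>\<close> equal to \<open>c\<close>, the
    scalar of \<open>L\<^sub>1(0)\<close>.\<close>
  define \<beta> where "\<beta> = 2 * c * s"
  have "s * \<beta> = 2 * c * (s * s)" by (simp add: \<beta>_def)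
  hence 1: "s * \<beta> = - (2 * c)" unfolding ss by simp
  hence 2: "2 * c / s = - \<beta>" using s_nz by (simp add: divide_eq_eq mult.commute)
  have W3: "md (J (Suc 0)) 0 W = (- (2 * c)) \<cdot> v" using W_md(15) assms by simp
  have W4: "md (Gp (Suc 0)) 0 W = \<beta> \<cdot> A" using W_md(17) 2 by simp
  have "act M (gen_elem g) (e4 b) = map_poly (lin e4) (V4b_act s \<Delta> \<Lambda> \<alpha> \<beta> g b)"
  proof (rule act_of_modes)
    fix n
    show "md g n (e4 b) = fact n \<cdot> lin e4 (coeff (V4b_act s \<Delta> \<Lambda> \<alpha> \<beta> g b) n)"
      using True
      by (cases b; cases n rule: nat_cases4; elim insertE emptyE)
        (simp_all add: v_md A_md(8-) B_md(9-) W3 W4 W_md(13,14,16,18-) L1 act_simps 1 2)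
  qed
  thus ?thesis by (simp only: \<beta>_def)
qed

lemma A_nz: "c \<noteq> 0 \<or> 2 * \<Delta> - \<Lambda> \<noteq> 0 \<Longrightarrow> A \<noteq> 0"
  using A_md(6) A_md(11) s_nz v_nz by auto

lemma B_nz: "c \<noteq> 0 \<or> 2 * \<Delta> + \<Lambda> \<noteq> 0 \<Longrightarrow> B \<noteq> 0"
  using B_md(7) B_md(12) s_nz v_nz by auto

lemma md0_smul: "md g 0 (smul M q u) = smul M q (md g 0 u)"
  using md0_endo[of g] unfolding endo_def endo_axioms_def by blast

text \<open>Parity separates \<open>v\<close>, \<open>W\<close> from \<open>A\<close>,
  \<open>B\<close>. For \<open>c = 0\<close>, \<open>G\<^sub>0\<^sup>+(0)\<close> kills
  \<open>W\<close> and sends \<open>v\<close> to a nonzero multiple of \<open>A\<close>; for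
  \<open>c \<noteq> 0\<close>, \<open>G\<^sub>1\<^sup>+(0)\<close> kills \<open>v\<close> and sends
  \<open>W\<close> to one. On \<open>A\<close> and \<open>B\<close> the
  \<complex>[\<partial>]-linear \<open>J\<^sub>0(0)\<close> has different eigenvalues.\<close>

lemma independent4:
  assumes "c \<noteq> 0 \<or> 2 * \<Delta> - \<Lambda> \<noteq> 0" "c \<noteq> 0 \<or> 2 * \<Delta> + \<Lambda> \<noteq> 0"
    and rel: "(\<Sum>b\<in>UNIV. smul M (q b) (e4 b)) = 0"
  shows "q b = 0"
proof -
  have "(smul M (q u1) v + smul M (q u2) W) + (smul M (q w1) A + smul M (q w2) B) = 0"
    using rel by (simp add: UNIV_basis4 add.assoc)
  moreover have "smul M (q u1) v + smul M (q u2) W \<in> part M i" "smul M (q w1) A + smul M (q w2) B \<in> part M (i + 1)"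
    using part_smul v_part W_part A_part B_part S.subspace_add[OF M.subspace_part] by blast+
  ultimately have even: "smul M (q u1) v + smul M (q u2) W = 0" and odd: "smul M (q w1) A + smul M (q w2) B = 0"
    using independent_parts by blast+
  have nz: "A \<noteq> 0" "B \<noteq> 0" using A_nz B_nz assms by blast+
  have "q u1 = 0 \<and> q u2 = 0"
  proof (cases "c = 0")
    case True
    have "md (Gp 0) 0 (smul M (q u1) v + smul M (q u2) W) = smul M (q u1) (s \<cdot> A)"
      by (simp only: md_add md0_smul v_G W_md S.scale_zero_right add_0_right)
    hence "smul M (q u1) (s \<cdot> A) = 0" by (simp add: even)
    with nz s_nz torsion_free have 1: "q u1 = 0" by (metis V.scale_eq_0_iff)
    have "W \<noteq> 0" using W_md(8) nz(1) s_nz assms(2) True by auto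
    with even 1 torsion_free show ?thesis by auto
  next
    case False
    have "md (Gp (Suc 0)) 0 (smul M (q u1) v + smul M (q u2) W) = smul M (q u2) ((- 2 * c / s) \<cdot> A)"
      by (simp only: md_add md0_smul v_md W_md S.scale_zero_right add_0_left)
    hence "smul M (q u2) ((- 2 * c / s) \<cdot> A) = 0" by (simp add: even)
    moreover have "(- 2 * c / s) \<cdot> A \<noteq> 0" using False s_nz nz(1) by simp
    ultimately have 1: "q u2 = 0" using torsion_free by blast
    with even v_nz torsion_free show ?thesis by auto
  qed
  moreover have "q w1 = 0 \<and> q w2 = 0"
  proof -
    have "md (J 0) 0 (smul M (q w1) A + smul M (q w2) B) = smul M (q w1) ((\<Lambda> + 1) \<cdot> A) + smul M (q w2) ((\<Lambda> - 1) \<cdot> B)"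
      by (simp only: md_add md0_smul A_md B_md)
    also have "\<dots> = (\<Lambda> - 1) \<cdot> (smul M (q w1) A + smul M (q w2) B) + 2 \<cdot> smul M (q w1) A"
    proof -
      have "smul M r (k \<cdot> u) = k \<cdot> smul M r u" for r k u by (simp add: cmul_def mult.commute)
      moreover have "(\<Lambda> + 1) \<cdot> u = (\<Lambda> - 1) \<cdot> u + 2 \<cdot> u" for u
        by (simp flip: V.scale_left_distrib)
      ultimately show ?thesis by (simp add: V.scale_right_distrib S.scale_right_distrib add_ac)
    qed
    finally have "smul M (q w1) A = 0" by (simp add: odd)
    with nz odd torsion_free show ?thesis by auto
  qed
  ultimately show ?thesis by (cases b) auto
qed

lemma range_e4: "range e4 = {v, A, B, W}"
  by (auto simp: UNIV_basis4)

lemma e4_part: "e4 b \<in> part M (basis4_parity b + i)"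
proof -
  have "A \<in> part M (1 + i)" "B \<in> part M (1 + i)"
    using A_part B_part by (simp_all only: add.commute[of 1])
  with v_part W_part show ?thesis
    by (cases b) (simp_all only: e4_simps basis4_parity.simps add_0)
qed

lemma isomorphic_V4:
  assumes "2 * \<Delta> - \<Lambda> \<noteq> 0" "2 * \<Delta> + \<Lambda> \<noteq> 0" "c = 0"
  shows "isomorphic_upto_parity M (V4 p s \<Delta> \<Lambda> \<alpha>)"
proof (rule isomorphic_free[where e = e4 and f = "V4_act p s \<Delta> \<Lambda> \<alpha>" and par = basis4_parity and i = i])
  show "ev (V4_act p s \<Delta> \<Lambda> \<alpha> g b) b' d l = 0" if "basis4_parity b' \<noteq> gen_parity g + basis4_parity b" for g b b' d l
    using that by (rule V4_parity)
  show "act M (gen_elem g) (e4 b) = map_poly (lin e4) (V4_act p s \<Delta> \<Lambda> \<alpha> g b)" for g b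
    by (rule act4_vanish) (simp add: assms)
  show "e4 b \<in> part M (basis4_parity b + i)" for b by (rule e4_part)
  show "q b = 0" if "(\<Sum>b\<in>UNIV. smul M (q b) (e4 b)) = 0" for q b
    using independent4[OF _ _ that] assms by blast
qed (simp_all add: V4_def fin4 range_e4 span4)

lemma isomorphic_V4b:
  assumes "c \<noteq> 0 \<or> 2 * \<Delta> - \<Lambda> \<noteq> 0" "c \<noteq> 0 \<or> 2 * \<Delta> + \<Lambda> \<noteq> 0" "p = - 1"
  shows "isomorphic_upto_parity M (V4b s \<Delta> \<Lambda> \<alpha> (2 * c * s))"
proof (rule isomorphic_free[where e = e4 and f = "V4b_act s \<Delta> \<Lambda> \<alpha> (2 * c * s)" and par = basis4_parity and i = i])
  show "ev (V4b_act s \<Delta> \<Lambda> \<alpha> (2 * c * s) g b) b' d l = 0" if "basis4_parity b' \<noteq> gen_parity g + basis4_parity b" for g b b' d l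
    using that by (rule V4b_parity)
  show "act M (gen_elem g) (e4 b) = map_poly (lin e4) (V4b_act s \<Delta> \<Lambda> \<alpha> (2 * c * s) g b)" for g b
    by (rule act4b) (simp add: assms)
  show "e4 b \<in> part M (basis4_parity b + i)" for b by (rule e4_part)
  show "q b = 0" if "(\<Sum>b\<in>UNIV. smul M (q b) (e4 b)) = 0" for q b
    using independent4[OF _ _ that] assms by blast
qed (simp_all add: V4b_def fin4 range_e4 span4)

section \<open>Modules of rank two\<close>

lemma fin2: "finite (UNIV :: basis2 set)"
  by (simp add: UNIV_basis2)

definition e2 :: "'m \<Rightarrow> basis2 \<Rightarrow> 'm"
  where "e2 u b = (case b of v0 \<Rightarrow> v | v1 \<Rightarrow> u)"

lemma e2_simps [simp]: "e2 u v0 = v" "e2 u v1 = u"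
  by (simp_all add: e2_def)

lemma lin2: "lin (e2 u) (Poly_Mapping.single b q) = smul M q (e2 u b)"
  by (rule lin_single[OF fin2])

lemma range_e2: "range (e2 u) = {v, u}"
  by (auto simp: UNIV_basis2)

lemma independent2:
  assumes "u \<in> part M (i + 1)" "u \<noteq> 0" "(\<Sum>b\<in>UNIV. smul M (q b) (e2 u b)) = 0"
  shows "q b = 0"
proof -
  have "smul M (q v0) v + smul M (q v1) u = 0" using assms(3) by (simp add: UNIV_basis2)
  hence "smul M (q v0) v = 0" "smul M (q v1) u = 0"
    using independent_parts[OF part_smul[OF v_part] part_smul[OF assms(1)]] by blast+
  with assms(2) v_nz torsion_free show ?thesis by (cases b) auto
qed

text \<open>
  If the span of \<open>u\<close> and \<open>(\<partial> + \<alpha>) v\<close> were everything, then \<open>\<partial> + \<alpha>\<close> would be invertible on \<open>v\<close>.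
\<close>

lemma y_proper:
  assumes u: "u \<in> part M (i + 1)" and md: "\<And>g n. md g n u \<in> S.span {u, y v}" "\<And>g n. md g n (y v) \<in> S.span {u, y v}"
  shows False
proof -
  have yv: "y v = smul M [:\<alpha>, 1:] v"
    by (simp add: smul_pCons add.commute)
  have "y v \<noteq> 0"
    using L00_inj[of v] v_nz by (auto simp: L00)
  have "S.span {u, y v} = UNIV"
  proof (rule span_UNIV)
    show "\<exists>i. e \<in> part M i" if "e \<in> {u, y v}" for e
      using that u part_smul[OF v_part, of "[:\<alpha>, 1:]"] unfolding yv by blast
    show "md g n e \<in> S.span {u, y v}" if "e \<in> {u, y v}" for e g n
      using that md by blast
  qed (use \<open>y v \<noteq> 0\<close> in auto)
  then obtain h where "v - smul M h u \<in> S.span {y v}"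
    using S.span_breakdown_eq[of v u "{y v}"] by blast
  then obtain k where k: "v - smul M h u = smul M k (y v)" using S.span_singleton by auto
  have "smul M (1 - k * [:\<alpha>, 1:]) v + smul M (- h) u = 0"
    using k unfolding yv by (simp only: S.scale_left_diff_distrib S.scale_minus_left S.scale_scale S.scale_one) (simp add: algebra_simps)
  hence "smul M (1 - k * [:\<alpha>, 1:]) v = 0"
    using independent_parts[OF part_smul[OF v_part] part_smul[OF u]] by blast
  hence "1 - k * [:\<alpha>, 1:] = 0" using torsion_free v_nz by blast
  hence "[:\<alpha>, 1:] dvd 1" by (metis dvd_triv_right eq_iff_diff_eq_0)
  thus False by (simp add: is_unit_iff_degree)
qed

lemma y_md: "md g n (y v) = D (md g n v) + of_nat n \<cdot> md g (n - 1) v + \<alpha> \<cdot> md g n v"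
  by (simp add: md_add md_D md_cm)

lemma span_closed:
  assumes "e \<in> S.span X" shows "k \<cdot> e \<in> S.span X" "D e \<in> S.span X"
  using S.span_scale[OF assms] by (simp_all add: cmul_def deriv_op_def)

lemma W_of_A_0: assumes "A = 0" shows "W = 2 \<cdot> y v"
proof -
  have "s \<cdot> W = s \<cdot> 2 \<cdot> y v" using A_Gm unfolding assms md_0 by (simp add: mult.commute)
  thus ?thesis using s_nz by (simp only: V.scale_cancel_left) simp
qed

lemma W_of_B_0: assumes "B = 0" shows "W = 0"
  using W_B assms by simp

section \<open>The case \<open>G\<^sub>0\<^sup>+(0) v = 0\<close>, which leads to
  \<open>V2\<close>\<close>

context
  assumes c0: "c = 0" and Z0: "A = 0"
begin

lemma chiral_vanish: "md (L (Suc j)) n u = 0" "md (J (Suc j)) n u = 0" "md (Gp (Suc j)) n u = 0" "md (Gm (Suc j)) n u = 0"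
proof -
  have "vanish (Suc j)"
    using hw c0 vanish_ge_2[of "Suc j"] by (cases j) (simp_all add: highest_def)
  thus "md (L (Suc j)) n u = 0" "md (J (Suc j)) n u = 0" "md (Gp (Suc j)) n u = 0" "md (Gm (Suc j)) n u = 0"
    by (simp_all add: vanishD)
qed

lemma chiral_Lambda: "\<Lambda> = 2 * \<Delta>"
  using A_md(6) Z0 s_nz v_nz by simp

lemma chiral_md:
  "md (J 0) 0 v = (2 * \<Delta>) \<cdot> v" "md (J 0) 0 B = (2 * \<Delta> - 1) \<cdot> B"
  "md (Gp 0) 0 v = 0" "md (Gm 0) 0 v = s \<cdot> B"
  "md (Gp 0) 0 B = (2 * s) \<cdot> y v" "md (Gp 0) (Suc 0) B = (2 * s * (2 * \<Delta>)) \<cdot> v"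
  using v_md(3) v_G Z0 W_of_A_0
  by (simp_all add: A_md B_md A_Gm chiral_Lambda  mult_ac)

lemmas chiral_tables = chiral_md v_md B_md L00 chiral_vanish

lemma chiral_X_nz: "B \<noteq> 0"
proof
  assume "B = 0"
  hence "(2 * s) \<cdot> y v = 0" using chiral_md(5) by simp
  hence "y v = 0" using s_nz by (simp only: V.scale_eq_0_iff) simp
  with L00_inj[of v] v_nz show False by (simp add: L00)
qed

text \<open>For \<open>\<Delta> = 0\<close> the multiples of \<open>v\<close> itself disappear from
  the images of \<open>B\<close> and \<open>(\<partial>+\<alpha>) v\<close> under the modes, and
  these two vectors would span a proper submodule.\<close>

lemma chiral_Delta: "\<Delta> \<noteq> 0"
proof
  assume \<Delta>: "\<Delta> = 0"
  define z where "z = y v"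
  define N where "N = S.span {B, z}"
  have cl: "k \<cdot> u \<in> N" "D u \<in> N" "- u \<in> N" if "u \<in> N" for k u
    using span_closed[of u "{B, z}"] S.span_neg[of u "{B, z}"] that by (simp_all add: N_def)
  have cl2: "x + u \<in> N" "x - u \<in> N" if "x \<in> N" "u \<in> N" for x u
    using that by (simp_all add: N_def S.span_add S.span_diff)
  have base: "B \<in> N" "z \<in> N" "0 \<in> N"
    unfolding N_def by (auto intro: S.span_base S.span_zero)
  have D0: "D 0 = 0" using D_add[of 0 0] by simp
  have 1: "md g n B \<in> N" for g n
    by (cases g rule: gen_cases; cases n rule: nat_cases4;
        simp add: chiral_tables \<Delta> base cl cl2 flip: z_def)
  have 2: "md g n z \<in> N" for g n
    unfolding z_def y_md
    by (cases g rule: gen_cases; cases n rule: nat_cases4;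
        simp add: chiral_tables \<Delta> base cl cl2 D0 D_cm flip: z_def)
  show False
    using y_proper[OF B_part] 1 2 unfolding N_def z_def by blast
qed

lemma chiral_span: "S.span {v, B} = UNIV"
proof (rule span_UNIV)
  show "\<exists>i. e \<in> part M i" if "e \<in> {v, B}" for e
    using that v_part B_part by blast
  define N where "N = S.span {v, B}"
  have cl: "k \<cdot> u \<in> N" "D u \<in> N" "- u \<in> N" if "u \<in> N" for k u
    using span_closed[of u "{v, B}"] S.span_neg[of u "{v, B}"] that by (simp_all add: N_def)
  have cl2: "x + u \<in> N" "x - u \<in> N" if "x \<in> N" "u \<in> N" for x u
    using that by (simp_all add: N_def S.span_add S.span_diff)
  have base: "B \<in> N" "v \<in> N" "0 \<in> N"
    unfolding N_def by (auto intro: S.span_base S.span_zero)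
  have "md g n B \<in> N" for g n
    by (cases g rule: gen_cases; cases n rule: nat_cases4; simp add: chiral_tables base cl cl2)
  moreover have "md g n v \<in> N" for g n
    by (cases g rule: gen_cases; cases n rule: nat_cases4; simp add: chiral_tables base cl cl2)
  ultimately show "md g n e \<in> S.span {v, B}" if "e \<in> {v, B}" for e g n
    using that unfolding N_def[symmetric] by blast
qed (use v_nz in auto)

lemma chiral_act: "act M (gen_elem g) (e2 B b) = map_poly (lin (e2 B)) (V2_act p s \<Delta> \<alpha> g b)"
proof (rule act_of_modes)
  fix n
  show "md g n (e2 B b) = fact n \<cdot> lin (e2 B) (coeff (V2_act p s \<Delta> \<alpha> g b) n)"
    by (cases g rule: gen_cases; cases b; cases n rule: nat_cases4;
        simp add: chiral_tables coeff_term lin2 smul_pCons lin_add D_add D_cm V.scale_right_distrib algebra_simps)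
qed

lemma isomorphic_V2: "isomorphic_upto_parity M (V2 p s \<Delta> \<alpha>)"
proof (rule isomorphic_free[where e = "e2 B" and f = "V2_act p s \<Delta> \<alpha>" and par = basis2_parity and i = i])
  show "ev (V2_act p s \<Delta> \<alpha> g b) b' d l = 0" if "basis2_parity b' \<noteq> gen_parity g + basis2_parity b" for g b b' d l
    using that by (rule V2_parity)
  show "act M (gen_elem g) (e2 B b) = map_poly (lin (e2 B)) (V2_act p s \<Delta> \<alpha> g b)" for g b
    by (rule chiral_act)
  show "e2 B b \<in> part M (basis2_parity b + i)" for b
    using v_part B_part by (cases b) (simp_all only: e2_simps basis2_parity.simps add_0 add.commute[of 1])
  show "q b = 0" if "(\<Sum>b\<in>UNIV. smul M (q b) (e2 B b)) = 0" for q b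
    using independent2[OF B_part chiral_X_nz that] .
qed (simp_all add: V2_def fin2 range_e2 chiral_span)

end

section \<open>The case \<open>G\<^sub>0\<^sup>-(0) v = 0\<close>, which leads to
  \<open>V1\<close>\<close>

context
  assumes c0: "c = 0" and Z0: "B = 0"
begin

lemma antichiral_vanish: "md (L (Suc j)) n u = 0" "md (J (Suc j)) n u = 0" "md (Gp (Suc j)) n u = 0" "md (Gm (Suc j)) n u = 0"
proof -
  have "vanish (Suc j)"
    using hw c0 vanish_ge_2[of "Suc j"] by (cases j) (simp_all add: highest_def)
  thus "md (L (Suc j)) n u = 0" "md (J (Suc j)) n u = 0" "md (Gp (Suc j)) n u = 0" "md (Gm (Suc j)) n u = 0"
    by (simp_all add: vanishD)
qed

lemma antichiral_Lambda: "\<Lambda> = - 2 * \<Delta>"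
  using B_md(7) Z0 s_nz v_nz by (simp add: eq_neg_iff_add_eq_0 add.commute)

lemma antichiral_md:
  "md (J 0) 0 v = (- 2 * \<Delta>) \<cdot> v" "md (J 0) 0 A = (1 - 2 * \<Delta>) \<cdot> A"
  "md (Gm 0) 0 v = 0" "md (Gp 0) 0 v = s \<cdot> A"
  "md (Gm 0) 0 A = (2 * s) \<cdot> y v" "md (Gm 0) (Suc 0) A = (2 * s * (2 * \<Delta>)) \<cdot> v"
  using v_md(3) v_G Z0 W_of_B_0
  by (simp_all add: A_md B_md A_Gm antichiral_Lambda  mult_ac)

lemmas antichiral_tables = antichiral_md v_md A_md L00 antichiral_vanish

lemma antichiral_X_nz: "A \<noteq> 0"
proof
  assume "A = 0"
  hence "(2 * s) \<cdot> y v = 0" using antichiral_md(5) by simp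
  hence "y v = 0" using s_nz by (simp only: V.scale_eq_0_iff) simp
  with L00_inj[of v] v_nz show False by (simp add: L00)
qed

text \<open>As in \<open>chiral_Delta\<close>, with \<open>A\<close> in place of
  \<open>B\<close>.\<close>

lemma antichiral_Delta: "\<Delta> \<noteq> 0"
proof
  assume \<Delta>: "\<Delta> = 0"
  define z where "z = y v"
  define N where "N = S.span {A, z}"
  have cl: "k \<cdot> u \<in> N" "D u \<in> N" "- u \<in> N" if "u \<in> N" for k u
    using span_closed[of u "{A, z}"] S.span_neg[of u "{A, z}"] that by (simp_all add: N_def)
  have cl2: "x + u \<in> N" "x - u \<in> N" if "x \<in> N" "u \<in> N" for x u
    using that by (simp_all add: N_def S.span_add S.span_diff)
  have base: "A \<in> N" "z \<in> N" "0 \<in> N"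
    unfolding N_def by (auto intro: S.span_base S.span_zero)
  have D0: "D 0 = 0" using D_add[of 0 0] by simp
  have 1: "md g n A \<in> N" for g n
    by (cases g rule: gen_cases; cases n rule: nat_cases4;
        simp add: antichiral_tables \<Delta> base cl cl2 flip: z_def)
  have 2: "md g n z \<in> N" for g n
    unfolding z_def y_md
    by (cases g rule: gen_cases; cases n rule: nat_cases4;
        simp add: antichiral_tables \<Delta> base cl cl2 D0 D_cm flip: z_def)
  show False
    using y_proper[OF A_part] 1 2 unfolding N_def z_def by blast
qed

lemma antichiral_span: "S.span {v, A} = UNIV"
proof (rule span_UNIV)
  show "\<exists>i. e \<in> part M i" if "e \<in> {v, A}" for e
    using that v_part A_part by blast
  define N where "N = S.span {v, A}"
  have cl: "k \<cdot> u \<in> N" "D u \<in> N" "- u \<in> N" if "u \<in> N" for k u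
    using span_closed[of u "{v, A}"] S.span_neg[of u "{v, A}"] that by (simp_all add: N_def)
  have cl2: "x + u \<in> N" "x - u \<in> N" if "x \<in> N" "u \<in> N" for x u
    using that by (simp_all add: N_def S.span_add S.span_diff)
  have base: "A \<in> N" "v \<in> N" "0 \<in> N"
    unfolding N_def by (auto intro: S.span_base S.span_zero)
  have "md g n A \<in> N" for g n
    by (cases g rule: gen_cases; cases n rule: nat_cases4; simp add: antichiral_tables base cl cl2)
  moreover have "md g n v \<in> N" for g n
    by (cases g rule: gen_cases; cases n rule: nat_cases4; simp add: antichiral_tables base cl cl2)
  ultimately show "md g n e \<in> S.span {v, A}" if "e \<in> {v, A}" for e g n
    using that unfolding N_def[symmetric] by blast
qed (use v_nz in auto)

lemma antichiral_act: "act M (gen_elem g) (e2 A b) = map_poly (lin (e2 A)) (V1_act p s \<Delta> \<alpha> g b)"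
proof (rule act_of_modes)
  fix n
  show "md g n (e2 A b) = fact n \<cdot> lin (e2 A) (coeff (V1_act p s \<Delta> \<alpha> g b) n)"
    by (cases g rule: gen_cases; cases b; cases n rule: nat_cases4;
        simp add: antichiral_tables coeff_term lin2 smul_pCons lin_add D_add D_cm V.scale_right_distrib algebra_simps)
qed

lemma isomorphic_V1: "isomorphic_upto_parity M (V1 p s \<Delta> \<alpha>)"
proof (rule isomorphic_free[where e = "e2 A" and f = "V1_act p s \<Delta> \<alpha>" and par = basis2_parity and i = i])
  show "ev (V1_act p s \<Delta> \<alpha> g b) b' d l = 0" if "basis2_parity b' \<noteq> gen_parity g + basis2_parity b" for g b b' d l
    using that by (rule V1_parity)
  show "act M (gen_elem g) (e2 A b) = map_poly (lin (e2 A)) (V1_act p s \<Delta> \<alpha> g b)" for g b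
    by (rule antichiral_act)
  show "e2 A b \<in> part M (basis2_parity b + i)" for b
    using v_part A_part by (cases b) (simp_all only: e2_simps basis2_parity.simps add_0 add.commute[of 1])
  show "q b = 0" if "(\<Sum>b\<in>UNIV. smul M (q b) (e2 A b)) = 0" for q b
    using independent2[OF A_part antichiral_X_nz that] .
qed (simp_all add: V1_def fin2 range_e2 antichiral_span)

end

text \<open>The only mode of positive degree that might not kill \<open>A\<close> is
  \<open>G\<^sub>0\<^sup>-(1)\<close>, whose value carries the factor
  \<open>2 \<Delta> - \<Lambda>\<close>.\<close>

lemma highest_A:
  assumes "c = 0" "2 * \<Delta> - \<Lambda> = 0" "A \<noteq> 0"
  shows "highest A (\<Delta> + 1/2) (\<Lambda> + 1) 0"
proof -
  have "md g n A = 0" if "g \<in> {J 0, Gp 0, Gm 0}" "n \<ge> 1" for g n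
    using that assms(2) A_md(4,5,7) A_md(6) by (cases n rule: nat_cases4) auto
  moreover have "md (L 0) n A = 0" if "n \<ge> 2" for n
    using that A_md(2) by (cases n rule: nat_cases4) auto
  moreover have v1: "vanish 1" using hw assms(1) by (simp add: highest_def)
  ultimately show ?thesis
    using assms A_md(1,3) hw v1[THEN vanishD(1)] v1[THEN vanishD(2)] v1[THEN vanishD(3)] v1[THEN vanishD(4)]
    by (simp add: highest_def kill1_def)
qed

lemma highest_B:
  assumes "c = 0" "2 * \<Delta> + \<Lambda> = 0" "B \<noteq> 0"
  shows "highest B (\<Delta> + 1/2) (\<Lambda> - 1) 0"
proof -
  have "md g n B = 0" if "g \<in> {J 0, Gp 0, Gm 0}" "n \<ge> 1" for g n
    using that assms(2) B_md(4,5,8) B_md(7) by (cases n rule: nat_cases4) auto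
  moreover have "md (L 0) n B = 0" if "n \<ge> 2" for n
    using that B_md(2) by (cases n rule: nat_cases4) auto
  moreover have v1: "vanish 1" using hw assms(1) by (simp add: highest_def)
  ultimately show ?thesis
    using assms B_md(1,3) hw v1[THEN vanishD(1)] v1[THEN vanishD(2)] v1[THEN vanishD(3)] v1[THEN vanishD(4)]
    by (simp add: highest_def kill1_def)
qed

text \<open>If \<open>A\<close> is nonzero, it replaces \<open>v\<close> as highest weight vector,
  with the opposite parity. It is killed by \<open>G\<^sub>0\<^sup>+(0)\<close>, so the case
  \<open>A = 0\<close> applies to it.\<close>

lemma ex_isomorphic_V2:
  assumes "c = 0" "2 * \<Delta> - \<Lambda> = 0"
  shows "\<exists>\<Delta> \<alpha>. \<Delta> \<noteq> 0 \<and> isomorphic_upto_parity M (V2 p s \<Delta> \<alpha>)"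
proof (cases "A = 0")
  case True
  with assms(1) chiral_Delta isomorphic_V2 show ?thesis by blast
next
  case False
  interpret A: K_hw p M s "\<Delta> + 1/2" "\<Lambda> + 1" 0 A "i + 1"
    by unfold_locales (rule s2 highest_A[OF assms False] A_part)+
  have "A.A = 0" by (simp add: A.A_def A_md)
  with A.chiral_Delta A.isomorphic_V2 show ?thesis by blast
qed

text \<open>The same argument with \<open>B\<close> and \<open>G\<^sub>0\<^sup>-(0)\<close>.\<close>

lemma ex_isomorphic_V1:
  assumes "c = 0" "2 * \<Delta> + \<Lambda> = 0"
  shows "\<exists>\<Delta> \<alpha>. \<Delta> \<noteq> 0 \<and> isomorphic_upto_parity M (V1 p s \<Delta> \<alpha>)"
proof (cases "B = 0")
  case True
  with assms(1) antichiral_Delta isomorphic_V1 show ?thesis by blast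
next
  case False
  interpret B: K_hw p M s "\<Delta> + 1/2" "\<Lambda> - 1" 0 B "i + 1"
    by unfold_locales (rule s2 highest_B[OF assms False] B_part)+
  have "B.B = 0" by (simp add: B.B_def B_md)
  with B.antichiral_Delta B.isomorphic_V1 show ?thesis by blast
qed

end

theorem theorem5p1:
  fixes p s :: complex
    and M :: "(gen free, 'm::ab_group_add) conf_mod"
  assumes "p \<noteq> 0" and "s^2 = p"
    and "conformal_module (K_alg p) M"
    and "nontrivial_module M" and "finite_module M" and "irreducible_module M"
  shows "(p \<noteq> - 1 \<longrightarrow>
           (\<exists>\<Delta> \<alpha>. \<Delta> \<noteq> 0 \<and>
              (isomorphic_upto_parity M (V1 p s \<Delta> \<alpha>) \<or> isomorphic_upto_parity M (V2 p s \<Delta> \<alpha>))) \<or>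
           (\<exists>\<Delta> \<Lambda> \<alpha>. 2 * \<Delta> + \<Lambda> \<noteq> 0 \<and> 2 * \<Delta> - \<Lambda> \<noteq> 0 \<and>
              isomorphic_upto_parity M (V4 p s \<Delta> \<Lambda> \<alpha>))) \<and>
         (p = - 1 \<longrightarrow>
           (\<exists>\<Delta> \<alpha>. \<Delta> \<noteq> 0 \<and>
              (isomorphic_upto_parity M (V1 p s \<Delta> \<alpha>) \<or> isomorphic_upto_parity M (V2 p s \<Delta> \<alpha>))) \<or>
           (\<exists>\<Delta> \<Lambda> \<alpha> \<beta>. (2 * \<Delta> + \<Lambda>, \<beta>) \<noteq> (0, 0) \<and> (2 * \<Delta> - \<Lambda>, \<beta>) \<noteq> (0, 0) \<and>
              isomorphic_upto_parity M (V4b s \<Delta> \<Lambda> \<alpha> \<beta>)))"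
proof -
  interpret K_irr p M
    using assms by (simp add: K_irr_def K_module_def K_irr_axioms_def)
  obtain v \<Delta> \<Lambda> c i where "highest v \<Delta> \<Lambda> c" "v \<in> part M i" by (rule ex_highest)
  then interpret K_hw p M s \<Delta> \<Lambda> c v i
    using assms(2) by unfold_locales
  \<comment> \<open>In the first two cases there is a highest weight vector killed by
    \<open>G\<^sub>0\<^sup>+(0)\<close> or by \<open>G\<^sub>0\<^sup>-(0)\<close>; in the third the
    four vectors are independent.\<close>
  consider "c = 0" "2 * \<Delta> - \<Lambda> = 0" | "c = 0" "2 * \<Delta> + \<Lambda> = 0"
    | "c \<noteq> 0 \<or> 2 * \<Delta> - \<Lambda> \<noteq> 0" "c \<noteq> 0 \<or> 2 * \<Delta> + \<Lambda> \<noteq> 0" by blast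
  thus ?thesis
  proof cases
    case 1
    from ex_isomorphic_V2[OF this] show ?thesis by blast
  next
    case 2
    from ex_isomorphic_V1[OF this] show ?thesis by blast
  next
    case 3
    show ?thesis
    proof (cases "p = - 1")
      case True
      have "(2 * \<Delta> + \<Lambda>, 2 * c * s) \<noteq> (0, 0)" "(2 * \<Delta> - \<Lambda>, 2 * c * s) \<noteq> (0, 0)"
        using 3 s_nz by auto
      with isomorphic_V4b[OF 3 True] True show ?thesis by blast
    next
      case False
      hence "c = 0" using hw by (auto simp: highest_def)
      with isomorphic_V4 3 False show ?thesis by blast
    qed
  qed
qed

end
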